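(* Fix $a\in[0,1]$ and assume that $\hat P\in\mathbb{R}^r$ is an estimator satisfying $n^{-1}\sum_{i=1}^nh(Y_i,\hat P)=o_{\mathrm{pr}}(1/\sqrt n)$ for some function $h\colon\mathbb{R}^{d+r}\to\mathbb{R}^r$, and that $\hat P$ is used as a plug-in estimator for $P$ in the empirical likelihood part of $h_n$. Let $P_0$ be the unique root of $P\mapsto\mathrm{E}\,h(Y,P)$. Let $u(y,\theta)=\nabla_\theta\log f_\theta(y)$ be the score function of the parametric family, and let $\hat\theta(\hat P)$ be the maximizer and unique critical point of $h_n$. Define $$\psi_P(y,\theta,P)=(1-a)\log f_\theta(y)-a\log\{1+\lambda(\theta,P)^Tm[y,\mu(\theta,P),P]\}.$$ For each $P$ assume that $\theta(P)$ maximizes and is the unique critical point of $\theta\mapsto\mathrm{E}\,\psi_P(Y,\theta,P)$, and set $\theta_0=\theta(P_0)$. Assume there exists a neighbourhood $\mathcal N$ of $\alpha_0=(\theta_0^T,\lambda(\theta_0,P_0)^T,P_0^T)^T$ such that: (i) on $\mathcal N$, $\mu(\theta,P)$ is twice continuously differentiable, and the function $$(\theta,\lambda,P)\mapsto\mathrm{E}\left\{\left(\partial_\theta\psi_P(Y,\theta,P),\ \frac{M(\theta,P)^T}{1+\lambda^TM(\theta,P)},\ h(Y,P)^T\right)^T\right\}$$ is continuously differentiable; (ii) on $\mathcal N$, the norm of $m$ and all first order partial derivatives of $m$ with respect to $\mu$ and $P$ are bounded by functions of $y$ not depending on $\mu$ or $P$ with finite fourth moments under $F$; and all second order partial derivatives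 of $m$, the score function $u$, and all partial derivatives of $u$ with respect to $\theta$ are bounded by $F$-square integrable functions of $y$ (not depending on the parameters); (iii) the function displayed in (i) has non-singular derivative at $\alpha_0$; (iv) there exists $L>0$ such that $\Pr(1+\lambda^TM(\theta,P)>L)=1$ for all $(\theta,\lambda,P)\in\mathcal N$; (v) on $\mathcal N$ the norms of $h$ and $\partial h/\partial P$ are bounded by $F$-square integrable functions not depending on $P$ or $\theta$. Then $\hat\theta(\hat P)$ is consistent for $\theta_0=\theta(P_0)$ and $$\hat\theta(\hat P)=\hat\theta(P_0)+\theta'(P_0)(\hat P-P_0)+o_{\mathrm{pr}}(1/\sqrt n),$$ where $\hat\theta(P_0)$ is the maximum hybrid likelihood estimator obtained when $P$ is fixed at $P_0$ in the estimating function, and $\theta'(P_0)$ is the Jacobian matrix of $P\mapsto\theta(P)$ at $P_0$.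
   Context: $Y_1,\ldots,Y_n\in\mathbb{R}^d$ are i.i.d. from a distribution $F$, and $Y\sim F$ denotes a generic copy; expectations and probabilities are under $F$ unless stated otherwise. $m\colon\mathbb{R}^{d+s+r}\to\mathbb{R}^q$, $(y,\mu,P)\mapsto m(y,\mu,P)$, is an estimating function for a control parameter $\mu\in\mathbb{R}^s$ depending on an additional parameter $P\in\mathbb{R}^r$. $\{f_\theta\}_{\theta\in\Theta}$, $\Theta\subseteq\mathbb{R}^p$, is a parametric family of densities, not assumed to contain the density of $F$. $\mu(\theta,P)$ is the solution of $\mathrm{E}_{f_\theta}\{m[Y,\mu(\theta,P),P]\}=0$. For a fixed value of $P$, the empirical likelihood function is $$\mathrm{EL}_n(\mu,P)=\max\Big\{\prod_{i=1}^nw_i\colon \sum_{i=1}^nw_i=1,\ \sum_{i=1}^nw_im(Y_i,\mu,P)=0,\ w_i\ge0\Big\},$$ equal to $0$ if the constraints cannot be satisfied. The hybrid log-likelihood with $P$ plugged in is $(1-a)\ell_n(\theta)+a\log\mathrm{EL}_n[\mu(\theta,P),P]$ with $\ell_n(\theta)=\sum_{i=1}^n\log f_\theta(Y_i)$ (for $a=1$ only the empirical likelihood term is kept). $h_n$ denotes this function with $P=\hat P$, and the maximum hybrid likelihood (MHL) estimator is its maximizer over $\theta$. Notation: $M(\theta,P)=m[Y,\mu(\theta,P),P]$. $\lambda(\theta,P)\in\mathbb{R}^q$ is the (unique) solution of $0=\mathrm{E}\{M(\theta,P)/[1+\lambda^TM(\theta,P)]\}$ (with $\Pr(1+\lambda^TM(\theta,P)\le0)=0$).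 $\partial_\theta\psi_P$ is the derivative (row vector) of $\theta\mapsto\psi_P(y,\theta,P)$, including the dependence through $\lambda(\theta,P)$ and $\mu(\theta,P)$. $o_{\mathrm{pr}}(r_n)$ denotes a term which, divided by $r_n$, tends to $0$ in probability.
   Formalization: The estimator P̂ is additionally assumed consistent for P₀, since an approximate root of the h-equation need not be near P₀, and θ̂(P₀), like θ̂(P̂), is taken to be the maximizer and unique critical point of its hybrid likelihood (with probability tending to one). *)

theory Defs
  imports "HOL-Probability.Probability"
begin

section \<open>Extended-real log-likelihoods\<close>

text \<open>Likelihoods may vanish, and the real \<open>ln\<close> takes a junk value at \<open>0\<close>. Log-likelihoods are
  therefore extended-real-valued, with \<open>log 0 = - \<infinity>\<close>. The convention \<open>0 * (- \<infinity>) = 0\<close> of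
  \<^typ>\<open>ereal\<close> removes the parametric term for \<open>a = 1\<close> and the empirical likelihood term for
  \<open>a = 0\<close>.\<close>

definition elog :: "real \<Rightarrow> ereal" where
  "elog x = (if 0 < x then ereal (ln x) else - \<infinity>)"

text \<open>Expectation of the positive part minus expectation of the negative part. If both are infinite,
  the \<^typ>\<open>ereal\<close> difference is \<open>\<infinity>\<close>, so a function \<open>\<theta> \<mapsto> E g\<^sub>\<theta>\<close> with a finite
  maximum has a well-defined expectation everywhere.\<close>

definition eexpectation :: "'a measure \<Rightarrow> ('a \<Rightarrow> ereal) \<Rightarrow> ereal" where
  "eexpectation F g =
     enn2ereal (\<integral>\<^sup>+ y. e2ennreal (g y) \<partial>F) - enn2ereal (\<integral>\<^sup>+ y. e2ennreal (- g y) \<partial>F)"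

definition has_egrad :: "('a::real_inner \<Rightarrow> ereal) \<Rightarrow> 'a \<Rightarrow> 'a \<Rightarrow> bool" where
  "has_egrad H v x \<longleftrightarrow>
     (\<forall>\<^sub>F t in nhds x. \<bar>H t\<bar> \<noteq> \<infinity>) \<and> GDERIV (\<lambda>t. real_of_ereal (H t)) x :> v"

definition egrad :: "('a::real_inner \<Rightarrow> ereal) \<Rightarrow> 'a \<Rightarrow> 'a" where
  "egrad H x = (THE v. has_egrad H v x)"

definition sole_critical_maximizer :: "'a::real_inner set \<Rightarrow> ('a \<Rightarrow> ereal) \<Rightarrow> 'a \<Rightarrow> bool" where
  "sole_critical_maximizer S H x \<longleftrightarrow>
     x \<in> S \<and> (\<forall>t\<in>S. H t \<le> H x) \<and> (\<forall>t. t \<in> interior S \<and> has_egrad H 0 t \<longleftrightarrow> t = x)"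


section \<open>Stochastic order\<close>

text \<open>Outer measure, which agrees with the measure on events, makes these notions meaningful without
  measurability of the estimators.\<close>

definition with_prob_tending_to_one :: "'w measure \<Rightarrow> (nat \<Rightarrow> 'w \<Rightarrow> bool) \<Rightarrow> bool" where
  "with_prob_tending_to_one M Q \<longleftrightarrow>
     (\<lambda>n. outer_measure_of M {\<omega> \<in> space M. \<not> Q n \<omega>}) \<longlonglongrightarrow> 0"

definition o_pr :: "'w measure \<Rightarrow> (nat \<Rightarrow> real) \<Rightarrow> (nat \<Rightarrow> 'w \<Rightarrow> 'b::real_normed_vector) \<Rightarrow> bool" where
  "o_pr M r X \<longleftrightarrow>
     (\<forall>\<epsilon>>0. (\<lambda>n. outer_measure_of M {\<omega> \<in> space M. norm (X n \<omega> /\<^sub>R r n) > \<epsilon>}) \<longlonglongrightarrow> 0)"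

definition consistent_for :: "'w measure \<Rightarrow> (nat \<Rightarrow> 'w \<Rightarrow> 'b::real_normed_vector) \<Rightarrow> 'b \<Rightarrow> bool" where
  "consistent_for M T t \<longleftrightarrow> o_pr M (\<lambda>n. 1) (\<lambda>n \<omega>. T n \<omega> - t)"


section \<open>Smoothness\<close>

definition C1_on :: "'a::real_normed_vector set \<Rightarrow> ('a \<Rightarrow> 'b::real_normed_vector) \<Rightarrow> bool" where
  "C1_on S g \<longleftrightarrow> (\<exists>g' :: 'a \<Rightarrow> 'a \<Rightarrow>\<^sub>L 'b.
     (\<forall>x\<in>S. (g has_derivative blinfun_apply (g' x)) (at x)) \<and> continuous_on S g')"

definition C2_on :: "'a::real_normed_vector set \<Rightarrow> ('a \<Rightarrow> 'b::real_normed_vector) \<Rightarrow> bool" where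
  "C2_on S g \<longleftrightarrow> (\<exists>g' :: 'a \<Rightarrow> 'a \<Rightarrow>\<^sub>L 'b.
     (\<forall>x\<in>S. (g has_derivative blinfun_apply (g' x)) (at x)) \<and> C1_on S g')"

text \<open>Applied to basis vectors, the derivative gives the partial derivatives.\<close>

definition partials_bounded ::
    "('a::euclidean_space \<Rightarrow> 'b::real_normed_vector) \<Rightarrow> 'a \<Rightarrow> real \<Rightarrow> bool" where
  "partials_bounded g x B \<longleftrightarrow>
     (\<exists>g'. (g has_derivative g') (at x) \<and> (\<forall>b\<in>Basis. norm (g' b) \<le> B))"

definition second_partials_bounded ::
    "('a::euclidean_space \<Rightarrow> 'b::real_normed_vector) \<Rightarrow> 'a \<Rightarrow> real \<Rightarrow> bool" where
  "second_partials_bounded g x B \<longleftrightarrow>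
     (\<exists>(g' :: 'a \<Rightarrow> 'a \<Rightarrow>\<^sub>L 'b) g''.
        (\<forall>\<^sub>F z in nhds x. (g has_derivative blinfun_apply (g' z)) (at z)) \<and>
        (g' has_derivative g'') (at x) \<and>
        (\<forall>b\<in>Basis. \<forall>c\<in>Basis. norm (blinfun_apply (g'' b) c) \<le> B))"


section \<open>Hybrid likelihood\<close>

definition zero_mean :: "'a measure \<Rightarrow> ('a \<Rightarrow> 'b::euclidean_space) \<Rightarrow> bool" where
  "zero_mean D g \<longleftrightarrow> integrable D g \<and> integral\<^sup>L D g = 0"

text \<open>The sample is \<open>y 0, \<dots>, y (n - 1)\<close>. The supremum is attained when the constraint set is
  nonempty, by compactness.\<close>

definition emp_lik ::
    "('y \<Rightarrow> 's \<Rightarrow> 'r \<Rightarrow> 'q::real_vector) \<Rightarrow> nat \<Rightarrow> (nat \<Rightarrow> 'y) \<Rightarrow> 's \<Rightarrow> 'r \<Rightarrow> real" where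
  "emp_lik m n y \<mu> P =
     (let A = {\<Prod>i<n. w i | w :: nat \<Rightarrow> real.
                 (\<Sum>i<n. w i) = 1 \<and> (\<Sum>i<n. w i *\<^sub>R m (y i) \<mu> P) = 0 \<and> (\<forall>i<n. 0 \<le> w i)}
      in if A = {} then 0 else Sup A)"

definition hybrid_loglik ::
    "real \<Rightarrow> ('p \<Rightarrow> 'y \<Rightarrow> real) \<Rightarrow> ('y \<Rightarrow> 's \<Rightarrow> 'r \<Rightarrow> 'q::real_vector) \<Rightarrow> ('p \<Rightarrow> 'r \<Rightarrow> 's)
      \<Rightarrow> nat \<Rightarrow> (nat \<Rightarrow> 'y) \<Rightarrow> 'p \<Rightarrow> 'r \<Rightarrow> ereal" where
  "hybrid_loglik a f m mu n y \<theta> P =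
     ereal (1 - a) * (\<Sum>i<n. elog (f \<theta> (y i))) + ereal a * elog (emp_lik m n y (mu \<theta> P) P)"

definition el_multiplier :: "'y measure \<Rightarrow> ('y \<Rightarrow> 'q::euclidean_space) \<Rightarrow> 'q \<Rightarrow> bool" where
  "el_multiplier F g l \<longleftrightarrow>
     (AE y in F. 1 + l \<bullet> g y > 0) \<and> zero_mean F (\<lambda>y. g y /\<^sub>R (1 + l \<bullet> g y))"

definition score :: "('p::real_inner \<Rightarrow> 'y \<Rightarrow> real) \<Rightarrow> 'y \<Rightarrow> 'p \<Rightarrow> 'p" where
  "score f y \<theta> = egrad (\<lambda>t. elog (f t y)) \<theta>"

definition psi ::
    "real \<Rightarrow> ('p \<Rightarrow> 'y \<Rightarrow> real) \<Rightarrow> ('y \<Rightarrow> 's \<Rightarrow> 'r \<Rightarrow> 'q::real_inner) \<Rightarrow> ('p \<Rightarrow> 'r \<Rightarrow> 's)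
      \<Rightarrow> ('p \<Rightarrow> 'r \<Rightarrow> 'q) \<Rightarrow> 'y \<Rightarrow> 'p \<Rightarrow> 'r \<Rightarrow> ereal" where
  "psi a f m mu lam y \<theta> P =
     ereal (1 - a) * elog (f \<theta> y) - ereal a * elog (1 + lam \<theta> P \<bullet> m y (mu \<theta> P) P)"

text \<open>In the first component the multiplier is \<open>lam \<theta> P\<close>, in the second it is the free
  argument \<open>l\<close>.\<close>

definition joint_est_fun ::
    "real \<Rightarrow> ('p::real_inner \<Rightarrow> 'y \<Rightarrow> real) \<Rightarrow> ('y \<Rightarrow> 's \<Rightarrow> 'r \<Rightarrow> 'q::real_inner) \<Rightarrow> ('p \<Rightarrow> 'r \<Rightarrow> 's)
      \<Rightarrow> ('p \<Rightarrow> 'r \<Rightarrow> 'q) \<Rightarrow> ('y \<Rightarrow> 'r \<Rightarrow> 'r) \<Rightarrow> 'p \<times> 'q \<times> 'r \<Rightarrow> 'y \<Rightarrow> 'p \<times> 'q \<times> 'r" where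
  "joint_est_fun a f m mu lam h = (\<lambda>(\<theta>, l, P) y.
     (egrad (\<lambda>t. psi a f m mu lam y t P) \<theta>,
      m y (mu \<theta> P) P /\<^sub>R (1 + l \<bullet> m y (mu \<theta> P) P),
      h y P))"

definition expected_est_fun ::
    "'y measure \<Rightarrow> real \<Rightarrow> ('p::euclidean_space \<Rightarrow> 'y \<Rightarrow> real)
      \<Rightarrow> ('y \<Rightarrow> 's \<Rightarrow> 'r::euclidean_space \<Rightarrow> 'q::euclidean_space) \<Rightarrow> ('p \<Rightarrow> 'r \<Rightarrow> 's)
      \<Rightarrow> ('p \<Rightarrow> 'r \<Rightarrow> 'q) \<Rightarrow> ('y \<Rightarrow> 'r \<Rightarrow> 'r) \<Rightarrow> 'p \<times> 'q \<times> 'r \<Rightarrow> 'p \<times> 'q \<times> 'r" where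
  "expected_est_fun F a f m mu lam h \<alpha> = (\<integral>y. joint_est_fun a f m mu lam h \<alpha> y \<partial>F)"

end

theory Submission
  imports Defs
begin

text \<open>
  Let \<open>S(y, \<theta>, \<lambda>, P)\<close> collect the gradient in \<open>\<theta>\<close> of the criterion with the multiplier
  \<open>\<lambda>\<close> held fixed, the multiplier equation, and \<open>h\<close>. By the envelope principle, the zeros of the
  first two components of the sample mean of \<open>S\<close> are critical points of the hybrid likelihood, and
  the zeros of their expectation are \<open>(\<theta>(P), \<lambda>(\<theta>(P), P))\<close>. Since \<open>S\<close> is differentiable at
  \<open>\<alpha>\<^sub>0\<close> and Lipschitz with a square-integrable constant, the sample mean of \<open>S\<close> equals its
  linearization at \<open>\<alpha>\<^sub>0\<close> up to an error \<open>\<epsilon> \<bar>z - \<alpha>\<^sub>0\<bar>\<close>, uniformly on a ball, with probability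
  tending to one. Brouwer's theorem then gives zeros at distance \<open>O(1/\<surd>n)\<close> from \<open>\<alpha>\<^sub>0\<close>, for \<open>P\<close>
  equal to the plug-in value and for \<open>P\<^sub>0\<close>. By uniqueness of the critical point they are the two
  estimators, which gives consistency, and subtracting the two linearizations gives the expansion.
\<close>

section \<open>Roots, implicit functions and derivatives of expectations\<close>

text \<open>The obstacle is the first component of the function in (i): it differentiates in
  \<theta> through the population multiplier \<open>lam\<close>, whereas the sample criterion has
  its own multiplier. Hence the passage to \<open>S\<close>, and the task of carrying (iii) over to
  the expectation of \<open>S\<close>. The two expectations agree in the last two components. In the
  first, the function in (i) does not see the free multiplier and equals the expectation of
  \<open>S\<close> on the graph of \<open>lam\<close>; so a kernel vector must be tangent to that
  graph, and (iii) then kills it. The population and the sample multiplier both get their derivative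
  from the implicit function lemma, because their block is a negative definite Gram matrix. Second
  derivatives are bounded without being continuous, so the zeros near \<alpha>0 come without local
  uniqueness, and only the uniqueness of the critical point identifies them. The rate: the error is
  \<epsilon> times a tight multiple of 1/sqrt n, and \<epsilon> is chosen after the tightness
  bound.\<close>

lemma brouwer_root:
  fixes \<phi> :: "'a::euclidean_space \<Rightarrow> 'a"
  assumes D: "bounded_linear D" "bounded_linear D'" "\<And>x. D' (D x) = x" "\<And>x. D (D' x) = x"
    and B: "0 < B" "\<And>x. norm (D' x) \<le> B * norm x"
    and \<eta>: "0 < \<eta>" "2 * B * \<eta> \<le> r"
    and cont: "continuous_on (cball x0 r) \<phi>"
    and bound: "\<And>x. x \<in> cball x0 r \<Longrightarrow> norm (\<phi> x - D (x - x0)) \<le> norm (x - x0) / (2 * B) + \<eta>"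
  shows "\<exists>x \<in> cball x0 (2 * B * \<eta>). \<phi> x = 0"
proof -
  interpret D: bounded_linear D by fact
  interpret D': bounded_linear D' by fact
  let ?\<rho> = "2 * B * \<eta>"
  \<comment> \<open>Newton map with the derivative frozen at \<open>x0\<close>; a fixed point is a
    zero because \<open>D'\<close> is injective. The radius \<open>2 * B * \<eta>\<close> is the
    smallest \<rho> with \<rho>/2 + B \<eta> \<le> \<rho>, the bound that \<open>T\<close>
    satisfies.\<close>
  define T where "T x = x - D' (\<phi> x)" for x
  have "?\<rho> > 0" using B \<eta> by simp
  moreover have "continuous_on (cball x0 ?\<rho>) T"
    unfolding T_def
    by (intro continuous_intros D'.continuous_on continuous_on_subset[OF cont]) (use \<eta> in auto)
  moreover have "T \<in> cball x0 ?\<rho> \<rightarrow> cball x0 ?\<rho>"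
  proof
    fix x assume x: "x \<in> cball x0 ?\<rho>"
    have "T x - x0 = - D' (\<phi> x - D (x - x0))"
      by (simp add: T_def D'.diff D(3))
    then have "norm (T x - x0) \<le> B * norm (\<phi> x - D (x - x0))"
      using B(2) by simp
    also have "\<dots> \<le> B * (norm (x - x0) / (2 * B) + \<eta>)"
      using x \<eta> B by (intro mult_left_mono bound) auto
    also have "\<dots> = norm (x - x0) / 2 + B * \<eta>" using B by (simp add: field_simps)
    also have "\<dots> \<le> ?\<rho>" using x by (auto simp: dist_norm norm_minus_commute)
    finally show "T x \<in> cball x0 ?\<rho>" by (simp add: dist_norm norm_minus_commute)
  qed
  ultimately obtain x where x: "x \<in> cball x0 ?\<rho>" "T x = x"
    by (rule brouwer_ball)
  then have "D' (\<phi> x) = 0" by (simp add: T_def)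
  then have "\<phi> x = 0" using D(4)[of "\<phi> x"] by (simp add: D.zero)
  then show ?thesis using x by blast
qed

lemma injective_linear_inverse:
  fixes D :: "'a::euclidean_space \<Rightarrow> 'a"
  assumes "bounded_linear D" "\<And>v. D v = 0 \<Longrightarrow> v = 0"
  obtains D' B where "bounded_linear D'" "\<And>x. D' (D x) = x" "\<And>x. D (D' x) = x"
    "B > 0" "\<And>x. norm (D' x) \<le> B * norm x"
proof -
  have lin: "linear D" using assms(1) by (simp add: linear_conv_bounded_linear)
  have "inj D" using assms(2) by (simp add: linear_injective_0[OF lin])
  then obtain D' where D': "linear D'" "\<forall>x. D' (D x) = x" "\<forall>x. D (D' x) = x"
    using linear_injective_isomorphism[OF lin] by blast
  then have "bounded_linear D'" by (simp add: linear_conv_bounded_linear)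
  moreover then obtain B where "B > 0" "\<And>x. norm (D' x) \<le> norm x * B"
    using bounded_linear.pos_bounded by blast
  ultimately show ?thesis using that[of D' B] D' by (simp add: mult.commute)
qed

text \<open>Differentiability is only required at the base point, so the solution is neither unique nor
  continuous; Brouwer's theorem replaces the contraction argument.\<close>

lemma implicit_function_at:
  fixes \<Phi> :: "'a::euclidean_space \<times> 'b::real_normed_vector \<Rightarrow> 'a"
  assumes der: "(\<Phi> has_derivative D) (at (x0, z0))"
    and zero: "\<Phi> (x0, z0) = 0"
    and inj: "\<And>v. D (v, 0) = 0 \<Longrightarrow> v = 0"
    and U: "open U" "(x0, z0) \<in> U"
    and cont: "continuous_on U \<Phi>"
  obtains X X' where "(X has_derivative X') (at z0)" "\<And>v. D (X' v, v) = 0" "X z0 = x0"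
    "\<forall>\<^sub>F z in nhds z0. (X z, z) \<in> U \<and> \<Phi> (X z, z) = 0"
proof -
  have Dbl: "bounded_linear D" using der by (rule has_derivative_bounded_linear)
  interpret D: bounded_linear D by fact
  define Dx where "Dx v = D (v, 0)" for v
  define Dz where "Dz v = D (0, v)" for v
  have Dx: "bounded_linear Dx" unfolding Dx_def
    by (rule bounded_linear_compose[OF Dbl]) (intro bounded_linear_Pair bounded_linear_ident bounded_linear_zero)
  have Dz: "bounded_linear Dz" unfolding Dz_def
    by (rule bounded_linear_compose[OF Dbl]) (intro bounded_linear_Pair bounded_linear_ident bounded_linear_zero)
  have split: "D (u, v) = Dx u + Dz v" for u v
    using D.add[of "(u, 0)" "(0, v)"] by (simp add: Dx_def Dz_def)
  obtain D' B where D': "bounded_linear D'" "\<And>x. D' (Dx x) = x" "\<And>x. Dx (D' x) = x"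
    and B: "B > 0" "\<And>x. norm (D' x) \<le> B * norm x"
    using injective_linear_inverse[OF Dx] inj unfolding Dx_def by metis
  interpret D': bounded_linear D' by (rule D'(1))
  interpret Dx: bounded_linear Dx by (rule Dx)
  obtain Cz where Cz: "Cz > 0" "\<And>v. norm (Dz v) \<le> norm v * Cz"
    using bounded_linear.pos_bounded[OF Dz] by blast
  have lin: "\<exists>\<delta>>0. \<forall>x z. norm (x - x0) \<le> \<delta> \<and> norm (z - z0) \<le> \<delta> \<longrightarrow>
       norm (\<Phi> (x, z) - Dx (x - x0) - Dz (z - z0)) \<le> \<epsilon> * (norm (x - x0) + norm (z - z0))"
    if "\<epsilon> > 0" for \<epsilon>
  proof -
    from der that obtain d where d: "d > 0" "\<And>p. norm (p - (x0, z0)) < d \<Longrightarrow>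
        norm (\<Phi> p - \<Phi> (x0, z0) - D (p - (x0, z0))) \<le> \<epsilon> * norm (p - (x0, z0))"
      unfolding has_derivative_at_alt by blast
    have "norm (\<Phi> (x, z) - Dx (x - x0) - Dz (z - z0)) \<le> \<epsilon> * (norm (x - x0) + norm (z - z0))"
      if "norm (x - x0) \<le> d / 3" "norm (z - z0) \<le> d / 3" for x z
    proof -
      have n: "norm ((x, z) - (x0, z0)) \<le> norm (x - x0) + norm (z - z0)"
        by (simp add: norm_Pair_le)
      then have "norm ((x, z) - (x0, z0)) < d" using that d(1) by simp
      from d(2)[OF this] have "norm (\<Phi> (x, z) - Dx (x - x0) - Dz (z - z0)) \<le> \<epsilon> * norm ((x, z) - (x0, z0))"
        by (simp add: zero split algebra_simps)
      also have "\<dots> \<le> \<epsilon> * (norm (x - x0) + norm (z - z0))"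
        using n \<open>\<epsilon> > 0\<close> by simp
      finally show ?thesis .
    qed
    then show ?thesis using d(1) by (intro exI[of _ "d / 3"]) auto
  qed
  \<comment> \<open>The accuracy 1/(2B) is what \<open>brouwer_root\<close> tolerates in
    \<open>x\<close>; the part in \<open>z\<close> goes into its constant \<eta>.\<close>
  obtain \<delta>1 where \<delta>1: "\<delta>1 > 0" "\<And>x z. norm (x - x0) \<le> \<delta>1 \<Longrightarrow> norm (z - z0) \<le> \<delta>1 \<Longrightarrow>
       norm (\<Phi> (x, z) - Dx (x - x0) - Dz (z - z0)) \<le> 1 / (2 * B) * (norm (x - x0) + norm (z - z0))"
    using lin[of "1 / (2 * B)"] B(1) by (metis divide_pos_pos mult_pos_pos zero_less_numeral zero_less_one)
  obtain \<delta>2 where \<delta>2: "\<delta>2 > 0" "cball x0 \<delta>2 \<times> cball z0 \<delta>2 \<subseteq> U"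
  proof -
    obtain A1 A2 where A: "open A1" "open A2" "x0 \<in> A1" "z0 \<in> A2" "A1 \<times> A2 \<subseteq> U"
      using open_prod_elim[OF U] by (metis mem_Sigma_iff)
    obtain e1 where e1: "e1 > 0" "cball x0 e1 \<subseteq> A1"
      using A(1,3) open_contains_cball by blast
    obtain e2 where e2: "e2 > 0" "cball z0 e2 \<subseteq> A2"
      using A(2,4) open_contains_cball by blast
    have "cball x0 (min e1 e2) \<times> cball z0 (min e1 e2) \<subseteq> cball x0 e1 \<times> cball z0 e2"
      by (intro Sigma_mono) auto
    also have "\<dots> \<subseteq> U" using A(5) e1(2) e2(2) by blast
    finally show ?thesis using e1(1) e2(1) by (intro that[of "min e1 e2"]) simp_all
  qed
  \<comment> \<open>With \<eta> as below, the ball of \<open>brouwer_root\<close> has radius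
    \<open>C * norm (z - z0)\<close>. The resulting Lipschitz estimate at \<open>z0\<close> is what
    makes \<open>X\<close> differentiable there.\<close>
  define C where "C = 2 * B * (Cz + 1 / (2 * B))"
  have C: "C > 0" unfolding C_def using B Cz by (intro mult_pos_pos add_pos_pos) auto
  define r where "r = min \<delta>1 \<delta>2"
  have r: "r > 0" using \<delta>1 \<delta>2 by (simp add: r_def)
  define s where "s = min r (r / C)"
  have s: "s > 0" using r C by (simp add: s_def)
  have "\<exists>x. norm (x - x0) \<le> C * norm (z - z0) \<and> norm (x - x0) \<le> r \<and> \<Phi> (x, z) = 0"
    if z: "norm (z - z0) \<le> s" for z
  proof (cases "z = z0")
    \<comment> \<open>\<open>brouwer_root\<close> wants a positive \<eta>, so the base point is
      treated on its own. This also forces \<open>X z0 = x0\<close>.\<close>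
    case True then show ?thesis using zero r by (intro exI[of _ x0]) auto
  next
    case False
    define \<eta> where "\<eta> = (Cz + 1 / (2 * B)) * norm (z - z0)"
    have zs: "norm (z - z0) \<le> r" "norm (z - z0) \<le> r / C" using z by (auto simp: s_def)
    have e1: "2 * B * \<eta> = C * norm (z - z0)" by (simp add: C_def \<eta>_def)
    have "\<eta> > 0" unfolding \<eta>_def using False B Cz by (intro mult_pos_pos add_pos_pos) auto
    moreover have le: "2 * B * \<eta> \<le> r" unfolding e1 using zs(2) C by (simp add: field_simps)
    moreover have "continuous_on (cball x0 r) (\<lambda>x. \<Phi> (x, z))"
      by (rule continuous_on_compose2[OF cont])
         (use \<delta>2(2) zs in \<open>auto intro!: continuous_intros simp: r_def dist_norm norm_minus_commute subset_iff\<close>)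
    moreover have "norm (\<Phi> (x, z) - Dx (x - x0)) \<le> norm (x - x0) / (2 * B) + \<eta>" if "x \<in> cball x0 r" for x
    proof -
      have "norm (\<Phi> (x, z) - Dx (x - x0)) \<le> norm (\<Phi> (x, z) - Dx (x - x0) - Dz (z - z0)) + norm (Dz (z - z0))"
        by (metis norm_triangle_sub add.commute)
      also have "\<dots> \<le> 1 / (2 * B) * (norm (x - x0) + norm (z - z0)) + norm (z - z0) * Cz"
        using that zs by (intro add_mono \<delta>1 Cz) (auto simp: r_def dist_norm norm_minus_commute)
      also have "\<dots> = norm (x - x0) / (2 * B) + \<eta>" by (simp add: \<eta>_def algebra_simps add_divide_distrib)
      finally show ?thesis .
    qed
    ultimately obtain x where "x \<in> cball x0 (2 * B * \<eta>)" "\<Phi> (x, z) = 0"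
      using brouwer_root[OF Dx D' B, of \<eta> r x0 "\<lambda>x. \<Phi> (x, z)"] by blast
    then show ?thesis using le e1 by (intro exI[of _ x]) (auto simp: dist_norm norm_minus_commute)
  qed
  then obtain X where X: "\<And>z. norm (z - z0) \<le> s \<Longrightarrow>
     norm (X z - x0) \<le> C * norm (z - z0) \<and> norm (X z - x0) \<le> r \<and> \<Phi> (X z, z) = 0"
    by metis
  have X0: "X z0 = x0" using X[of z0] s by simp
  \<comment> \<open>Implicit differentiation: solve \<open>Dx u + Dz v = 0\<close> for
    \<open>u\<close>.\<close>
  define X' where "X' v = - D' (Dz v)" for v
  have X'bl: "bounded_linear X'" unfolding X'_def
    by (intro bounded_linear_minus bounded_linear_compose[OF D'(1) Dz])
  have "D (X' v, v) = 0" for v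
    by (simp add: split X'_def Dx.neg D'(3))
  moreover have "(X has_derivative X') (at z0)"
    unfolding has_derivative_at_alt
  proof (intro conjI allI impI X'bl)
    fix e :: real assume e: "e > 0"
    \<comment> \<open>\<open>B\<close> is the cost of applying \<open>D'\<close>, and C + 1 bounds
      \<open>norm (x - x0) + norm (z - z0)\<close> by a multiple of
      \<open>norm (z - z0)\<close>.\<close>
    define \<epsilon> where "\<epsilon> = e / (B * (C + 1))"
    have \<epsilon>: "\<epsilon> > 0" using e B C by (simp add: \<epsilon>_def)
    obtain \<delta> where \<delta>: "\<delta> > 0" "\<And>x z. norm (x - x0) \<le> \<delta> \<Longrightarrow> norm (z - z0) \<le> \<delta> \<Longrightarrow>
       norm (\<Phi> (x, z) - Dx (x - x0) - Dz (z - z0)) \<le> \<epsilon> * (norm (x - x0) + norm (z - z0))"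
      using lin[OF \<epsilon>] by blast
    define d where "d = min s (min \<delta> (\<delta> / C))"
    have "d > 0" using s \<delta> C by (simp add: d_def)
    moreover have "norm (X z - X z0 - X' (z - z0)) \<le> e * norm (z - z0)" if "norm (z - z0) < d" for z
    proof -
      have zs: "norm (z - z0) \<le> s" "norm (z - z0) \<le> \<delta>" "norm (z - z0) \<le> \<delta> / C"
        using that by (auto simp: d_def)
      note Xz = X[OF zs(1)]
      have "C * norm (z - z0) \<le> \<delta>" using zs(3) C by (simp add: field_simps)
      then have "norm (X z - x0) \<le> \<delta>" using Xz by linarith
      then have b: "norm (Dx (X z - x0) + Dz (z - z0)) \<le> \<epsilon> * (norm (X z - x0) + norm (z - z0))"
      proof -
        have "0 - Dx (X z - x0) - Dz (z - z0) = - (Dx (X z - x0) + Dz (z - z0))" by simp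
        with \<delta>(2)[OF \<open>norm (X z - x0) \<le> \<delta>\<close> zs(2)] Xz show ?thesis
          by (simp only: norm_minus_cancel)
      qed
      have "X z - X z0 - X' (z - z0) = D' (Dx (X z - x0) + Dz (z - z0))"
        by (simp add: X0 X'_def D'.add D'(2))
      then have "norm (X z - X z0 - X' (z - z0)) \<le> B * norm (Dx (X z - x0) + Dz (z - z0))"
        using B(2) by simp
      also have "\<dots> \<le> B * (\<epsilon> * (norm (X z - x0) + norm (z - z0)))" using b B by simp
      also have "\<dots> \<le> B * (\<epsilon> * (C * norm (z - z0) + norm (z - z0)))" using Xz B \<epsilon> by simp
      also have "\<dots> = \<epsilon> * (B * (C + 1)) * norm (z - z0)" by (simp add: algebra_simps)
      also have "\<dots> = e * norm (z - z0)" using B C by (simp add: \<epsilon>_def)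
      finally show ?thesis .
    qed
    ultimately show "\<exists>d>0. \<forall>y. norm (y - z0) < d \<longrightarrow> norm (X y - X z0 - X' (y - z0)) \<le> e * norm (y - z0)"
      by blast
  qed
  moreover have "\<forall>\<^sub>F z in nhds z0. (X z, z) \<in> U \<and> \<Phi> (X z, z) = 0"
    unfolding eventually_nhds_metric
  proof (intro exI[of _ s] conjI allI impI)
    fix z assume "dist z z0 < s"
    then have zs: "norm (z - z0) \<le> s" by (simp add: dist_norm)
    then have "norm (z - z0) \<le> r" by (auto simp: s_def)
    then have "(X z, z) \<in> cball x0 \<delta>2 \<times> cball z0 \<delta>2"
      using X[OF zs] by (auto simp: r_def dist_norm norm_minus_commute)
    then show "(X z, z) \<in> U" using \<delta>2 by blast
    show "\<Phi> (X z, z) = 0" using X[OF zs] by simp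
  qed (rule s)
  ultimately show ?thesis using that X0 by blast
qed

section \<open>Differentiation of expectations under a Lipschitz bound at one point\<close>

lemma has_derivative_norm_diff_tendsto:
  assumes "(f has_derivative f') (at x)" "S \<longlonglongrightarrow> x"
  shows "(\<lambda>n. norm (f (S n) - f x - f' (S n - x)) / norm (S n - x)) \<longlonglongrightarrow> 0"
proof (rule LIMSEQ_I)
  fix e :: real assume "e > 0"
  then have "e / 2 > 0" by simp
  with assms(1) obtain d where d: "d > 0" "\<And>y. norm (y - x) < d \<Longrightarrow> norm (f y - f x - f' (y - x)) \<le> e / 2 * norm (y - x)"
    unfolding has_derivative_at_alt by blast
  obtain N where "\<And>n. n \<ge> N \<Longrightarrow> norm (S n - x) < d" using LIMSEQ_D[OF assms(2) d(1)] by blast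
  then have "norm (norm (f (S n) - f x - f' (S n - x)) / norm (S n - x) - 0) < e" if "n \<ge> N" for n
    using d(2)[of "S n"] that \<open>e > 0\<close>
    by (cases "S n = x") (auto simp: divide_le_eq intro: le_less_trans[of _ "e/2"])
  then show "\<exists>no. \<forall>n\<ge>no. norm (norm (f (S n) - f x - f' (S n - x)) / norm (S n - x) - 0) < e" by blast
qed

text \<open>One integrable Lipschitz constant thereby dominates both the difference quotients and
  their limit.\<close>

lemma norm_derivative_le:
  assumes der: "(f has_derivative f') (at x)" and r: "r > 0"
    and lip: "\<And>y. norm (y - x) < r \<Longrightarrow> norm (f y - f x) \<le> K * norm (y - x)"
  shows "norm (f' v) \<le> K * norm v"
proof (cases "v = 0")
  case True then show ?thesis using has_derivative_bounded_linear[OF der]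
    by (simp add: linear_simps(3))
next
  case False
  interpret f': bounded_linear f' using der by (rule has_derivative_bounded_linear)
  show ?thesis
  proof (rule field_le_epsilon)
    fix e :: real assume e: "e > 0"
    then have "e / norm v > 0" using False by simp
    with der obtain d where d: "d > 0" "\<And>y. norm (y - x) < d \<Longrightarrow> norm (f y - f x - f' (y - x)) \<le> e / norm v * norm (y - x)"
      unfolding has_derivative_at_alt by blast
    define t where "t = min d r / (2 * norm v)"
    have t: "t > 0" using d(1) r False by (simp add: t_def)
    have tv: "norm ((x + t *\<^sub>R v) - x) = min d r / 2" using t False d r by (simp add: t_def)
    have "norm (f' (t *\<^sub>R v)) \<le> norm (f (x + t *\<^sub>R v) - f x - f' (t *\<^sub>R v)) + norm (f (x + t *\<^sub>R v) - f x)"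
      by (metis norm_triangle_sub norm_minus_commute add.commute)
    also have "\<dots> \<le> e / norm v * norm (t *\<^sub>R v) + K * norm (t *\<^sub>R v)"
      using d(2)[of "x + t *\<^sub>R v"] lip[of "x + t *\<^sub>R v"] tv d(1) r by (intro add_mono) auto
    finally have "t * norm (f' v) \<le> t * (e + K * norm v)"
      using t False by (simp add: f'.scaleR algebra_simps)
    then show "norm (f' v) \<le> K * norm v + e" using t by simp
  qed
qed

text \<open>Limits along a fixed sequence of steps preserve measurability, and inequalities between
  difference quotients pass to the derivative.\<close>

lemma derivative_limit_seq:
  assumes der: "(f has_derivative f') (at x)"
  shows "(\<lambda>n. real (Suc n) *\<^sub>R (f (x + v /\<^sub>R real (Suc n)) - f x)) \<longlonglongrightarrow> f' v"
proof -
  interpret f': bounded_linear f' using der by (rule has_derivative_bounded_linear)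
  show ?thesis
  proof (cases "v = 0")
    case False
    let ?S = "\<lambda>n. x + v /\<^sub>R real (Suc n)"
    have i0: "(\<lambda>n. inverse (real (Suc n))) \<longlonglongrightarrow> 0" by (rule LIMSEQ_inverse_real_of_nat)
    have "?S \<longlonglongrightarrow> x + 0 *\<^sub>R v" by (intro tendsto_intros i0)
    then have "?S \<longlonglongrightarrow> x" by simp
    from has_derivative_norm_diff_tendsto[OF der this]
    have "(\<lambda>n. norm v * (norm (f (?S n) - f x - f' (?S n - x)) / norm (?S n - x))) \<longlonglongrightarrow> norm v * 0"
      by (intro tendsto_intros)
    moreover have "norm v * (norm (f (?S n) - f x - f' (?S n - x)) / norm (?S n - x))
        = norm (real (Suc n) *\<^sub>R (f (?S n) - f x) - f' v)" for n
    proof -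
      have "norm (real (Suc n) *\<^sub>R (f (?S n) - f x) - f' v) = norm (real (Suc n) *\<^sub>R (f (?S n) - f x - f' (?S n - x)))"
        by (simp add: f'.scaleR scaleR_diff_right)
      also have "\<dots> = real (Suc n) * norm (f (?S n) - f x - f' (?S n - x))"
        by simp
      finally show ?thesis using False by (simp add: field_simps)
    qed
    ultimately have "(\<lambda>n. norm (real (Suc n) *\<^sub>R (f (?S n) - f x) - f' v)) \<longlonglongrightarrow> 0" by simp
    then show ?thesis by (simp add: tendsto_norm_zero_iff LIM_zero_iff)
  qed (simp add: f'.zero)
qed

text \<open>The derivative is a pointwise limit of difference quotients in measurable functions. The
  indicator restricts to the points where it exists, and shifting the sequence by \<open>n0\<close>
  keeps the evaluation points in \<open>U\<close>.\<close>

lemma measurable_derivative: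
  fixes g :: "'y \<Rightarrow> 'a::euclidean_space \<Rightarrow> 'b::euclidean_space"
  assumes \<Omega>: "\<Omega> \<in> sets F" and U: "open U" "x \<in> U"
    and meas: "\<And>z. z \<in> U \<Longrightarrow> (\<lambda>y. g y z) \<in> borel_measurable F"
    and der: "\<And>y. y \<in> \<Omega> \<Longrightarrow> (g y has_derivative g' y) (at x)"
  shows "(\<lambda>y. indicat_real \<Omega> y *\<^sub>R g' y v) \<in> borel_measurable F"
proof -
  have "(\<lambda>n. x + v /\<^sub>R real (Suc n)) \<longlonglongrightarrow> x + 0 *\<^sub>R v"
    by (intro tendsto_intros LIMSEQ_inverse_real_of_nat)
  then have "\<forall>\<^sub>F n in sequentially. x + v /\<^sub>R real (Suc n) \<in> U"
    using U by (simp add: topological_tendstoD)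
  then obtain n0 where n0: "\<And>n. n \<ge> n0 \<Longrightarrow> x + v /\<^sub>R real (Suc n) \<in> U"
    by (auto simp: eventually_sequentially)
  let ?q = "\<lambda>n y. indicat_real \<Omega> y *\<^sub>R (real (Suc (n + n0)) *\<^sub>R (g y (x + v /\<^sub>R real (Suc (n + n0))) - g y x))"
  show ?thesis
  proof (rule borel_measurable_LIMSEQ_metric)
    fix n
    have "(\<lambda>y. g y (x + v /\<^sub>R real (Suc (n + n0)))) \<in> borel_measurable F" by (intro meas n0) simp
    moreover have "(\<lambda>y. g y x) \<in> borel_measurable F" using U by (intro meas)
    ultimately show "?q n \<in> borel_measurable F" using \<Omega> by measurable
  next
    fix y assume "y \<in> space F"
    show "(\<lambda>n. ?q n y) \<longlonglongrightarrow> indicat_real \<Omega> y *\<^sub>R g' y v"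
    proof (cases "y \<in> \<Omega>")
      case True
      from LIMSEQ_ignore_initial_segment[OF derivative_limit_seq[OF der[OF True], of v], of n0]
      show ?thesis using True by simp
    qed simp
  qed
qed

text \<open>Dominated convergence along an arbitrary sequence of increments: the normalized
  remainder tends to zero pointwise and is dominated by \<open>2 * K\<close>, one \<open>K\<close>
  for the increment and one for the derivative.\<close>

lemma dominated_has_derivative:
  fixes g :: "'y \<Rightarrow> 'a::euclidean_space \<Rightarrow> 'b::euclidean_space"
  assumes \<Omega>: "\<Omega> \<in> sets F" "AE y in F. y \<in> \<Omega>"
    and r: "r > 0"
    and int: "\<And>z. z \<in> ball x r \<Longrightarrow> integrable F (\<lambda>y. g y z)"
    and der: "\<And>y. y \<in> \<Omega> \<Longrightarrow> (g y has_derivative g' y) (at x)"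
    and K: "integrable F K"
    and lip: "\<And>y z. y \<in> \<Omega> \<Longrightarrow> z \<in> ball x r \<Longrightarrow> norm (g y z - g y x) \<le> K y * norm (z - x)"
  shows "((\<lambda>z. \<integral>y. g y z \<partial>F) has_derivative (\<lambda>v. \<integral>y. indicat_real \<Omega> y *\<^sub>R g' y v \<partial>F)) (at x)"
    and "integrable F (\<lambda>y. indicat_real \<Omega> y *\<^sub>R g' y v)"
proof -
  let ?g' = "\<lambda>v y. indicat_real \<Omega> y *\<^sub>R g' y v"
  have le: "norm (g' y v) \<le> K y * norm v" if "y \<in> \<Omega>" for y v
    by (rule norm_derivative_le[OF der[OF that] r])
       (use lip[OF that] in \<open>auto simp: dist_norm norm_minus_commute\<close>)
  have int': "integrable F (?g' v)" for v
  proof (rule Bochner_Integration.integrable_bound)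
    show "integrable F (\<lambda>y. K y * norm v)" using K by simp
    show "?g' v \<in> borel_measurable F"
      by (rule measurable_derivative[OF \<Omega>(1) open_ball, of x x r g])
         (use r int der in auto)
    show "AE y in F. norm (?g' v y) \<le> norm (K y * norm v)"
      using \<Omega>(2) by eventually_elim (auto intro!: order_trans[OF le] mult_right_mono simp: abs_mult)
  qed
  then show "integrable F (?g' v)" .
  let ?D = "\<lambda>v. \<integral>y. ?g' v y \<partial>F"
  have blg: "bounded_linear (g' y)" if "y \<in> \<Omega>" for y using der[OF that] by (rule has_derivative_bounded_linear)
  have addg: "?g' (u + v) y = ?g' u y + ?g' v y" for u v y
    by (cases "y \<in> \<Omega>") (auto dest: blg simp: linear_simps)
  have scg: "?g' (c *\<^sub>R v) y = c *\<^sub>R ?g' v y" for c v y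
    by (cases "y \<in> \<Omega>") (auto dest: blg simp: linear_simps)
  have "linear ?D"
    by (rule linearI) (simp_all only: addg scg Bochner_Integration.integral_add[OF int' int'] integral_scaleR_right)
  then have bl: "bounded_linear ?D" by (simp add: linear_conv_bounded_linear)
  show "((\<lambda>z. \<integral>y. g y z \<partial>F) has_derivative ?D) (at x)"
    unfolding has_derivative_at
  proof (intro conjI bl)
    let ?q = "\<lambda>v. norm ((\<integral>y. g y (x + v) \<partial>F) - (\<integral>y. g y x \<partial>F) - ?D v) / norm v"
    show "?q \<midarrow>0\<rightarrow> 0"
      unfolding tendsto_at_iff_sequentially comp_def
    proof (intro allI impI)
      fix S :: "nat \<Rightarrow> 'a" assume S: "\<forall>i. S i \<in> UNIV - {0}" "S \<longlonglongrightarrow> 0"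
      have "\<forall>\<^sub>F n in sequentially. S n \<in> ball 0 r"
        using S(2) r by (intro topological_tendstoD) auto
      then obtain n0 where n0: "\<And>n. n \<ge> n0 \<Longrightarrow> S n \<in> ball 0 r"
        by (auto simp: eventually_sequentially)
      \<comment> \<open>Integrability is known only inside the ball, so the initial terms that may
        lie outside are dropped.\<close>
      define T where "T n = S (n + n0)" for n
      have T: "T n \<noteq> 0" "norm (T n) < r" for n using S(1) n0[of "n + n0"] by (auto simp: T_def)
      have T0: "T \<longlonglongrightarrow> 0" unfolding T_def using S(2) by (rule LIMSEQ_ignore_initial_segment)
      let ?s = "\<lambda>n y. (g y (x + T n) - g y x - ?g' (T n) y) /\<^sub>R norm (T n)"
      have intT: "integrable F (\<lambda>y. g y (x + T n))" for n using T by (intro int) (simp add: dist_norm)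
      have intx: "integrable F (\<lambda>y. g y x)" using r by (intro int) simp
      have ints: "integrable F (?s n)" for n
        by (intro integrable_scaleR_right Bochner_Integration.integrable_diff intT intx int')
      have "(\<lambda>n. \<integral>y. ?s n y \<partial>F) \<longlonglongrightarrow> (\<integral>y. 0 \<partial>F)"
      proof (rule integral_dominated_convergence)
        show "integrable F (\<lambda>y. 2 * K y)" using K by simp
        show "AE y in F. (\<lambda>n. ?s n y) \<longlonglongrightarrow> 0"
          using \<Omega>(2)
        proof eventually_elim
          case (elim y)
          have "(\<lambda>n. x + T n) \<longlonglongrightarrow> x" using tendsto_add[OF tendsto_const[of x] T0] by simp
          from has_derivative_norm_diff_tendsto[OF der[OF elim] this]
          have "(\<lambda>n. norm (?s n y)) \<longlonglongrightarrow> 0" using elim by (simp add: divide_inverse mult.commute)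
          then show ?case by (rule tendsto_norm_zero_cancel)
        qed
        show "AE y in F. norm (?s n y) \<le> 2 * K y" for n
          using \<Omega>(2)
        proof eventually_elim
          case (elim y)
          have "norm (g y (x + T n) - g y x - g' y (T n)) \<le> norm (g y (x + T n) - g y x) + norm (g' y (T n))"
            by (rule norm_triangle_ineq4)
          also have "\<dots> \<le> K y * norm (T n) + K y * norm (T n)"
            using lip[OF elim, of "x + T n"] le[OF elim, of "T n"] T(2)[of n]
            by (intro add_mono) (auto simp: dist_norm)
          finally have "norm (g y (x + T n) - g y x - ?g' (T n) y) \<le> 2 * K y * norm (T n)"
            using elim by simp
          then show ?case using T(1)[of n] by (simp add: pos_divide_le_eq flip: divide_inverse_commute)
        qed
      qed (use ints in auto)
      moreover have "(\<integral>y. ?s n y \<partial>F) = ((\<integral>y. g y (x + T n) \<partial>F) - (\<integral>y. g y x \<partial>F) - ?D (T n)) /\<^sub>R norm (T n)" for n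
        by (simp only: integral_scaleR_right Bochner_Integration.integral_diff[OF Bochner_Integration.integrable_diff[OF intT intx] int']
              Bochner_Integration.integral_diff[OF intT intx])
      ultimately have "(\<lambda>n. norm (((\<integral>y. g y (x + T n) \<partial>F) - (\<integral>y. g y x \<partial>F) - ?D (T n)) /\<^sub>R norm (T n))) \<longlonglongrightarrow> 0"
        by (simp only: integral_zero tendsto_norm_zero)
      then have "(\<lambda>n. ?q (T n)) \<longlonglongrightarrow> 0" by (simp add: divide_inverse mult.commute)
      then show "(\<lambda>n. ?q (S n)) \<longlonglongrightarrow> 0" unfolding T_def by (rule LIMSEQ_offset)
    qed
  qed
qed

section \<open>Stochastic order for i.i.d. samples\<close>

lemma outer_measure_of_Un_le: "outer_measure_of M (A \<union> B) \<le> outer_measure_of M A + outer_measure_of M B"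
  if A: "A \<subseteq> space M" and B: "B \<subseteq> space M"
proof -
  obtain A' where A': "A' \<in> sets M" "A \<subseteq> A'" "outer_measure_of M A = emeasure M A'"
    using outer_measure_of_attain[OF A] by blast
  obtain B' where B': "B' \<in> sets M" "B \<subseteq> B'" "outer_measure_of M B = emeasure M B'"
    using outer_measure_of_attain[OF B] by blast
  have "outer_measure_of M (A \<union> B) \<le> outer_measure_of M (A' \<union> B')"
    using A' B' by (intro outer_measure_of_mono) auto
  also have "\<dots> \<le> emeasure M A' + emeasure M B'"
    using A' B' by (simp add: emeasure_subadditive)
  finally show ?thesis using A' B' by simp
qed

lemma ennreal_tendsto_0_iff:
  fixes f :: "nat \<Rightarrow> ennreal"
  shows "f \<longlonglongrightarrow> 0 \<longleftrightarrow> (\<forall>e>0. \<forall>\<^sub>F n in sequentially. f n \<le> ennreal e)"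
proof
  assume "f \<longlonglongrightarrow> 0"
  then show "\<forall>e>0. \<forall>\<^sub>F n in sequentially. f n \<le> ennreal e"
    by (auto dest!: order_tendstoD(2)[of _ _ _ "ennreal _"] elim: eventually_mono)
next
  assume *: "\<forall>e>0. \<forall>\<^sub>F n in sequentially. f n \<le> ennreal e"
  show "f \<longlonglongrightarrow> 0"
  proof (rule order_tendstoI)
    fix u :: ennreal assume "0 < u"
    then obtain x where x: "0 < x" "x < u" using dense by blast
    then obtain e where e: "x = ennreal e" "e > 0"
      by (metis ennreal_cases ennreal_0 ennreal_less_zero_iff infinity_ennreal_def less_le not_less top_greatest)
    show "\<forall>\<^sub>F n in sequentially. f n < u"
      using *[rule_format, OF e(2)] by eventually_elim (use x e in \<open>auto intro: le_less_trans\<close>)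
  qed simp
qed

lemma with_prob_mono:
  assumes "with_prob_tending_to_one M Q"
    and "\<And>n \<omega>. n \<ge> n0 \<Longrightarrow> \<omega> \<in> space M \<Longrightarrow> Q n \<omega> \<Longrightarrow> Q' n \<omega>"
  shows "with_prob_tending_to_one M Q'"
  unfolding with_prob_tending_to_one_def
proof (rule tendsto_sandwich[OF _ _ tendsto_const assms(1)[unfolded with_prob_tending_to_one_def]])
  show "\<forall>\<^sub>F n in sequentially. outer_measure_of M {\<omega> \<in> space M. \<not> Q' n \<omega>} \<le> outer_measure_of M {\<omega> \<in> space M. \<not> Q n \<omega>}"
    using eventually_ge_at_top[of n0]
    by eventually_elim (intro outer_measure_of_mono, use assms(2) in auto)
qed simp

text \<open>\<open>R\<close> may depend on \<eta>. This allows the accuracy of a linearization to be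
  fixed after a bound on the size of the noise.\<close>

lemma with_prob_tight:
  assumes "\<And>\<eta>. \<eta> > 0 \<Longrightarrow> \<exists>R. with_prob_tending_to_one M R \<and>
     (\<forall>\<^sub>F n in sequentially. outer_measure_of M {\<omega> \<in> space M. R n \<omega> \<and> \<not> Q n \<omega>} \<le> ennreal \<eta>)"
  shows "with_prob_tending_to_one M Q"
  unfolding with_prob_tending_to_one_def ennreal_tendsto_0_iff
proof (intro allI impI)
  fix e :: real assume e: "e > 0"
  then obtain R where R: "with_prob_tending_to_one M R"
    "\<forall>\<^sub>F n in sequentially. outer_measure_of M {\<omega> \<in> space M. R n \<omega> \<and> \<not> Q n \<omega>} \<le> ennreal (e / 2)"
    using assms[of "e / 2"] by auto
  have "\<forall>\<^sub>F n in sequentially. outer_measure_of M {\<omega> \<in> space M. \<not> R n \<omega>} \<le> ennreal (e / 2)"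
    using R(1) e unfolding with_prob_tending_to_one_def ennreal_tendsto_0_iff by simp
  with R(2) show "\<forall>\<^sub>F n in sequentially. outer_measure_of M {\<omega> \<in> space M. \<not> Q n \<omega>} \<le> ennreal e"
  proof eventually_elim
    case (elim n)
    have "outer_measure_of M {\<omega> \<in> space M. \<not> Q n \<omega>}
       \<le> outer_measure_of M ({\<omega> \<in> space M. R n \<omega> \<and> \<not> Q n \<omega>} \<union> {\<omega> \<in> space M. \<not> R n \<omega>})"
      by (intro outer_measure_of_mono) auto
    also have "\<dots> \<le> outer_measure_of M {\<omega> \<in> space M. R n \<omega> \<and> \<not> Q n \<omega>} + outer_measure_of M {\<omega> \<in> space M. \<not> R n \<omega>}"
      by (intro outer_measure_of_Un_le) auto
    also have "\<dots> \<le> ennreal (e / 2) + ennreal (e / 2)" using elim by (intro add_mono)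
    also have "\<dots> = ennreal e" using e by (simp flip: ennreal_plus)
    finally show ?case .
  qed
qed

lemma with_prob_conj:
  assumes "with_prob_tending_to_one M Q" "with_prob_tending_to_one M Q'"
  shows "with_prob_tending_to_one M (\<lambda>n \<omega>. Q n \<omega> \<and> Q' n \<omega>)"
proof (rule with_prob_tight)
  fix \<eta> :: real assume "\<eta> > 0"
  then have "\<forall>\<^sub>F n in sequentially. outer_measure_of M {\<omega> \<in> space M. \<not> Q' n \<omega>} \<le> ennreal \<eta>"
    using assms(2) unfolding with_prob_tending_to_one_def ennreal_tendsto_0_iff by simp
  then have "\<forall>\<^sub>F n in sequentially. outer_measure_of M {\<omega> \<in> space M. Q n \<omega> \<and> \<not> (Q n \<omega> \<and> Q' n \<omega>)} \<le> ennreal \<eta>"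
    by (rule eventually_mono) (erule order_trans[OF outer_measure_of_mono, rotated], auto)
  with assms(1) show "\<exists>R. with_prob_tending_to_one M R \<and>
     (\<forall>\<^sub>F n in sequentially. outer_measure_of M {\<omega> \<in> space M. R n \<omega> \<and> \<not> (Q n \<omega> \<and> Q' n \<omega>)} \<le> ennreal \<eta>)" by blast
qed

lemma with_prob_AE:
  assumes "AE \<omega> in M. Q \<omega>"
  shows "with_prob_tending_to_one M (\<lambda>n. Q)"
proof -
  obtain N where N: "N \<in> null_sets M" "{\<omega> \<in> space M. \<not> Q \<omega>} \<subseteq> N"
    using assms by (auto simp: eventually_ae_filter)
  have "outer_measure_of M {\<omega> \<in> space M. \<not> Q \<omega>} \<le> outer_measure_of M N"
    by (rule outer_measure_of_mono[OF N(2)])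
  also have "\<dots> = 0" using N(1) by (auto simp: null_sets_def)
  finally show ?thesis by (simp add: with_prob_tending_to_one_def)
qed

lemma with_prob_ball:
  assumes "finite I" "\<And>i. i \<in> I \<Longrightarrow> with_prob_tending_to_one M (\<lambda>n \<omega>. Q i n \<omega>)"
  shows "with_prob_tending_to_one M (\<lambda>n \<omega>. \<forall>i\<in>I. Q i n \<omega>)"
  using assms
proof (induction I rule: finite_induct)
  case empty
  then show ?case using with_prob_AE[of "\<lambda>_. True" M] by simp
next
  case (insert i I)
  then have "with_prob_tending_to_one M (\<lambda>n \<omega>. Q i n \<omega> \<and> (\<forall>i\<in>I. Q i n \<omega>))"
    by (intro with_prob_conj) auto
  then show ?case by simp
qed

lemma o_pr_iff:
  "o_pr M r X \<longleftrightarrow> (\<forall>\<epsilon>>0. with_prob_tending_to_one M (\<lambda>n \<omega>. norm (X n \<omega> /\<^sub>R r n) \<le> \<epsilon>))"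
  by (simp add: o_pr_def with_prob_tending_to_one_def not_le)

section \<open>Chebyshev bounds and uniform linearization for i.i.d. samples\<close>

locale iid_sample = prob_space M for M :: "'w measure" +
  fixes Y :: "nat \<Rightarrow> 'w \<Rightarrow> 'y::topological_space" and F :: "'y measure"
  assumes indep: "indep_vars (\<lambda>_. borel) Y UNIV"
    and ident: "\<And>i. distr M borel (Y i) = F"
begin

lemma Y_measurable [measurable]: "Y i \<in> borel_measurable M"
  using indep by (auto simp: indep_vars_def)

lemma sets_F [measurable_cong]: "sets F = sets borel"
  using ident[of 0] by auto

lemma prob_space_F: "prob_space F"
  using ident[of 0] prob_space_distr[OF Y_measurable] by metis

sublocale F: prob_space F by (rule prob_space_F)

lemma AE_sample: "AE y in F. Q y \<Longrightarrow> AE \<omega> in M. \<forall>i. Q (Y i \<omega>)"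
  unfolding AE_all_countable
  using AE_distrD[OF Y_measurable] ident by metis

text \<open>By induction: a new summand is independent of the earlier sum and both have mean zero,
  so the cross term vanishes.\<close>

lemma
  fixes \<phi> :: "'y \<Rightarrow> real"
  assumes [measurable]: "\<phi> \<in> borel_measurable F" and "integrable F (\<lambda>y. (\<phi> y)\<^sup>2)" and "(\<integral>y. \<phi> y \<partial>F) = 0"
  shows integrable_sum_square: "integrable M (\<lambda>\<omega>. (\<Sum>i<n. \<phi> (Y i \<omega>))\<^sup>2)" (is "?I n")
    and integral_sum_square: "(\<integral>\<omega>. (\<Sum>i<n. \<phi> (Y i \<omega>))\<^sup>2 \<partial>M) = real n * (\<integral>y. (\<phi> y)\<^sup>2 \<partial>F)" (is "?E n")
proof -
  have m [measurable]: "\<phi> \<in> borel_measurable borel" using assms(1) measurable_cong_sets[OF sets_F refl] by blast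
  have sqm: "(\<lambda>y. (\<phi> y)\<^sup>2) \<in> borel_measurable borel" by (rule borel_measurable_power[OF m])
  have sq: "integrable M (\<lambda>\<omega>. (\<phi> (Y i \<omega>))\<^sup>2)" for i
    using assms(2) unfolding ident[of i, symmetric] integrable_distr_eq[OF Y_measurable sqm] .
  have int: "integrable M (\<lambda>\<omega>. \<phi> (Y i \<omega>))" for i
    by (rule square_integrable_imp_integrable[OF measurable_compose[OF Y_measurable m] sq])
  have E: "(\<integral>\<omega>. (\<phi> (Y i \<omega>)) \<partial>M) = 0" "(\<integral>\<omega>. (\<phi> (Y i \<omega>))\<^sup>2 \<partial>M) = (\<integral>y. (\<phi> y)\<^sup>2 \<partial>F)" for i
    using assms(3) integral_distr[OF Y_measurable m, of i] integral_distr[OF Y_measurable sqm, of i]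
    unfolding ident by simp_all
  have "?I n \<and> ?E n"
  proof (induction n)
    case (Suc n)
    let ?S = "\<lambda>\<omega>. \<Sum>i<n. \<phi> (Y i \<omega>)" and ?X = "\<lambda>\<omega>. \<phi> (Y n \<omega>)"
    have "indep_vars (\<lambda>_. borel) (\<lambda>i \<omega>. \<phi> (Y i \<omega>)) (insert n {..<n})"
      by (rule indep_vars_subset[OF indep_vars_compose2[OF indep]]) auto
    then have iv: "indep_var borel ?X borel ?S"
      by (intro indep_vars_sum) auto
    have iS: "integrable M ?S" by (intro Bochner_Integration.integrable_sum int)
    have "integrable M (\<lambda>\<omega>. ?X \<omega> * ?S \<omega>)" "(\<integral>\<omega>. ?X \<omega> * ?S \<omega> \<partial>M) = 0"
      using indep_var_integrable[OF iv int iS] indep_var_lebesgue_integral[OF iv int iS] E by simp_all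
    moreover have "(\<Sum>i<Suc n. \<phi> (Y i \<omega>))\<^sup>2 = (?S \<omega>)\<^sup>2 + 2 * (?X \<omega> * ?S \<omega>) + (?X \<omega>)\<^sup>2" for \<omega>
      by (simp add: power2_sum algebra_simps)
    ultimately show ?case using Suc.IH sq[of n] E(2)[of n] by (simp add: algebra_simps)
  qed simp
  then show "?I n" "?E n" by blast+
qed

text \<open>The constant \<open>V\<close> is uniform in \<open>n\<close> and \<open>t\<close>. A
  fixed \<open>t\<close> gives tightness at rate 1/sqrt n, and t = e sqrt n gives the weak
  law.\<close>

lemma chebyshev_mean:
  fixes \<phi> :: "'y \<Rightarrow> 'b::euclidean_space"
  assumes [measurable]: "\<phi> \<in> borel_measurable F" and sq: "integrable F (\<lambda>y. (norm (\<phi> y))\<^sup>2)"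
  shows "\<exists>V\<ge>0. \<forall>n t. n > 0 \<longrightarrow> t > 0 \<longrightarrow>
     outer_measure_of M {\<omega> \<in> space M. t / sqrt n \<le> norm ((\<Sum>i<n. \<phi> (Y i \<omega>)) /\<^sub>R n - (\<integral>y. \<phi> y \<partial>F))} \<le> ennreal (V / t\<^sup>2)"
proof -
  have m [measurable]: "\<phi> \<in> borel_measurable borel" using assms(1) measurable_cong_sets[OF sets_F refl] by blast
  let ?\<mu> = "\<integral>y. \<phi> y \<partial>F"
  have int: "integrable F \<phi>"
  proof -
    have "integrable F (\<lambda>y. norm (\<phi> y))"
      by (rule F.square_integrable_imp_integrable[OF measurable_compose[OF assms(1) borel_measurable_norm] sq])
    then show ?thesis using integrable_norm_iff[OF assms(1)] by blast
  qed
  define \<psi> where "\<psi> b y = (\<phi> y - ?\<mu>) \<bullet> b" for b y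
  have m\<psi> [measurable]: "\<psi> b \<in> borel_measurable F" for b unfolding \<psi>_def by measurable
  have z: "(\<integral>y. \<psi> b y \<partial>F) = 0" for b
    unfolding \<psi>_def using int by (simp add: F.prob_space inner_diff_left)
  have s: "integrable F (\<lambda>y. (\<psi> b y)\<^sup>2)" for b
  proof -
    have "integrable F (\<lambda>y. (\<phi> y \<bullet> b)\<^sup>2)"
    proof (rule Bochner_Integration.integrable_bound)
      show "integrable F (\<lambda>y. (norm (\<phi> y))\<^sup>2 * (norm b)\<^sup>2)" using sq by simp
      show "AE y in F. norm ((\<phi> y \<bullet> b)\<^sup>2) \<le> norm ((norm (\<phi> y))\<^sup>2 * (norm b)\<^sup>2)"
      proof (rule AE_I2)
        fix y
        have "\<bar>\<phi> y \<bullet> b\<bar>\<^sup>2 \<le> (norm (\<phi> y) * norm b)\<^sup>2"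
          by (intro power_mono Cauchy_Schwarz_ineq2) auto
        then show "norm ((\<phi> y \<bullet> b)\<^sup>2) \<le> norm ((norm (\<phi> y))\<^sup>2 * (norm b)\<^sup>2)"
          by (simp add: power_mult_distrib)
      qed
    qed measurable
    moreover have "(\<psi> b y)\<^sup>2 = (\<phi> y \<bullet> b)\<^sup>2 - 2 * (?\<mu> \<bullet> b) * (\<phi> y \<bullet> b) + (?\<mu> \<bullet> b)\<^sup>2" for y
      by (simp add: \<psi>_def inner_diff_left power2_diff algebra_simps)
    ultimately show ?thesis using int by simp
  qed
  define V where "V = (\<Sum>b\<in>Basis. \<integral>y. (\<psi> b y)\<^sup>2 \<partial>F)"
  have "V \<ge> 0" unfolding V_def by (intro sum_nonneg) simp
  moreover have "outer_measure_of M {\<omega> \<in> space M. t / sqrt n \<le> norm ((\<Sum>i<n. \<phi> (Y i \<omega>)) /\<^sub>R n - ?\<mu>)} \<le> ennreal (V / t\<^sup>2)"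
    if n: "n > 0" and t: "t > 0" for n :: nat and t :: real
  proof -
    \<comment> \<open>Markov's inequality is applied to the sum of the squared coordinate sums,
      which is the squared norm of n times the centred mean.\<close>
    let ?Z = "\<lambda>\<omega>. (\<Sum>b\<in>Basis. (\<Sum>i<n. \<psi> b (Y i \<omega>))\<^sup>2)"
    have eq: "?Z \<omega> = (real n * norm ((\<Sum>i<n. \<phi> (Y i \<omega>)) /\<^sub>R n - ?\<mu>))\<^sup>2" for \<omega>
    proof -
      let ?v = "(\<Sum>i<n. \<phi> (Y i \<omega>)) - real n *\<^sub>R ?\<mu>"
      have "(\<Sum>i<n. \<psi> b (Y i \<omega>)) = ?v \<bullet> b" for b
        by (simp add: \<psi>_def inner_diff_left inner_sum_left sum_subtractf)
      then have "?Z \<omega> = (norm ?v)\<^sup>2"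
        by (simp add: norm_eq_sqrt_inner euclidean_inner[of ?v ?v] power2_eq_square sum_nonneg)
      also have "?v = real n *\<^sub>R ((\<Sum>i<n. \<phi> (Y i \<omega>)) /\<^sub>R n - ?\<mu>)" using n by (simp add: scaleR_diff_right)
      finally show ?thesis by (simp only: norm_scaleR abs_of_nat)
    qed
    let ?A = "{\<omega> \<in> space M. t / sqrt n \<le> norm ((\<Sum>i<n. \<phi> (Y i \<omega>)) /\<^sub>R n - ?\<mu>)}"
    have "?A \<subseteq> {\<omega> \<in> space M. ?Z \<omega> \<ge> real n * t\<^sup>2}"
    proof safe
      fix \<omega> assume *: "t / sqrt n \<le> norm ((\<Sum>i<n. \<phi> (Y i \<omega>)) /\<^sub>R n - ?\<mu>)"
      have "real n * (t / sqrt n) \<le> real n * norm ((\<Sum>i<n. \<phi> (Y i \<omega>)) /\<^sub>R n - ?\<mu>)"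
        using * by (intro mult_left_mono) auto
      then have "(real n * (t / sqrt n))\<^sup>2 \<le> ?Z \<omega>" unfolding eq
        using t by (intro power_mono) auto
      moreover have "(real n * (t / sqrt n))\<^sup>2 = real n * t\<^sup>2"
        using n by (simp add: power_mult_distrib power_divide power2_eq_square)
      ultimately show "?Z \<omega> \<ge> real n * t\<^sup>2" by simp
    qed
    then have "outer_measure_of M ?A \<le> outer_measure_of M {\<omega> \<in> space M. ?Z \<omega> \<ge> real n * t\<^sup>2}"
      by (rule outer_measure_of_mono)
    also have "\<dots> = emeasure M {\<omega> \<in> space M. ?Z \<omega> \<ge> real n * t\<^sup>2}"
      by (rule outer_measure_of_eq) measurable
    also have "\<dots> \<le> ennreal (1 / (real n * t\<^sup>2) * (\<integral>\<omega>. ?Z \<omega> \<partial>M))"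
    proof (rule integral_Markov_inequality)
      show "integrable M ?Z"
        by (intro Bochner_Integration.integrable_sum integrable_sum_square[OF m\<psi> s z])
    qed (use n t in \<open>auto intro!: sum_nonneg\<close>)
    also have "(\<integral>\<omega>. ?Z \<omega> \<partial>M) = real n * V"
      by (simp add: Bochner_Integration.integral_sum integrable_sum_square[OF m\<psi> s z] integral_sum_square[OF m\<psi> s z] V_def sum_distrib_left)
    finally show ?thesis using n by simp
  qed
  ultimately show ?thesis by blast
qed

lemma weak_law:
  fixes \<phi> :: "'y \<Rightarrow> 'b::euclidean_space"
  assumes "\<phi> \<in> borel_measurable F" "integrable F (\<lambda>y. (norm (\<phi> y))\<^sup>2)" and e: "e > 0"
  shows "with_prob_tending_to_one M (\<lambda>n \<omega>. norm ((\<Sum>i<n. \<phi> (Y i \<omega>)) /\<^sub>R n - (\<integral>y. \<phi> y \<partial>F)) < e)"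
proof -
  obtain V where V: "V \<ge> 0" "\<And>n t. n > 0 \<Longrightarrow> t > 0 \<Longrightarrow>
     outer_measure_of M {\<omega> \<in> space M. t / sqrt n \<le> norm ((\<Sum>i<n. \<phi> (Y i \<omega>)) /\<^sub>R n - (\<integral>y. \<phi> y \<partial>F))} \<le> ennreal (V / t\<^sup>2)"
    using chebyshev_mean[OF assms(1,2)] by blast
  have "\<forall>\<^sub>F n in sequentially. outer_measure_of M {\<omega> \<in> space M. \<not> norm ((\<Sum>i<n. \<phi> (Y i \<omega>)) /\<^sub>R n - (\<integral>y. \<phi> y \<partial>F)) < e}
      \<le> ennreal (V / e\<^sup>2 * (1 / real n))"
    using eventually_gt_at_top[of 0]
  proof eventually_elim
    case (elim n)
    then show ?case using V(2)[of n "e * sqrt n"] e by (simp add: not_less power_mult_distrib)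
  qed
  moreover have "(\<lambda>n. ennreal (V / e\<^sup>2 * (1 / real n))) \<longlonglongrightarrow> 0"
    using tendsto_ennrealI[OF tendsto_mult[OF tendsto_const[of "V / e\<^sup>2"] lim_1_over_n]] by simp
  ultimately show ?thesis unfolding with_prob_tending_to_one_def
    by (rule tendsto_sandwich[OF always_eventually[OF allI[OF zero_le]] _ tendsto_const])
qed

text \<open>The points where the linearization of \<open>g y\<close> is not yet \<open>\<epsilon>\<close>-accurate on a ball of radius \<open>\<delta>\<close>
  have small weight under \<open>K\<close>, because they decrease to a null set as \<open>\<delta>\<close> tends to zero. This
  replaces an equicontinuity argument and needs differentiability at one point only.\<close>

lemma uniform_linearization:
  fixes g :: "'y \<Rightarrow> 'a::euclidean_space \<Rightarrow> 'b::euclidean_space"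
  assumes \<Omega>: "\<Omega> \<in> sets F" "AE y in F. y \<in> \<Omega>"
    and r: "r > 0"
    and meas: "\<And>z. z \<in> ball x r \<Longrightarrow> (\<lambda>y. g y z) \<in> borel_measurable F"
    and der: "\<And>y. y \<in> \<Omega> \<Longrightarrow> (g y has_derivative g' y) (at x)"
    and cont: "\<And>y. y \<in> \<Omega> \<Longrightarrow> continuous_on (ball x r) (g y)"
    and K: "K \<in> borel_measurable F" "integrable F (\<lambda>y. (K y)\<^sup>2)" "\<And>y. 0 \<le> K y"
    and lip: "\<And>y z. y \<in> \<Omega> \<Longrightarrow> z \<in> ball x r \<Longrightarrow> norm (g y z - g y x) \<le> K y * norm (z - x)"
    and \<epsilon>: "\<epsilon> > 0"
  obtains \<delta> where "0 < \<delta>" "\<delta> < r"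
    "with_prob_tending_to_one M (\<lambda>n \<omega>. \<forall>z \<in> cball x \<delta>.
       norm ((\<Sum>i<n. g (Y i \<omega>) z - g (Y i \<omega>) x) /\<^sub>R n - (\<integral>y. indicat_real \<Omega> y *\<^sub>R g' y (z - x) \<partial>F)) \<le> \<epsilon> * norm (z - x))"
proof -
  note [measurable] = K(1) \<Omega>(1)
  define G where "G v y = indicat_real \<Omega> y *\<^sub>R g' y v" for v y
  have le: "norm (g' y v) \<le> K y * norm v" if "y \<in> \<Omega>" for y v
    by (rule norm_derivative_le[OF der[OF that] r])
       (use lip[OF that] in \<open>auto simp: dist_norm norm_minus_commute\<close>)
  have mG [measurable]: "G v \<in> borel_measurable F" for v unfolding G_def
    by (rule measurable_derivative[OF \<Omega>(1) open_ball, of x x r g]) (use r meas der in auto)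
  have leG: "norm (G v y) \<le> K y * norm v" for v y
    using le[of y v] K(3)[of y] by (cases "y \<in> \<Omega>") (auto simp: G_def)
  have sqG: "integrable F (\<lambda>y. (norm (G v y))\<^sup>2)" for v
  proof (rule Bochner_Integration.integrable_bound)
    show "integrable F (\<lambda>y. (K y)\<^sup>2 * (norm v)\<^sup>2)" using K by simp
    show "AE y in F. norm ((norm (G v y))\<^sup>2) \<le> norm ((K y)\<^sup>2 * (norm v)\<^sup>2)"
    proof (rule AE_I2)
      fix y show "norm ((norm (G v y))\<^sup>2) \<le> norm ((K y)\<^sup>2 * (norm v)\<^sup>2)"
        using power_mono[OF leG[of v y], of 2] by (simp add: power_mult_distrib)
    qed
  qed measurable
  have intG: "integrable F (G v)" for v
  proof -
    have "integrable F (\<lambda>y. norm (G v y))"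
      by (rule F.square_integrable_imp_integrable[OF measurable_compose[OF mG borel_measurable_norm] sqG])
    then show ?thesis using integrable_norm_iff[OF mG] by blast
  qed
  have linG: "bounded_linear (\<lambda>v. G v y)" for y
  proof (cases "y \<in> \<Omega>")
    case True then show ?thesis using der[OF True] by (simp add: G_def has_derivative_bounded_linear)
  next
    case False then show ?thesis by (simp add: G_def)
  qed
  define D where "D v = (\<integral>y. G v y \<partial>F)" for v
  have addG: "G (u + v) y = G u y + G v y" and scG: "G (c *\<^sub>R v) y = c *\<^sub>R G v y" for u v c y
    by (rule linear_simps(1)[OF linG], rule linear_simps(5)[OF linG])
  have linD: "linear D" unfolding D_def
  proof (rule linearI)
    show "(\<integral>y. G (u + v) y \<partial>F) = (\<integral>y. G u y \<partial>F) + (\<integral>y. G v y \<partial>F)" for u v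
      unfolding Bochner_Integration.integral_add[OF intG intG, symmetric]
      by (rule Bochner_Integration.integral_cong[OF refl addG])
    show "(\<integral>y. G (c *\<^sub>R v) y \<partial>F) = c *\<^sub>R (\<integral>y. G v y \<partial>F)" for c v
      unfolding integral_scaleR_right[symmetric]
      by (rule Bochner_Integration.integral_cong[OF refl scG])
  qed

  \<comment> \<open>Only \<open>z\<close> in a countable dense set enters \<open>bad\<close>, so
    that \<open>bad\<close> is measurable; continuity recovers the remaining
    \<open>z\<close>.\<close>
  obtain Q :: "'a set" where Q: "countable Q" "\<And>X. open X \<Longrightarrow> X \<noteq> {} \<Longrightarrow> \<exists>d\<in>Q. d \<in> X"
    by (metis countable_dense_exists)
  \<comment> \<open>\<open>Suc (Suc k)\<close> keeps every radius strictly below \<open>r\<close>,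
    where the Lipschitz bound holds.\<close>
  define \<rho> where "\<rho> k = r / real (Suc (Suc k))" for k
  have \<rho>: "0 < \<rho> k" "\<rho> k < r" for k
    using r divide_strict_left_mono[of 1 "real (Suc (Suc k))" r] by (simp_all add: \<rho>_def)
  define rem where "rem z y = norm (g y z - g y x - G (z - x) y)" for z y
  define bad where "bad k = (\<Union>z\<in>Q \<inter> ball x (\<rho> k). {y \<in> \<Omega>. rem z y > \<epsilon> / 4 * norm (z - x)})" for k
  have mbad [measurable]: "bad k \<in> sets F" for k
  proof -
    have "{y \<in> \<Omega>. rem z y > \<epsilon> / 4 * norm (z - x)} \<in> sets F" if "z \<in> ball x (\<rho> k)" for z
    proof -
      have [measurable]: "(\<lambda>y. g y z) \<in> borel_measurable F" "(\<lambda>y. g y x) \<in> borel_measurable F"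
        using that \<rho>[of k] r by (auto intro!: meas)
      have "{y \<in> space F. y \<in> \<Omega> \<and> rem z y > \<epsilon> / 4 * norm (z - x)} \<in> sets F"
        unfolding rem_def by measurable
      also have "{y \<in> space F. y \<in> \<Omega> \<and> rem z y > \<epsilon> / 4 * norm (z - x)} = {y \<in> \<Omega>. rem z y > \<epsilon> / 4 * norm (z - x)}"
        using sets.sets_into_space[OF \<Omega>(1)] by blast
      finally show ?thesis .
    qed
    then show ?thesis unfolding bad_def using Q(1) by (intro sets.countable_UN'') auto
  qed
  \<comment> \<open>The set of \<open>z\<close> with a too large remainder is open in the ball, so
    if nonempty it would contain a point of \<open>Q\<close>.\<close>
  have good: "rem z y \<le> \<epsilon> / 4 * norm (z - x)" if y: "y \<in> \<Omega>" "y \<notin> bad k" and z: "z \<in> ball x (\<rho> k)" for y z k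
  proof (rule ccontr)
    assume *: "\<not> rem z y \<le> \<epsilon> / 4 * norm (z - x)"
    let ?h = "\<lambda>z. rem z y - \<epsilon> / 4 * norm (z - x)"
    have "continuous_on (ball x (\<rho> k)) ?h" unfolding rem_def
      by (intro continuous_intros continuous_on_subset[OF cont[OF y(1)]] bounded_linear.continuous_on[OF linG])
         (use \<rho>[of k] in auto)
    then have "open (?h -` {0<..} \<inter> ball x (\<rho> k))"
      by (subst (asm) continuous_on_open_vimage) auto
    moreover have "z \<in> ?h -` {0<..} \<inter> ball x (\<rho> k)" using * z by auto
    ultimately obtain q where "q \<in> Q" "q \<in> ?h -` {0<..} \<inter> ball x (\<rho> k)" using Q(2) by blast
    then show False using y by (auto simp: bad_def)
  qed
  have \<rho>0: "\<rho> \<longlonglongrightarrow> 0" unfolding \<rho>_def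
    using LIMSEQ_ignore_initial_segment[OF lim_const_over_n[of r], of 2] by simp
  have "(\<lambda>k. \<integral>y. K y * indicat_real (bad k) y \<partial>F) \<longlonglongrightarrow> (\<integral>y. 0 \<partial>F)"
  proof (rule integral_dominated_convergence[where w = K])
    show "integrable F K" by (rule F.square_integrable_imp_integrable[OF K(1,2)])
    show "AE y in F. (\<lambda>k. K y * indicat_real (bad k) y) \<longlonglongrightarrow> 0"
      using \<Omega>(2)
    proof eventually_elim
      case (elim y)
      from der[OF elim] \<epsilon> obtain d where d: "d > 0" "\<And>z. norm (z - x) < d \<Longrightarrow> norm (g y z - g y x - g' y (z - x)) \<le> \<epsilon> / 4 * norm (z - x)"
        unfolding has_derivative_at_alt by (metis divide_pos_pos zero_less_numeral)
      have "\<forall>\<^sub>F k in sequentially. \<rho> k < d" using order_tendstoD(2)[OF \<rho>0 d(1)] .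
      then have "\<forall>\<^sub>F k in sequentially. K y * indicat_real (bad k) y = 0"
      proof eventually_elim
        case (elim k)
        have "y \<notin> bad k"
        proof
          assume "y \<in> bad k"
          then obtain z where z: "y \<in> \<Omega>" "norm (z - x) < \<rho> k" "rem z y > \<epsilon> / 4 * norm (z - x)"
            by (auto simp: bad_def dist_norm norm_minus_commute)
          then show False using d(2)[of z] elim by (auto simp: rem_def G_def)
        qed
        then show ?case by simp
      qed
      then show ?case by (rule tendsto_eventually)
    qed
    show "AE y in F. norm (K y * indicat_real (bad k) y) \<le> K y" for k
      using K(3) by (auto simp: indicator_def)
  qed measurable
  then have "\<forall>\<^sub>F k in sequentially. (\<integral>y. K y * indicat_real (bad k) y \<partial>F) < \<epsilon> / 16"
    using \<epsilon> by (intro order_tendstoD(2)[where y = 0]) auto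
  then obtain k where k: "(\<integral>y. K y * indicat_real (bad k) y \<partial>F) < \<epsilon> / 16"
    by (auto simp: eventually_sequentially)

  let ?KB = "\<lambda>y. K y * indicat_real (bad k) y"
  \<comment> \<open>The error budget: \<epsilon>/4 for the mean of the derivatives, shared among the
    basis directions; \<epsilon>/4 for the good sample points; and twice the mean of
    \<open>?KB\<close> for the bad ones, which is at most \<epsilon>/4.\<close>
  define \<epsilon>' where "\<epsilon>' = \<epsilon> / (4 * DIM('a))"
  have \<epsilon>': "\<epsilon>' > 0" using \<epsilon> by (simp add: \<epsilon>'_def)
  have sqKB: "integrable F (\<lambda>y. (norm (?KB y))\<^sup>2)"
    by (rule Bochner_Integration.integrable_bound[OF K(2)])
       (use K(3) in \<open>auto simp: indicator_def\<close>)
  have 1: "with_prob_tending_to_one M (\<lambda>n \<omega>. norm ((\<Sum>i<n. ?KB (Y i \<omega>)) /\<^sub>R n - (\<integral>y. ?KB y \<partial>F)) < \<epsilon> / 16)"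
    using \<epsilon> by (intro weak_law sqKB) auto
  have 2: "with_prob_tending_to_one M (\<lambda>n \<omega>. \<forall>b\<in>Basis. norm ((\<Sum>i<n. G b (Y i \<omega>)) /\<^sub>R n - D b) < \<epsilon>')"
    unfolding D_def by (intro with_prob_ball weak_law sqG mG \<epsilon>') simp
  have 3: "with_prob_tending_to_one M (\<lambda>n \<omega>. \<forall>i. Y i \<omega> \<in> \<Omega>)"
    by (intro with_prob_AE AE_sample \<Omega>)
  have "with_prob_tending_to_one M (\<lambda>n \<omega>. \<forall>z \<in> cball x (\<rho> k / 2).
       norm ((\<Sum>i<n. g (Y i \<omega>) z - g (Y i \<omega>) x) /\<^sub>R n - D (z - x)) \<le> \<epsilon> * norm (z - x))"
  proof (rule with_prob_mono[OF with_prob_conj[OF 1 with_prob_conj[OF 2 3]], where ?n0.0 = 1], safe)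
    fix n \<omega> z assume n: "1 \<le> n" and b1: "norm ((\<Sum>i<n. ?KB (Y i \<omega>)) /\<^sub>R n - (\<integral>y. ?KB y \<partial>F)) < \<epsilon> / 16"
      and b2: "\<forall>b\<in>Basis. norm ((\<Sum>i<n. G b (Y i \<omega>)) /\<^sub>R n - D b) < \<epsilon>'"
      and b3: "\<forall>i. Y i \<omega> \<in> \<Omega>" and z: "z \<in> cball x (\<rho> k / 2)"
    let ?v = "z - x"
    define A where "A v = (\<Sum>i<n. G v (Y i \<omega>)) /\<^sub>R n - D v" for v
    have zb: "z \<in> ball x (\<rho> k)" using z \<rho>(1)[of k] by auto
    \<comment> \<open>By linearity the weak law for the basis vectors controls all directions at
      once, which gives uniformity in \<open>z\<close>.\<close>
    have "linear A" unfolding A_def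
      by (intro linear_compose_sub linear_compose_scale_right linear_compose_sum ballI
          bounded_linear.linear[OF linG] linD)
    then have "A ?v = (\<Sum>b\<in>Basis. (?v \<bullet> b) *\<^sub>R A b)"
      by (subst euclidean_representation[of ?v, symmetric]) (simp add: linear_sum linear_scale)
    also have "norm \<dots> \<le> (\<Sum>b\<in>(Basis :: 'a set). norm ?v * \<epsilon>')"
      by (rule sum_norm_le) (use b2 in \<open>auto intro!: mult_mono simp: A_def Basis_le_norm less_imp_le\<close>)
    also have "\<dots> = \<epsilon> / 4 * norm ?v" by (simp add: \<epsilon>'_def)
    finally have A: "norm (A ?v) \<le> \<epsilon> / 4 * norm ?v" .
    \<comment> \<open>At a bad point the Lipschitz constant is paid twice, for the increment and for
      the derivative.\<close>
    have R: "norm (g (Y i \<omega>) z - g (Y i \<omega>) x - G ?v (Y i \<omega>)) \<le> (\<epsilon> / 4 + 2 * ?KB (Y i \<omega>)) * norm ?v" for i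
    proof (cases "Y i \<omega> \<in> bad k")
      case False
      then show ?thesis using good[of "Y i \<omega>" k z] b3 zb by (simp add: rem_def)
    next
      case True
      have "norm (g (Y i \<omega>) z - g (Y i \<omega>) x - G ?v (Y i \<omega>)) \<le> norm (g (Y i \<omega>) z - g (Y i \<omega>) x) + norm (G ?v (Y i \<omega>))"
        by (rule norm_triangle_ineq4)
      also have "\<dots> \<le> K (Y i \<omega>) * norm ?v + K (Y i \<omega>) * norm ?v"
        using b3 zb \<rho>(2)[of k] by (intro add_mono lip leG) auto
      also have "\<dots> \<le> (\<epsilon> / 4 + 2 * ?KB (Y i \<omega>)) * norm ?v"
        using True \<epsilon> by (simp add: algebra_simps)
      finally show ?thesis .
    qed
    let ?KS = "(\<Sum>i<n. ?KB (Y i \<omega>)) / n"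
    have "(\<Sum>i<n. ?KB (Y i \<omega>)) /\<^sub>R n = ?KS" by (simp only: real_scaleR_def divide_inverse mult.commute)
    then have KS: "?KS \<le> \<epsilon> / 8" using b1 k unfolding real_norm_def by linarith
    have "(\<Sum>i<n. g (Y i \<omega>) z - g (Y i \<omega>) x) /\<^sub>R n - D ?v
        = (\<Sum>i<n. g (Y i \<omega>) z - g (Y i \<omega>) x - G ?v (Y i \<omega>)) /\<^sub>R n + A ?v"
      unfolding A_def sum_subtractf scaleR_diff_right by simp
    also have "norm \<dots> \<le> norm ((\<Sum>i<n. g (Y i \<omega>) z - g (Y i \<omega>) x - G ?v (Y i \<omega>)) /\<^sub>R n) + norm (A ?v)"
      by (rule norm_triangle_ineq)
    also have "\<dots> \<le> (\<Sum>i<n. (\<epsilon> / 4 + 2 * ?KB (Y i \<omega>)) * norm ?v) / n + \<epsilon> / 4 * norm ?v"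
    proof (rule add_mono[OF _ A])
      have "norm (\<Sum>i<n. g (Y i \<omega>) z - g (Y i \<omega>) x - G ?v (Y i \<omega>)) \<le> (\<Sum>i<n. (\<epsilon> / 4 + 2 * ?KB (Y i \<omega>)) * norm ?v)"
        by (rule sum_norm_le) (rule R)
      from divide_right_mono[OF this, of "real n"]
      show "norm ((\<Sum>i<n. g (Y i \<omega>) z - g (Y i \<omega>) x - G ?v (Y i \<omega>)) /\<^sub>R n) \<le> (\<Sum>i<n. (\<epsilon> / 4 + 2 * ?KB (Y i \<omega>)) * norm ?v) / n"
        by (simp only: norm_scaleR abs_inverse abs_of_nat divide_inverse mult.commute of_nat_0_le_iff)
    qed
    also have "(\<Sum>i<n. (\<epsilon> / 4 + 2 * ?KB (Y i \<omega>)) * norm ?v) = (n * (\<epsilon> / 4) + 2 * (\<Sum>i<n. ?KB (Y i \<omega>))) * norm ?v"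
      unfolding sum_distrib_right[symmetric] sum.distrib sum_distrib_left[symmetric] by simp
    also have "\<dots> / n = (\<epsilon> / 4 + 2 * ?KS) * norm ?v"
      using n by (simp add: add_divide_distrib distrib_right)
    also have "\<dots> + \<epsilon> / 4 * norm ?v = (\<epsilon> / 2 + 2 * ?KS) * norm ?v"
      by (simp only: distrib_right[symmetric]) simp
    also have "\<dots> \<le> \<epsilon> * norm ?v"
    proof (rule mult_right_mono)
      show "\<epsilon> / 2 + 2 * ?KS \<le> \<epsilon>" using KS \<epsilon> by linarith
    qed simp
    finally show "norm ((\<Sum>i<n. g (Y i \<omega>) z - g (Y i \<omega>) x) /\<^sub>R n - D ?v) \<le> \<epsilon> * norm ?v" .
  qed
  then show ?thesis
    using \<rho>[of k] by (intro that[of "\<rho> k / 2"]) (simp_all add: D_def G_def)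
qed

end

section \<open>The population criterion\<close>

lemma has_egrad_unique:
  assumes "has_egrad H v x" "has_egrad H w x"
  shows "v = w"
proof -
  have "(\<lambda>h. h \<bullet> v) = (\<lambda>h. h \<bullet> w)"
    using assms by (intro has_derivative_unique) (auto simp: has_egrad_def gderiv_def)
  then show ?thesis by (metis vector_eq_ldot)
qed

lemma egrad_eq: "has_egrad H v x \<Longrightarrow> egrad H x = v"
  unfolding egrad_def using has_egrad_unique by blast

lemma elog_finite_iff: "\<bar>elog x\<bar> \<noteq> \<infinity> \<longleftrightarrow> 0 < x"
  by (simp add: elog_def)

lemma differentiable_bound_ball:
  fixes g :: "'a::real_normed_vector \<Rightarrow> 'b::real_normed_vector"
  assumes "\<And>x. x \<in> ball c r \<Longrightarrow> (g has_derivative g' x) (at x)"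
    and "\<And>x v. x \<in> ball c r \<Longrightarrow> norm (g' x v) \<le> B * norm v"
    and "x \<in> ball c r" "y \<in> ball c r" and "0 \<le> B"
  shows "norm (g x - g y) \<le> B * norm (x - y)"
proof (rule differentiable_bound[OF convex_ball _ _ assms(3,4)])
  show "(g has_derivative g' x) (at x within ball c r)" if "x \<in> ball c r" for x
    using assms(1)[OF that] by (rule has_derivative_at_withinI)
  show "onorm (g' x) \<le> B" if "x \<in> ball c r" for x
    using assms(2)[OF that] assms(5) by (intro onorm_bound)
qed

text \<open>Common source of the Lipschitz constants below: it is used for the inner product, for
  scaling, for \<open>grad\<theta>\<close> and for the composition of operators.\<close>

lemma (in bounded_bilinear) lipschitz_prod:
  assumes "\<And>a b. norm (prod a b) \<le> norm a * norm b"
    and "norm a \<le> A" "norm b' \<le> B" "norm (a - a') \<le> La * d" "norm (b - b') \<le> Lb * d" "0 \<le> A" "0 \<le> B"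
  shows "norm (prod a b - prod a' b') \<le> (A * Lb + La * B) * d"
proof -
  have "prod a b - prod a' b' = prod a (b - b') + prod (a - a') b'"
    by (simp add: diff_left diff_right)
  also have "norm \<dots> \<le> norm a * norm (b - b') + norm (a - a') * norm b'"
    by (intro order_trans[OF norm_triangle_ineq] add_mono assms)
  also have "\<dots> \<le> A * (Lb * d) + (La * d) * B"
    using assms(2-) by (intro add_mono mult_mono) (auto intro: order_trans[OF norm_ge_zero])
  finally show ?thesis by (simp add: algebra_simps)
qed

lemma dist_drop_middle_le:
  "dist (fst z, snd (snd z)) (fst z', snd (snd z')) \<le> dist z z'"
proof -
  obtain x l p x' l' p' where "z = (x, l, p)" "z' = (x', l', p')" by (metis prod.exhaust)
  then show ?thesis
    by (simp add: dist_Pair_Pair real_sqrt_le_mono real_sqrt_pow2 add_nonneg_nonneg)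
qed

lemma square_sum3_le: "(x + y + z)\<^sup>2 \<le> 3 * (x\<^sup>2 + y\<^sup>2 + (z::real)\<^sup>2)"
  using zero_le_power2[of "x - y"] zero_le_power2[of "y - z"] zero_le_power2[of "x - z"]
  by (simp add: power2_eq_square algebra_simps)

lemma has_derivative_eventually_cong:
  assumes "(f has_derivative f') (at x)" "\<forall>\<^sub>F y in nhds x. f y = g y"
  shows "(g has_derivative f') (at x)"
  using assms(2) eventually_nhds_x_imp_x[OF assms(2)]
  by (intro has_derivative_transform_eventually[OF assms(1)]) (auto simp: eventually_at_filter elim: eventually_mono)

lemma eexpectation_real:
  assumes eq: "AE y in F. g y = ereal (k y)" and int: "integrable F k"
  shows "eexpectation F g = ereal (\<integral>y. k y \<partial>F)"
proof -
  have "(\<integral>\<^sup>+ y. e2ennreal (g y) \<partial>F) = (\<integral>\<^sup>+ y. ennreal (k y) \<partial>F)"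
    "(\<integral>\<^sup>+ y. e2ennreal (- g y) \<partial>F) = (\<integral>\<^sup>+ y. ennreal (- k y) \<partial>F)"
    by (intro nn_integral_cong_AE; use eq in eventually_elim; simp)+
  moreover obtain p where p: "(\<integral>\<^sup>+ y. ennreal (k y) \<partial>F) = ennreal p" "p \<ge> 0"
    using int by (auto simp: real_integrable_def less_top[symmetric] intro: ennreal_cases)
  moreover obtain q where q: "(\<integral>\<^sup>+ y. ennreal (- k y) \<partial>F) = ennreal q" "q \<ge> 0"
    using int by (auto simp: real_integrable_def less_top[symmetric] intro: ennreal_cases)
  ultimately show ?thesis
    unfolding eexpectation_def real_lebesgue_integral_def[OF int] by (simp add: enn2ereal_ennreal)
qed

text \<open>The difference is infinite as soon as one part is: an infinite positive part gives
  \<infinity> whatever is subtracted, and a finite one minus an infinite negative part gives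
  -\<infinity>. A finite criterion thus yields integrability.\<close>

lemma eexpectation_finite_integrable:
  fixes k :: "'y \<Rightarrow> real"
  assumes eq: "AE y in F. g y = ereal (k y)" and k: "k \<in> borel_measurable F"
    and fin: "\<bar>eexpectation F g\<bar> \<noteq> \<infinity>"
  shows "integrable F k"
proof -
  have e: "(\<integral>\<^sup>+ y. e2ennreal (g y) \<partial>F) = (\<integral>\<^sup>+ y. ennreal (k y) \<partial>F)"
    "(\<integral>\<^sup>+ y. e2ennreal (- g y) \<partial>F) = (\<integral>\<^sup>+ y. ennreal (- k y) \<partial>F)"
    by (intro nn_integral_cong_AE; use eq in eventually_elim; simp)+
  have "(\<integral>\<^sup>+ y. ennreal (k y) \<partial>F) \<noteq> \<infinity>"
    using fin unfolding eexpectation_def e by (auto simp: top_ereal_def)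
  moreover have "(\<integral>\<^sup>+ y. ennreal (- k y) \<partial>F) \<noteq> \<infinity>"
  proof
    assume top: "(\<integral>\<^sup>+ y. ennreal (- k y) \<partial>F) = \<infinity>"
    show False using fin unfolding eexpectation_def e top
      by (cases "enn2ereal (\<integral>\<^sup>+ y. ennreal (k y) \<partial>F)") (auto simp: top_ereal_def)
  qed
  ultimately show ?thesis using k by (simp add: real_integrable_def)
qed

text \<open>The almost sure conditions, which range over uncountably many parameters, are moved to one
  measurable set \<open>\<Omega>\<close> of full measure.\<close>

locale regular_hybrid_model = iid_sample M Y F
  for M :: "'w measure" and Y :: "nat \<Rightarrow> 'w \<Rightarrow> 'y::topological_space" and F +
  fixes a :: real
    and \<Theta> :: "'p::euclidean_space set"
    and f :: "'p \<Rightarrow> 'y \<Rightarrow> real"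
    and m :: "'y \<Rightarrow> 's::euclidean_space \<Rightarrow> 'r::euclidean_space \<Rightarrow> 'q::euclidean_space"
    and h :: "'y \<Rightarrow> 'r \<Rightarrow> 'r"
    and mu :: "'p \<Rightarrow> 'r \<Rightarrow> 's"
    and lam :: "'p \<Rightarrow> 'r \<Rightarrow> 'q"
    and theta :: "'r \<Rightarrow> 'p"
    and P0 :: 'r
    and M' :: "'y \<Rightarrow> 'p \<times> 'r \<Rightarrow> ('p \<times> 'r) \<Rightarrow>\<^sub>L 'q"
    and \<Omega> :: "'y set" and K1 K2 :: "'y \<Rightarrow> real" and r L :: real
  assumes a: "0 \<le> a" "a \<le> 1"
    and f_meas: "\<And>\<theta>. \<theta> \<in> \<Theta> \<Longrightarrow> f \<theta> \<in> borel_measurable borel"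
    and m_meas: "\<And>\<mu> P. (\<lambda>y. m y \<mu> P) \<in> borel_measurable borel"
    and h_meas: "\<And>P. (\<lambda>y. h y P) \<in> borel_measurable borel"
    and lam: "\<And>\<theta> P l. \<theta> \<in> \<Theta> \<Longrightarrow> el_multiplier F (\<lambda>y. m y (mu \<theta> P) P) l \<longleftrightarrow> l = lam \<theta> P"
    and h_P0: "(\<integral>y. h y P0 \<partial>F) = 0"
    and theta: "\<And>P. sole_critical_maximizer \<Theta>
          (\<lambda>\<theta>. eexpectation F (\<lambda>y. psi a f m mu lam y \<theta> P)) (theta P)"
    and r: "0 < r"
    and ball_\<Theta>: "ball (theta P0, lam (theta P0) P0, P0) r \<subseteq> \<Theta> \<times> UNIV"
    and i_int: "\<And>\<alpha>. \<alpha> \<in> ball (theta P0, lam (theta P0) P0, P0) r \<Longrightarrow> integrable F (joint_est_fun a f m mu lam h \<alpha>)"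
    and i_C1: "C1_on (ball (theta P0, lam (theta P0) P0, P0) r) (expected_est_fun F a f m mu lam h)"
    and iii: "\<exists>G'. (expected_est_fun F a f m mu lam h has_derivative G')
                   (at (theta P0, lam (theta P0) P0, P0)) \<and> bij G'"
    and \<Omega>: "\<Omega> \<in> sets F" "AE y in F. y \<in> \<Omega>"
    and K1: "K1 \<in> borel_measurable F" "\<And>y. 0 \<le> K1 y" "integrable F (\<lambda>y. K1 y ^ 4)"
    and K2: "K2 \<in> borel_measurable F" "\<And>y. 0 \<le> K2 y" "integrable F (\<lambda>y. (K2 y)\<^sup>2)"
    and L: "0 < L"
    and M_der: "\<And>y x. y \<in> \<Omega> \<Longrightarrow> x \<in> ball (theta P0, P0) r \<Longrightarrow>
          ((\<lambda>(\<theta>, P). m y (mu \<theta> P) P) has_derivative blinfun_apply (M' y x)) (at x)"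
    and M_bound: "\<And>y \<theta> P. y \<in> \<Omega> \<Longrightarrow> (\<theta>, P) \<in> ball (theta P0, P0) r \<Longrightarrow> norm (m y (mu \<theta> P) P) \<le> K1 y"
    and M'_bound: "\<And>y x. y \<in> \<Omega> \<Longrightarrow> x \<in> ball (theta P0, P0) r \<Longrightarrow> norm (M' y x) \<le> K1 y"
    and M'_diff: "\<And>y x. y \<in> \<Omega> \<Longrightarrow> x \<in> ball (theta P0, P0) r \<Longrightarrow> M' y differentiable (at x)"
    and M'_lip: "\<And>y x x'. y \<in> \<Omega> \<Longrightarrow> x \<in> ball (theta P0, P0) r \<Longrightarrow> x' \<in> ball (theta P0, P0) r \<Longrightarrow>
          norm (M' y x - M' y x') \<le> K2 y * norm (x - x')"
    and score: "\<And>y \<theta>. y \<in> \<Omega> \<Longrightarrow> \<theta> \<in> ball (theta P0) r \<Longrightarrow> has_egrad (\<lambda>t. elog (f t y)) (score f y \<theta>) \<theta>"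
    and score_bound: "\<And>y \<theta>. y \<in> \<Omega> \<Longrightarrow> \<theta> \<in> ball (theta P0) r \<Longrightarrow> norm (score f y \<theta>) \<le> K2 y"
    and score_diff: "\<And>y \<theta>. y \<in> \<Omega> \<Longrightarrow> \<theta> \<in> ball (theta P0) r \<Longrightarrow> score f y differentiable (at \<theta>)"
    and score_lip: "\<And>y \<theta> \<theta>'. y \<in> \<Omega> \<Longrightarrow> \<theta> \<in> ball (theta P0) r \<Longrightarrow> \<theta>' \<in> ball (theta P0) r \<Longrightarrow>
          norm (score f y \<theta> - score f y \<theta>') \<le> K2 y * norm (\<theta> - \<theta>')"
    and h_bound: "\<And>y P. y \<in> \<Omega> \<Longrightarrow> P \<in> ball P0 r \<Longrightarrow> norm (h y P) \<le> K2 y"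
    and h_diff: "\<And>y P. y \<in> \<Omega> \<Longrightarrow> P \<in> ball P0 r \<Longrightarrow> h y differentiable (at P)"
    and h_lip: "\<And>y P P'. y \<in> \<Omega> \<Longrightarrow> P \<in> ball P0 r \<Longrightarrow> P' \<in> ball P0 r \<Longrightarrow>
          norm (h y P - h y P') \<le> K2 y * norm (P - P')"
    and pos: "\<And>y \<theta> l P. y \<in> \<Omega> \<Longrightarrow> (\<theta>, l, P) \<in> ball (theta P0, lam (theta P0) P0, P0) r \<Longrightarrow>
          L \<le> 1 + l \<bullet> m y (mu \<theta> P) P"
begin

section \<open>The estimating function with a free multiplier: bounds and Lipschitz
  constants\<close>

definition "\<theta>0 = theta P0"
definition "l0 = lam \<theta>0 P0"
definition "\<alpha>0 = (\<theta>0, l0, P0)"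

lemma \<alpha>0: "(theta P0, lam (theta P0) P0, P0) = \<alpha>0"
  by (simp add: \<alpha>0_def \<theta>0_def l0_def)

definition Mf :: "'y \<Rightarrow> 'p \<times> 'r \<Rightarrow> 'q" where "Mf y x = m y (mu (fst x) (snd x)) (snd x)"

definition Q :: "'y \<Rightarrow> 'p \<times> 'q \<times> 'r \<Rightarrow> real" where
  "Q y z = 1 + fst (snd z) \<bullet> Mf y (fst z, snd (snd z))"

text \<open>The \<theta> part of the adjoint of \<open>T\<close> applied to \<open>l\<close>. If
  \<open>T\<close> is the derivative of \<open>Mf y\<close>, this is the gradient in \<theta> of the
  product \<open>l \<bullet> Mf y (\<theta>, P)\<close> with \<open>l\<close> fixed.\<close>

definition grad\<theta> :: "'q \<Rightarrow> (('p \<times> 'r) \<Rightarrow>\<^sub>L 'q) \<Rightarrow> 'p" where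
  "grad\<theta> l T = (\<Sum>b\<in>Basis. (l \<bullet> blinfun_apply T (b, 0)) *\<^sub>R b)"

text \<open>Estimating function with a free multiplier in every component; its zeros in the sample are the
  critical points of the hybrid likelihood.\<close>

definition S1 :: "'y \<Rightarrow> 'p \<times> 'q \<times> 'r \<Rightarrow> 'p" where
  "S1 y z = (1 - a) *\<^sub>R score f y (fst z)
     - a *\<^sub>R inverse (Q y z) *\<^sub>R grad\<theta> (fst (snd z)) (M' y (fst z, snd (snd z)))"

definition S2 :: "'y \<Rightarrow> 'p \<times> 'q \<times> 'r \<Rightarrow> 'q" where
  "S2 y z = inverse (Q y z) *\<^sub>R Mf y (fst z, snd (snd z))"

definition S :: "'y \<Rightarrow> 'p \<times> 'q \<times> 'r \<Rightarrow> 'p \<times> 'q \<times> 'r" where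
  "S y z = (S1 y z, S2 y z, h y (snd (snd z)))"

lemma grad\<theta>_inner: "v \<bullet> grad\<theta> l T = l \<bullet> blinfun_apply T (v, 0)"
proof -
  have lin: "linear (\<lambda>v. l \<bullet> blinfun_apply T (v, 0))"
    by (rule linearI) (simp_all add: inner_add_right[symmetric] blinfun.add_right[symmetric] blinfun.scaleR_right[symmetric]
        inner_scaleR_right[symmetric])
  then have "l \<bullet> blinfun_apply T (\<Sum>b\<in>Basis. (v \<bullet> b) *\<^sub>R b, 0) = (\<Sum>b\<in>Basis. (v \<bullet> b) *\<^sub>R (l \<bullet> blinfun_apply T (b, 0)))"
    by (simp only: linear_sum[OF lin] linear_scale[OF lin])
  then show ?thesis by (simp add: grad\<theta>_def inner_sum_right euclidean_representation mult.commute)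
qed

lemma norm_grad\<theta>_le: "norm (grad\<theta> l T) \<le> norm l * norm T"
proof -
  let ?g = "grad\<theta> l T"
  \<comment> \<open>Pairing the vector with itself turns the adjoint identity into a norm
    bound.\<close>
  have "norm ?g * norm ?g = l \<bullet> blinfun_apply T (?g, 0)" unfolding grad\<theta>_inner[of ?g l T, symmetric]
    by (simp add: power2_norm_eq_inner[symmetric] power2_eq_square)
  also have "\<dots> \<le> norm l * norm (blinfun_apply T (?g, 0))" by (rule norm_cauchy_schwarz)
  also have "\<dots> \<le> norm l * (norm T * norm (?g, 0::'r))" by (intro mult_left_mono norm_blinfun) simp
  finally have "norm ?g * norm ?g \<le> norm l * norm T * norm ?g" by (simp add: norm_Pair)
  then show ?thesis by (cases "?g = 0") auto
qed

sublocale grad: bounded_bilinear grad\<theta>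
proof
  fix l l' T T' and c :: real
  show "grad\<theta> (l + l') T = grad\<theta> l T + grad\<theta> l' T" "grad\<theta> l (T + T') = grad\<theta> l T + grad\<theta> l T'"
    by (simp_all add: grad\<theta>_def blinfun.add_left inner_add_left inner_add_right scaleR_left_distrib sum.distrib)
  show "grad\<theta> (c *\<^sub>R l) T = c *\<^sub>R grad\<theta> l T" "grad\<theta> l (c *\<^sub>R T) = c *\<^sub>R grad\<theta> l T"
    by (simp_all add: grad\<theta>_def blinfun.scaleR_left scaleR_sum_right)
  show "\<exists>K. \<forall>l T. norm (grad\<theta> l T) \<le> norm l * norm T * K"
    using norm_grad\<theta>_le by (intro exI[of _ 1]) simp
qed

lemma ball_proj:
  assumes "z \<in> ball \<alpha>0 r"
  shows "(fst z, snd (snd z)) \<in> ball (\<theta>0, P0) r" "fst z \<in> ball \<theta>0 r" "snd (snd z) \<in> ball P0 r"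
    and "norm (fst (snd z)) \<le> norm l0 + r" "fst z \<in> interior \<Theta>" "fst z \<in> \<Theta>"
proof -
  obtain \<theta> l P where z: "z = (\<theta>, l, P)" by (metis prod.exhaust)
  have d: "dist \<alpha>0 z < r" using assms by simp
  have "dist (\<theta>0, P0) (\<theta>, P) \<le> dist \<alpha>0 z"
    using dist_drop_middle_le[of \<alpha>0 z] by (simp add: z \<alpha>0_def)
  then show "(fst z, snd (snd z)) \<in> ball (\<theta>0, P0) r" using d by (simp add: z)
  have "dist \<theta>0 \<theta> \<le> dist \<alpha>0 z" using dist_fst_le[of \<alpha>0 z] by (simp add: z \<alpha>0_def)
  then show "fst z \<in> ball \<theta>0 r" using d by (simp add: z)
  have "dist l0 l \<le> dist \<alpha>0 z" "dist P0 P \<le> dist \<alpha>0 z"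
    using dist_snd_le[of \<alpha>0 z] dist_fst_le[of "snd \<alpha>0" "snd z"] dist_snd_le[of "snd \<alpha>0" "snd z"]
    by (simp_all add: z \<alpha>0_def)
  then show "snd (snd z) \<in> ball P0 r" "norm (fst (snd z)) \<le> norm l0 + r"
    using d norm_triangle_sub[of l l0] by (simp_all add: z dist_norm norm_minus_commute)
  have "ball \<alpha>0 r \<subseteq> interior (\<Theta> \<times> (UNIV :: ('q \<times> 'r) set))"
    using ball_\<Theta> unfolding \<alpha>0 by (intro interior_maximal open_ball)
  then show "fst z \<in> interior \<Theta>" using assms by (auto simp: interior_Times)
  then show "fst z \<in> \<Theta>" using interior_subset by blast
qed

lemma \<alpha>0_in_ball: "\<alpha>0 \<in> ball \<alpha>0 r" using r by simp

lemma Mf_der: "y \<in> \<Omega> \<Longrightarrow> x \<in> ball (\<theta>0, P0) r \<Longrightarrow> (Mf y has_derivative blinfun_apply (M' y x)) (at x)"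
  using M_der[of y x] unfolding Mf_def[abs_def] by (simp add: case_prod_unfold \<theta>0_def)

lemma Mf_bound: "y \<in> \<Omega> \<Longrightarrow> x \<in> ball (\<theta>0, P0) r \<Longrightarrow> norm (Mf y x) \<le> K1 y"
  using M_bound[of y "fst x" "snd x"] unfolding Mf_def by (simp add: \<theta>0_def)

lemma Mf_lip:
  assumes "y \<in> \<Omega>" "x \<in> ball (\<theta>0, P0) r" "x' \<in> ball (\<theta>0, P0) r"
  shows "norm (Mf y x - Mf y x') \<le> K1 y * norm (x - x')"
proof (rule differentiable_bound_ball[OF Mf_der[OF assms(1)] _ assms(2,3) K1(2)])
  fix x v assume "x \<in> ball (\<theta>0, P0) r"
  then have "norm (M' y x) \<le> K1 y" using M'_bound[OF assms(1)] by (simp add: \<theta>0_def)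
  then show "norm (blinfun_apply (M' y x) v) \<le> K1 y * norm v"
    by (rule order_trans[OF norm_blinfun mult_right_mono]) simp
qed

lemma Q_ge: "y \<in> \<Omega> \<Longrightarrow> z \<in> ball \<alpha>0 r \<Longrightarrow> L \<le> Q y z"
  using pos[of y "fst z" "fst (snd z)" "snd (snd z)"] unfolding \<alpha>0 Q_def Mf_def by simp

lemma Q_pos: "y \<in> \<Omega> \<Longrightarrow> z \<in> ball \<alpha>0 r \<Longrightarrow> 0 < Q y z"
  by (rule less_le_trans[OF L Q_ge])

text \<open>Bound for the multiplier coordinate on the ball around \<alpha>0.\<close>

definition "Bl = norm l0 + r"

lemma Bl: "0 < Bl" using r by (simp add: Bl_def add_nonneg_pos)

lemma proj_norm_le:
  "norm ((fst z, snd (snd z)) - (fst z', snd (snd z'))) \<le> norm (z - z')"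
  "norm (fst z - fst z') \<le> norm (z - z')"
  "norm (fst (snd z) - fst (snd z')) \<le> norm (z - z')"
  "norm (snd (snd z) - snd (snd z')) \<le> norm (z - z')"
  for z z' :: "'p \<times> 'q \<times> 'r"
proof -
  obtain \<theta> l P \<theta>' l' P' where z: "z = (\<theta>, l, P)" "z' = (\<theta>', l', P')" by (metis prod.exhaust)
  show "norm ((fst z, snd (snd z)) - (fst z', snd (snd z'))) \<le> norm (z - z')"
    unfolding z by (auto simp: norm_Pair intro!: real_sqrt_le_mono)
  show "norm (fst z - fst z') \<le> norm (z - z')" unfolding z by (simp add: norm_fst_le)
  have "norm (snd z - snd z') \<le> norm (z - z')" unfolding z by (simp add: norm_snd_le)
  moreover have "norm (fst (snd z) - fst (snd z')) \<le> norm (snd z - snd z')" unfolding z by (simp add: norm_fst_le)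
  moreover have "norm (snd (snd z) - snd (snd z')) \<le> norm (snd z - snd z')" unfolding z by (simp add: norm_snd_le)
  ultimately show "norm (fst (snd z) - fst (snd z')) \<le> norm (z - z')" "norm (snd (snd z) - snd (snd z')) \<le> norm (z - z')"
    by linarith+
qed

lemma Q_lip:
  assumes y: "y \<in> \<Omega>" and z: "z \<in> ball \<alpha>0 r" and z': "z' \<in> ball \<alpha>0 r"
  shows "\<bar>Q y z - Q y z'\<bar> \<le> (1 + Bl) * K1 y * norm (z - z')"
proof -
  have "norm (fst (snd z) \<bullet> Mf y (fst z, snd (snd z)) - fst (snd z') \<bullet> Mf y (fst z', snd (snd z')))
      \<le> (Bl * K1 y + 1 * K1 y) * norm (z - z')"
  proof (rule bounded_bilinear.lipschitz_prod[OF bounded_bilinear_inner])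
    show "norm (Mf y (fst z, snd (snd z)) - Mf y (fst z', snd (snd z'))) \<le> K1 y * norm (z - z')"
      by (rule order_trans[OF Mf_lip[OF y ball_proj(1)[OF z] ball_proj(1)[OF z']] mult_left_mono[OF proj_norm_le(1) K1(2)]])
  qed (use ball_proj[OF z] ball_proj[OF z'] Mf_bound[OF y] Bl K1 proj_norm_le in \<open>auto simp: Bl_def Cauchy_Schwarz_ineq2\<close>)
  then show ?thesis by (simp add: Q_def algebra_simps)
qed

lemma inverse_Q:
  assumes y: "y \<in> \<Omega>" and z: "z \<in> ball \<alpha>0 r" and z': "z' \<in> ball \<alpha>0 r"
  shows "\<bar>inverse (Q y z)\<bar> \<le> 1 / L" "\<bar>inverse (Q y z) - inverse (Q y z')\<bar> \<le> ((1 + Bl) * K1 y / L\<^sup>2) * norm (z - z')"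
proof -
  have inv: "\<bar>inverse (Q y z)\<bar> \<le> 1 / L" if "z \<in> ball \<alpha>0 r" for z
    using Q_ge[OF y that] L by (simp add: divide_inverse)
  show "\<bar>inverse (Q y z)\<bar> \<le> 1 / L" by (rule inv[OF z])
  have "inverse (Q y z) - inverse (Q y z') = inverse (Q y z) * inverse (Q y z') * (Q y z' - Q y z)"
    using Q_pos[OF y z] Q_pos[OF y z'] by (simp add: field_simps)
  also have "\<bar>\<dots>\<bar> \<le> (1 / L) * (1 / L) * ((1 + Bl) * K1 y * norm (z - z'))"
    unfolding abs_mult
    by (intro mult_mono inv z z') (use Q_lip[OF y z z'] L in \<open>auto simp: abs_minus_commute\<close>)
  finally show "\<bar>inverse (Q y z) - inverse (Q y z')\<bar> \<le> ((1 + Bl) * K1 y / L\<^sup>2) * norm (z - z')"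
    by (simp add: power2_eq_square)
qed

text \<open>Sum of the Lipschitz constants of \<open>S1\<close>, \<open>S2\<close> and
  \<open>h\<close>, in the form in which they arise. The squares of \<open>K1\<close> come from
  differences of \<open>inverse (Q y z)\<close> times a factor of size \<open>K1\<close>; square
  integrability of \<open>KS\<close> therefore uses the fourth moment of \<open>K1\<close>.\<close>

definition "KS y = (Bl * K1 y * (1 + Bl) * K1 y / L\<^sup>2 + (K1 y + Bl * K2 y) / L + K2 y)
   + ((1 + Bl) * K1 y * K1 y / L\<^sup>2 + K1 y / L) + K2 y"

lemma S2_lip:
  assumes y: "y \<in> \<Omega>" and z: "z \<in> ball \<alpha>0 r" and z': "z' \<in> ball \<alpha>0 r"
  shows "norm (S2 y z - S2 y z') \<le> ((1 + Bl) * K1 y * K1 y / L\<^sup>2 + K1 y / L) * norm (z - z')"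
proof -
  have "norm (S2 y z - S2 y z') \<le> (1 / L * K1 y + (1 + Bl) * K1 y / L\<^sup>2 * K1 y) * norm (z - z')"
    unfolding S2_def
  proof (rule bounded_bilinear.lipschitz_prod[OF bounded_bilinear_scaleR])
    show "norm (Mf y (fst z, snd (snd z)) - Mf y (fst z', snd (snd z'))) \<le> K1 y * norm (z - z')"
      by (rule order_trans[OF Mf_lip[OF y ball_proj(1)[OF z] ball_proj(1)[OF z']] mult_left_mono[OF proj_norm_le(1) K1(2)]])
  qed (use ball_proj[OF z] ball_proj[OF z'] Mf_bound[OF y] L K1 inverse_Q[OF y z z'] in \<open>auto\<close>)
  then show ?thesis by (simp add: algebra_simps)
qed

lemma S1_lip:
  assumes y: "y \<in> \<Omega>" and z: "z \<in> ball \<alpha>0 r" and z': "z' \<in> ball \<alpha>0 r"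
  shows "norm (S1 y z - S1 y z') \<le> (Bl * K1 y * (1 + Bl) * K1 y / L\<^sup>2 + (K1 y + Bl * K2 y) / L + K2 y) * norm (z - z')"
proof -
  let ?g = "\<lambda>z. grad\<theta> (fst (snd z)) (M' y (fst z, snd (snd z)))"
  note p = ball_proj[OF z] and p' = ball_proj[OF z']
  have mb: "norm (M' y (fst z, snd (snd z))) \<le> K1 y" if "z \<in> ball \<alpha>0 r" for z
    using M'_bound[OF y] ball_proj(1)[OF that] by (simp add: \<theta>0_def)
  have gb: "norm (?g z) \<le> Bl * K1 y" if "z \<in> ball \<alpha>0 r" for z
    by (rule order_trans[OF norm_grad\<theta>_le mult_mono]) (use ball_proj(4)[OF that] mb[OF that] Bl in \<open>auto simp: Bl_def\<close>)
  have gl: "norm (?g z - ?g z') \<le> (Bl * K2 y + 1 * K1 y) * norm (z - z')"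
  proof (rule grad.lipschitz_prod[OF norm_grad\<theta>_le])
    show "norm (M' y (fst z, snd (snd z)) - M' y (fst z', snd (snd z'))) \<le> K2 y * norm (z - z')"
      by (rule order_trans[OF M'_lip[OF y] mult_left_mono[OF proj_norm_le(1) K2(2)]])
         (use p(1) p'(1) in \<open>simp_all add: \<theta>0_def\<close>)
  qed (use p p' mb[OF z'] Bl K1 proj_norm_le in \<open>auto simp: Bl_def\<close>)
  have 1: "norm (inverse (Q y z) *\<^sub>R ?g z - inverse (Q y z') *\<^sub>R ?g z')
      \<le> (1 / L * (Bl * K2 y + 1 * K1 y) + (1 + Bl) * K1 y / L\<^sup>2 * (Bl * K1 y)) * norm (z - z')"
    by (rule bounded_bilinear.lipschitz_prod[OF bounded_bilinear_scaleR]) (use inverse_Q[OF y z z'] gb[OF z'] gl Bl K1 L in auto)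
  have 2: "norm (score f y (fst z) - score f y (fst z')) \<le> K2 y * norm (z - z')"
    by (rule order_trans[OF score_lip[OF y] mult_left_mono[OF proj_norm_le(2) K2(2)]])
       (use p(2) p'(2) in \<open>simp_all add: \<theta>0_def\<close>)
  have "S1 y z - S1 y z' = (1 - a) *\<^sub>R (score f y (fst z) - score f y (fst z'))
      - a *\<^sub>R (inverse (Q y z) *\<^sub>R ?g z - inverse (Q y z') *\<^sub>R ?g z')"
    by (simp add: S1_def scaleR_diff_right)
  also have "norm \<dots> \<le> (1 - a) * norm (score f y (fst z) - score f y (fst z'))
      + a * norm (inverse (Q y z) *\<^sub>R ?g z - inverse (Q y z') *\<^sub>R ?g z')"
    by (rule order_trans[OF norm_triangle_ineq4]) (use a in simp)
  also have "\<dots> \<le> 1 * (K2 y * norm (z - z')) + 1 * ((1 / L * (Bl * K2 y + 1 * K1 y) + (1 + Bl) * K1 y / L\<^sup>2 * (Bl * K1 y)) * norm (z - z'))"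
    by (intro add_mono mult_mono 1 2) (use a in auto)
  finally show ?thesis by (simp add: algebra_simps add_divide_distrib)
qed

lemma S_lip:
  assumes y: "y \<in> \<Omega>" and z: "z \<in> ball \<alpha>0 r" and z': "z' \<in> ball \<alpha>0 r"
  shows "norm (S y z - S y z') \<le> KS y * norm (z - z')"
proof -
  have "norm (h y (snd (snd z)) - h y (snd (snd z'))) \<le> K2 y * norm (z - z')"
    by (rule order_trans[OF h_lip[OF y] mult_left_mono[OF proj_norm_le(4) K2(2)]])
       (use ball_proj(3)[OF z] ball_proj(3)[OF z'] in simp_all)
  then have "norm (S y z - S y z') \<le> (Bl * K1 y * (1 + Bl) * K1 y / L\<^sup>2 + (K1 y + Bl * K2 y) / L + K2 y) * norm (z - z')
      + (((1 + Bl) * K1 y * K1 y / L\<^sup>2 + K1 y / L) * norm (z - z') + K2 y * norm (z - z'))"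
    unfolding S_def diff_Pair
    by (intro order_trans[OF norm_Pair_le] add_mono S1_lip[OF y z z'] S2_lip[OF y z z'])
  then show ?thesis by (simp add: KS_def algebra_simps)
qed

lemma K1_powers: "integrable F K1" "integrable F (\<lambda>y. (K1 y)\<^sup>2)"
proof -
  have "integrable F (\<lambda>y. ((K1 y)\<^sup>2)\<^sup>2)" using K1(3) by (simp flip: power_mult)
  then show *: "integrable F (\<lambda>y. (K1 y)\<^sup>2)"
    by (rule F.square_integrable_imp_integrable[OF borel_measurable_power[OF K1(1)]])
  show "integrable F K1" by (rule F.square_integrable_imp_integrable[OF K1(1) *])
qed

lemma K2_integrable: "integrable F K2"
  by (rule F.square_integrable_imp_integrable[OF K2(1,3)])

lemma KS: "KS \<in> borel_measurable F" "0 \<le> KS y" "integrable F (\<lambda>y. (KS y)\<^sup>2)" "integrable F KS"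
proof -
  note [measurable] = K1(1) K2(1)
  show m: "KS \<in> borel_measurable F" unfolding KS_def[abs_def] by measurable
  show "0 \<le> KS y" unfolding KS_def using Bl K1(2)[of y] K2(2)[of y] L by simp
  \<comment> \<open>Coefficients after sorting \<open>KS\<close> by the square of \<open>K1\<close>,
    \<open>K1\<close> and \<open>K2\<close>.\<close>
  define A B C where "A = Bl * (1 + Bl) / L\<^sup>2 + (1 + Bl) / L\<^sup>2" and "B = 1 / L + 1 / L" and "C = Bl / L + 1 + 1"
  have KS_eq: "KS y = A * (K1 y)\<^sup>2 + B * K1 y + C * K2 y" for y
    unfolding KS_def A_def B_def C_def by (simp add: algebra_simps add_divide_distrib power2_eq_square)
  show *: "integrable F (\<lambda>y. (KS y)\<^sup>2)"
  proof (rule Bochner_Integration.integrable_bound)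
    show "integrable F (\<lambda>y. 3 * (A\<^sup>2 * K1 y ^ 4 + B\<^sup>2 * (K1 y)\<^sup>2 + C\<^sup>2 * (K2 y)\<^sup>2))"
      using K1(3) K1_powers K2(3) by simp
    show "AE y in F. norm ((KS y)\<^sup>2) \<le> norm (3 * (A\<^sup>2 * K1 y ^ 4 + B\<^sup>2 * (K1 y)\<^sup>2 + C\<^sup>2 * (K2 y)\<^sup>2))"
    proof (rule AE_I2)
      fix y
      have "(KS y)\<^sup>2 \<le> 3 * ((A * (K1 y)\<^sup>2)\<^sup>2 + (B * K1 y)\<^sup>2 + (C * K2 y)\<^sup>2)"
        unfolding KS_eq by (rule square_sum3_le)
      then show "norm ((KS y)\<^sup>2) \<le> norm (3 * (A\<^sup>2 * K1 y ^ 4 + B\<^sup>2 * (K1 y)\<^sup>2 + C\<^sup>2 * (K2 y)\<^sup>2))"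
        by (simp add: power_mult_distrib flip: power_mult)
    qed
  qed (use m in measurable)
  show "integrable F KS" by (rule F.square_integrable_imp_integrable[OF m *])
qed

text \<open>In contrast to the Lipschitz constant the bound is linear in \<open>K1\<close> and
  \<open>K2\<close>, since only one factor of each product grows with \<open>y\<close>.\<close>

lemma S_bound:
  assumes y: "y \<in> \<Omega>" and z: "z \<in> ball \<alpha>0 r"
  shows "norm (S y z) \<le> 2 * K2 y + (Bl + 1) / L * K1 y"
proof -
  note p = ball_proj[OF z]
  let ?g = "grad\<theta> (fst (snd z)) (M' y (fst z, snd (snd z)))"
  have mb: "norm (M' y (fst z, snd (snd z))) \<le> K1 y"
    using M'_bound[OF y] p(1) by (simp add: \<theta>0_def)
  have gb: "norm ?g \<le> Bl * K1 y"
    by (rule order_trans[OF norm_grad\<theta>_le mult_mono]) (use p(4) mb Bl in \<open>auto simp: Bl_def\<close>)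
  have i: "\<bar>inverse (Q y z)\<bar> \<le> 1 / L" by (rule inverse_Q(1)[OF y z z])
  have "norm (S1 y z) \<le> (1 - a) * norm (score f y (fst z)) + a * (\<bar>inverse (Q y z)\<bar> * norm ?g)"
    unfolding S1_def by (rule order_trans[OF norm_triangle_ineq4]) (use a in \<open>simp add: abs_mult\<close>)
  also have "\<dots> \<le> 1 * K2 y + 1 * (1 / L * (Bl * K1 y))"
    by (intro add_mono mult_mono i gb score_bound y) (use a p(2) L Bl K1 in \<open>auto simp: \<theta>0_def\<close>)
  finally have 1: "norm (S1 y z) \<le> 1 * K2 y + 1 * (1 / L * (Bl * K1 y))" .
  have 2: "norm (S2 y z) \<le> 1 / L * K1 y"
    unfolding S2_def norm_scaleR by (intro mult_mono i Mf_bound y p(1)) (use L in auto)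
  have 3: "norm (h y (snd (snd z))) \<le> K2 y" by (rule h_bound[OF y p(3)])
  have "norm (S y z) \<le> 1 * K2 y + 1 * (1 / L * (Bl * K1 y)) + (1 / L * K1 y + K2 y)"
    unfolding S_def by (intro order_trans[OF norm_Pair_le] add_mono 1 2 3)
  then show ?thesis by (simp add: algebra_simps add_divide_distrib)
qed

section \<open>Differentiability, measurability and integrability of the estimating function\<close>

lemma proj_diff:
  "(\<lambda>z. (fst z, snd (snd z))) differentiable (at z)" "fst differentiable (at z)"
  "(\<lambda>z. snd (snd z)) differentiable (at z)" "(\<lambda>z. fst (snd z)) differentiable (at z)"
  for z :: "'p \<times> 'q \<times> 'r"
  by (intro bounded_linear_imp_differentiable bounded_linear_intros)+

lemma Mf_proj_diff: "y \<in> \<Omega> \<Longrightarrow> z \<in> ball \<alpha>0 r \<Longrightarrow> (\<lambda>z. Mf y (fst z, snd (snd z))) differentiable (at z)"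
  using Mf_der[OF _ ball_proj(1)]
  by (intro differentiable_compose[where f = "Mf y" and g = "\<lambda>z. (fst z, snd (snd z))"] proj_diff differentiableI)

lemma Q_diff: "y \<in> \<Omega> \<Longrightarrow> z \<in> ball \<alpha>0 r \<Longrightarrow> Q y differentiable (at z)"
  unfolding Q_def[abs_def]
  by (intro differentiable_add differentiable_const differentiable_inner Mf_proj_diff proj_diff)

lemma S2_diff:
  assumes y: "y \<in> \<Omega>" and z: "z \<in> ball \<alpha>0 r"
  shows "S2 y differentiable (at z)"
proof -
  have "(\<lambda>z. inverse (Q y z)) differentiable (at z)"
    using Q_diff[OF y z] Q_pos[OF y z] by (intro differentiable_inverse) auto
  then show ?thesis
    using Mf_proj_diff[OF y z] unfolding S2_def[abs_def] by (intro differentiable_scaleR)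
qed

lemma S_diff:
  assumes y: "y \<in> \<Omega>" and z: "z \<in> ball \<alpha>0 r"
  shows "S y differentiable (at z)"
proof -
  note p = ball_proj[OF z]
  have i: "(\<lambda>z. inverse (Q y z)) differentiable (at z)"
    using Q_diff[OF y z] Q_pos[OF y z] by (intro differentiable_inverse) auto
  have "(\<lambda>z. score f y (fst z)) differentiable (at z)"
    using score_diff[OF y] p(2) by (intro differentiable_compose[where f = "score f y" and g = fst] proj_diff) (simp add: \<theta>0_def)
  moreover have "(\<lambda>z. M' y (fst z, snd (snd z))) differentiable (at z)"
    using M'_diff[OF y] p(1)
    by (intro differentiable_compose[where f = "M' y" and g = "\<lambda>z. (fst z, snd (snd z))"] proj_diff) (simp add: \<theta>0_def)
  then have "(\<lambda>z. grad\<theta> (fst (snd z)) (M' y (fst z, snd (snd z)))) differentiable (at z)"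
  proof -
    assume "(\<lambda>z. M' y (fst z, snd (snd z))) differentiable (at z)"
    then obtain A B where "((\<lambda>z. M' y (fst z, snd (snd z))) has_derivative A) (at z)" "((\<lambda>z. fst (snd z)) has_derivative B) (at z)"
      using proj_diff(4)[of z] unfolding differentiable_def by blast
    from grad.FDERIV[OF this(2,1)] show ?thesis unfolding differentiable_def by blast
  qed
  ultimately have 1: "S1 y differentiable (at z)"
    unfolding S1_def[abs_def] using i
    by (intro differentiable_diff differentiable_scaleR differentiable_const)
  have 3: "(\<lambda>z. h y (snd (snd z))) differentiable (at z)"
    using h_diff[OF y p(3)] by (intro differentiable_compose[where f = "h y" and g = "\<lambda>z. snd (snd z)"] proj_diff)
  obtain A B C where "(S1 y has_derivative A) (at z)" "(S2 y has_derivative B) (at z)"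
    "((\<lambda>z. h y (snd (snd z))) has_derivative C) (at z)"
    using 1 3 S2_diff[OF y z] unfolding differentiable_def by blast
  from has_derivative_Pair[OF this(1) has_derivative_Pair[OF this(2,3)]]
  show ?thesis unfolding S_def[abs_def] differentiable_def by blast
qed

lemma S_cont: "y \<in> \<Omega> \<Longrightarrow> continuous_on (ball \<alpha>0 r) (S y)"
  using S_diff by (meson continuous_at_imp_continuous_on differentiable_imp_continuous_within)

lemma measurable_F_iff: "measurable F borel = measurable borel borel"
  by (rule measurable_cong_sets[OF sets_F refl])

lemma m_meas_F [measurable]: "(\<lambda>y. m y \<mu> P) \<in> borel_measurable F"
  and h_meas_F [measurable]: "(\<lambda>y. h y P) \<in> borel_measurable F"
  and Mf_meas [measurable]: "(\<lambda>y. Mf y x) \<in> borel_measurable F"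
  unfolding measurable_F_iff Mf_def by (rule m_meas h_meas)+

lemma f_meas_F: "\<theta> \<in> \<Theta> \<Longrightarrow> f \<theta> \<in> borel_measurable F"
  unfolding measurable_F_iff by (rule f_meas)

lemma \<Omega>_meas [measurable]: "\<Omega> \<in> sets F" by (rule \<Omega>)

lemma elog_real: "real_of_ereal (elog x) = (if 0 < x then ln x else 0)"
  by (simp add: elog_def)

lemma score_der:
  assumes "y \<in> \<Omega>" "\<theta> \<in> ball \<theta>0 r"
  shows "((\<lambda>t. real_of_ereal (elog (f t y))) has_derivative (\<lambda>v. v \<bullet> score f y \<theta>)) (at \<theta>)"
  using score[of y \<theta>] assms by (simp add: has_egrad_def gderiv_def \<theta>0_def)

text \<open>\<open>score\<close> is given by a description operator; it becomes measurable as a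
  limit of difference quotients of the log density, taken one coordinate at a time.\<close>

lemma score_meas:
  assumes "\<theta> \<in> ball \<theta>0 r"
  shows "(\<lambda>y. indicat_real \<Omega> y *\<^sub>R score f y \<theta>) \<in> borel_measurable F"
proof -
  have "(\<lambda>y. (indicat_real \<Omega> y *\<^sub>R score f y \<theta>) \<bullet> b) \<in> borel_measurable F" if "b \<in> Basis" for b
  proof -
    have "(\<lambda>y. indicat_real \<Omega> y *\<^sub>R (b \<bullet> score f y \<theta>)) \<in> borel_measurable F"
    proof (rule measurable_derivative[OF \<Omega>(1) open_ball assms, where g = "\<lambda>y t. real_of_ereal (elog (f t y))"
          and g' = "\<lambda>y v. v \<bullet> score f y \<theta>" and v = b])
      fix t assume "t \<in> ball \<theta>0 r"
      then have "(t, l0, P0) \<in> ball \<alpha>0 r" by (simp add: \<alpha>0_def dist_Pair_Pair)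
      then have [measurable]: "f t \<in> borel_measurable F" using ball_proj(6) f_meas_F by fastforce
      show "(\<lambda>y. real_of_ereal (elog (f t y))) \<in> borel_measurable F" unfolding elog_real by measurable
    next
      fix y assume "y \<in> \<Omega>"
      then show "((\<lambda>t. real_of_ereal (elog (f t y))) has_derivative (\<lambda>v. v \<bullet> score f y \<theta>)) (at \<theta>)"
        using assms by (rule score_der)
    qed
    then show ?thesis by (simp add: inner_commute)
  qed
  then show ?thesis using borel_measurable_euclidean_space by blast
qed

text \<open>Cut off outside \<Omega>, where nothing is known about \<open>S\<close>, so that
  measurability and the moment bounds hold for all \<open>y\<close>.\<close>

definition G :: "'y \<Rightarrow> 'p \<times> 'q \<times> 'r \<Rightarrow> 'p \<times> 'q \<times> 'r" where
  "G y z = indicat_real \<Omega> y *\<^sub>R S y z"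

lemma G_meas:
  assumes z: "z \<in> ball \<alpha>0 r"
  shows "(\<lambda>y. G y z) \<in> borel_measurable F"
proof -
  note p = ball_proj[OF z]
  have [measurable]: "(\<lambda>y. indicat_real \<Omega> y *\<^sub>R blinfun_apply (M' y (fst z, snd (snd z))) (b, 0)) \<in> borel_measurable F" for b
    by (rule measurable_derivative[OF \<Omega>(1) open_ball p(1), of Mf]) (simp_all add: Mf_der[OF _ p(1)])
  have [measurable]: "(\<lambda>y. Q y z) \<in> borel_measurable F" unfolding Q_def by measurable
  note [measurable] = score_meas[OF p(2)]
  \<comment> \<open>The indicator is moved onto the score and onto \<open>M'\<close>, because it is
    these products that are known to be measurable.\<close>
  have eq: "G y z = ((1 - a) *\<^sub>R (indicat_real \<Omega> y *\<^sub>R score f y (fst z))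
       - a *\<^sub>R inverse (Q y z) *\<^sub>R (\<Sum>b\<in>Basis. (fst (snd z) \<bullet> (indicat_real \<Omega> y *\<^sub>R blinfun_apply (M' y (fst z, snd (snd z))) (b, 0))) *\<^sub>R b),
       indicat_real \<Omega> y *\<^sub>R inverse (Q y z) *\<^sub>R Mf y (fst z, snd (snd z)), indicat_real \<Omega> y *\<^sub>R h y (snd (snd z)))" for y
    by (simp add: G_def S_def S1_def S2_def grad\<theta>_def scaleR_diff_right scaleR_sum_right ac_simps indicator_def)
  show ?thesis unfolding eq by measurable
qed

lemma G_eq: "y \<in> \<Omega> \<Longrightarrow> G y = S y" by (simp add: G_def fun_eq_iff)

lemma G_bound: "z \<in> ball \<alpha>0 r \<Longrightarrow> norm (G y z) \<le> 2 * K2 y + (Bl + 1) / L * K1 y"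
  using S_bound[of y z] K1(2)[of y] K2(2)[of y] Bl L by (cases "y \<in> \<Omega>") (auto simp: G_def)

lemma G_integrable:
  assumes "z \<in> ball \<alpha>0 r" shows "integrable F (\<lambda>y. G y z)"
proof (rule Bochner_Integration.integrable_bound[OF _ G_meas[OF assms]])
  show "integrable F (\<lambda>y. 2 * K2 y + (Bl + 1) / L * K1 y)" using K2_integrable K1_powers by simp
  show "AE y in F. norm (G y z) \<le> norm (2 * K2 y + (Bl + 1) / L * K1 y)"
    unfolding real_norm_def by (intro AE_I2 order_trans[OF G_bound[OF assms] abs_ge_self])
qed

lemma G_square_integrable:
  assumes "z \<in> ball \<alpha>0 r" shows "integrable F (\<lambda>y. (norm (G y z))\<^sup>2)"
proof (rule Bochner_Integration.integrable_bound)
  show "integrable F (\<lambda>y. 3 * ((2 * K2 y)\<^sup>2 + ((Bl + 1) / L * K1 y)\<^sup>2 + 0\<^sup>2))"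
    unfolding power_mult_distrib using K2(3) K1_powers by simp
  show "AE y in F. norm ((norm (G y z))\<^sup>2) \<le> norm (3 * ((2 * K2 y)\<^sup>2 + ((Bl + 1) / L * K1 y)\<^sup>2 + 0\<^sup>2))"
  proof (rule AE_I2)
    fix y
    have "(norm (G y z))\<^sup>2 \<le> (2 * K2 y + (Bl + 1) / L * K1 y + 0)\<^sup>2"
      using G_bound[OF assms, of y] by (intro power_mono) auto
    also have "\<dots> \<le> 3 * ((2 * K2 y)\<^sup>2 + ((Bl + 1) / L * K1 y)\<^sup>2 + 0\<^sup>2)" by (rule square_sum3_le)
    finally show "norm ((norm (G y z))\<^sup>2) \<le> norm (3 * ((2 * K2 y)\<^sup>2 + ((Bl + 1) / L * K1 y)\<^sup>2 + 0\<^sup>2))" by simp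
  qed
qed (use G_meas[OF assms] in measurable)

definition "G' y = frechet_derivative (S y) (at \<alpha>0)"

lemma G_der: "y \<in> \<Omega> \<Longrightarrow> (G y has_derivative G' y) (at \<alpha>0)"
  unfolding G_eq G'_def using S_diff[OF _ \<alpha>0_in_ball] by (simp add: frechet_derivative_works[symmetric])

definition "ES z = (\<integral>y. G y z \<partial>F)"
definition "D v = (\<integral>y. indicat_real \<Omega> y *\<^sub>R G' y v \<partial>F)"

lemma G_lip: "y \<in> \<Omega> \<Longrightarrow> z \<in> ball \<alpha>0 r \<Longrightarrow> norm (G y z - G y \<alpha>0) \<le> KS y * norm (z - \<alpha>0)"
  unfolding G_eq by (rule S_lip[OF _ _ \<alpha>0_in_ball])

lemma ES_der: "(ES has_derivative D) (at \<alpha>0)"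
  unfolding ES_def[abs_def] D_def[abs_def]
  by (rule dominated_has_derivative(1)[OF \<Omega> r G_integrable G_der KS(4) G_lip])

lemma G_linearization:
  assumes "\<epsilon> > 0"
  obtains \<delta> where "0 < \<delta>" "\<delta> < r"
    "with_prob_tending_to_one M (\<lambda>n \<omega>. \<forall>z \<in> cball \<alpha>0 \<delta>.
       norm ((\<Sum>i<n. G (Y i \<omega>) z - G (Y i \<omega>) \<alpha>0) /\<^sub>R n - D (z - \<alpha>0)) \<le> \<epsilon> * norm (z - \<alpha>0))"
  unfolding D_def
  by (rule uniform_linearization[OF \<Omega> r G_meas G_der _ KS(1,3,2) G_lip assms])
     (use G_eq S_cont in auto)

section \<open>Comparison with the function in (i), and the population multiplier\<close>

abbreviation "EG \<equiv> expected_est_fun F a f m mu lam h"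
abbreviation "Jn \<equiv> joint_est_fun a f m mu lam h"

text \<open>Point above \<open>x\<close> on the graph of the population multiplier.\<close>

definition gp :: "'p \<times> 'r \<Rightarrow> 'p \<times> 'q \<times> 'r" where "gp x = (fst x, lam (fst x) (snd x), snd x)"

lemma gp_\<alpha>0: "gp (\<theta>0, P0) = \<alpha>0" by (simp add: gp_def \<alpha>0_def l0_def)

lemma Jn_eq: "Jn z y = (egrad (\<lambda>t. psi a f m mu lam y t (snd (snd z))) (fst z), S2 y z, h y (snd (snd z)))"
  by (cases z) (simp add: joint_est_fun_def S2_def Mf_def Q_def)

lemma i_int': "z \<in> ball \<alpha>0 r \<Longrightarrow> integrable F (Jn z)"
  using i_int unfolding \<alpha>0 .

lemma EG_snd: assumes z: "z \<in> ball \<alpha>0 r" shows "snd (EG z) = snd (ES z)"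
proof -
  have "snd (EG z) = (\<integral>y. snd (Jn z y) \<partial>F)"
    unfolding expected_est_fun_def by (rule integral_bounded_linear[OF bounded_linear_snd i_int'[OF z], symmetric])
  also have "\<dots> = (\<integral>y. snd (G y z) \<partial>F)"
  proof (rule integral_cong_AE)
    show "(\<lambda>y. snd (Jn z y)) \<in> borel_measurable F"
      using integrable_bounded_linear[OF bounded_linear_snd i_int'[OF z]] by (rule borel_measurable_integrable)
    show "(\<lambda>y. snd (G y z)) \<in> borel_measurable F"
      using integrable_bounded_linear[OF bounded_linear_snd G_integrable[OF z]] by (rule borel_measurable_integrable)
    show "AE y in F. snd (Jn z y) = snd (G y z)"
      using \<Omega>(2) by eventually_elim (simp add: Jn_eq G_def S_def)
  qed
  also have "\<dots> = snd (ES z)"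
    unfolding ES_def by (rule integral_bounded_linear[OF bounded_linear_snd G_integrable[OF z]])
  finally show ?thesis .
qed

lemma ES2_eq: assumes z: "z \<in> ball \<alpha>0 r" shows "fst (snd (ES z)) = (\<integral>y. S2 y z \<partial>F)" "integrable F (\<lambda>y. S2 y z)"
proof -
  have bl: "bounded_linear (\<lambda>x :: 'p \<times> 'q \<times> 'r. fst (snd x))" by (intro bounded_linear_intros)
  have "fst (snd (EG z)) = (\<integral>y. fst (snd (Jn z y)) \<partial>F)" "integrable F (\<lambda>y. fst (snd (Jn z y)))"
    unfolding expected_est_fun_def using i_int'[OF z]
    by (intro integral_bounded_linear[OF bl, symmetric] integrable_bounded_linear[OF bl]; assumption)+
  then show "fst (snd (ES z)) = (\<integral>y. S2 y z \<partial>F)" "integrable F (\<lambda>y. S2 y z)"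
    using EG_snd[OF z] by (simp_all add: Jn_eq)
qed

text \<open>Positivity holds throughout the ball, so the equation alone characterizes the
  multiplier. Uniqueness of the multiplier thus becomes uniqueness of zeros, which later identifies
  implicit solutions with \<open>lam\<close>.\<close>

lemma multiplier_iff:
  assumes z: "z \<in> ball \<alpha>0 r"
  shows "fst (snd (ES z)) = 0 \<longleftrightarrow> fst (snd z) = lam (fst z) (snd (snd z))"
proof -
  have "AE y in F. 0 < Q y z" using \<Omega>(2) by eventually_elim (rule Q_pos[OF _ z])
  then have "el_multiplier F (\<lambda>y. m y (mu (fst z) (snd (snd z))) (snd (snd z))) (fst (snd z)) \<longleftrightarrow> (\<integral>y. S2 y z \<partial>F) = 0"
    using ES2_eq(2)[OF z] by (simp add: el_multiplier_def zero_mean_def S2_def[abs_def] Q_def Mf_def)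
  then show ?thesis using lam[OF ball_proj(6)[OF z]] ES2_eq(1)[OF z] by simp
qed

lemma ES2_gp: "gp x \<in> ball \<alpha>0 r \<Longrightarrow> fst (snd (ES (gp x))) = 0"
  by (simp add: multiplier_iff) (simp add: gp_def)

lemma EG_differentiable:
  assumes "z \<in> ball \<alpha>0 r" obtains E' where "(EG has_derivative E') (at z)"
  using i_C1 assms unfolding \<alpha>0 C1_on_def by blast

lemma EG_continuous: "continuous_on (ball \<alpha>0 r) EG"
  by (meson EG_differentiable continuous_at_imp_continuous_on has_derivative_continuous)

text \<open>The derivative in the direction of the multiplier is \<open>- E (M M\<^sup>T) / (1 + \<lambda>\<^sup>T M)\<^sup>2\<close>. A vector
  in its kernel would be orthogonal to \<open>M\<close> almost surely and could be added to the multiplier.\<close>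

lemma multiplier_block_injective:
  assumes z: "gp x \<in> ball \<alpha>0 r" and E': "(EG has_derivative E') (at (gp x))"
    and zero: "fst (snd (E' (0, v, 0))) = 0"
  shows "v = 0"
proof -
  define w where "w = (0 :: 'p, v, 0 :: 'r)"
  let ?M = "\<lambda>y. Mf y x"
  \<comment> \<open>Lower bound for the quadratic form that does not depend on the step length: both
    denominators \<open>Q\<close> are at most \<open>1 + Bl * K1 y\<close>.\<close>
  define k where "k y = indicat_real \<Omega> y * ((v \<bullet> ?M y)\<^sup>2 / (1 + Bl * K1 y)\<^sup>2)" for y
  note [measurable] = K1(1)
  have [measurable]: "k \<in> borel_measurable F" unfolding k_def[abs_def] by measurable
  have intk: "integrable F k"
  proof (rule Bochner_Integration.integrable_bound)
    show "integrable F (\<lambda>y. (norm v)\<^sup>2 * (K1 y)\<^sup>2)" using K1_powers by simp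
    show "AE y in F. norm (k y) \<le> norm ((norm v)\<^sup>2 * (K1 y)\<^sup>2)"
      using \<Omega>(2)
    proof eventually_elim
      case (elim y)
      have "\<bar>v \<bullet> ?M y\<bar> \<le> norm v * K1 y"
        using ball_proj(1)[OF z] Mf_bound[OF elim, of x]
        by (intro order_trans[OF Cauchy_Schwarz_ineq2] mult_left_mono) (auto simp: gp_def)
      then have "\<bar>v \<bullet> ?M y\<bar>\<^sup>2 \<le> (norm v * K1 y)\<^sup>2" by (rule power_mono) simp
      moreover have "1 \<le> (1 + Bl * K1 y)\<^sup>2" using Bl K1(2)[of y] by (simp add: one_le_power)
      then have "(v \<bullet> ?M y)\<^sup>2 / (1 + Bl * K1 y)\<^sup>2 \<le> (v \<bullet> ?M y)\<^sup>2 / 1"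
        by (intro divide_left_mono) auto
      ultimately show ?case using elim by (simp add: k_def power_mult_distrib)
    qed
  qed measurable
  \<comment> \<open>The multiplier equation is monotone along \<open>v\<close> pointwise in
    \<open>y\<close>. The inequality is integrated at a positive step and divided by the step only
    afterwards, so the limit needs nothing but the derivative of \<open>EG\<close>.\<close>
  have step: "v \<bullet> fst (snd (ES (gp x + t *\<^sub>R w))) \<le> - t * (\<integral>y. k y \<partial>F)"
    if z': "gp x + t *\<^sub>R w \<in> ball \<alpha>0 r" and t: "t > 0" for t
  proof -
    let ?z = "gp x" and ?z' = "gp x + t *\<^sub>R w"
    have pt: "v \<bullet> (S2 y ?z' - S2 y ?z) \<le> - t * k y" if y: "y \<in> \<Omega>" for y
    proof -
      have Q': "Q y ?z' = Q y ?z + t * (v \<bullet> ?M y)" by (simp add: Q_def w_def gp_def inner_add_left)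
      have pos: "0 < Q y ?z" "0 < Q y ?z'" using Q_pos[OF y] z z' by auto
      have le: "Q y z \<le> 1 + Bl * K1 y" if "z \<in> ball \<alpha>0 r" "(fst z, snd (snd z)) = x" for z
      proof -
        have "fst (snd z) \<bullet> ?M y \<le> norm (fst (snd z)) * norm (?M y)" by (rule norm_cauchy_schwarz)
        also have "\<dots> \<le> Bl * K1 y"
          using ball_proj[OF that(1)] Mf_bound[OF y, of x] that Bl by (intro mult_mono) (auto simp: Bl_def)
        finally show ?thesis using that(2) by (simp add: Q_def)
      qed
      have "v \<bullet> (S2 y ?z' - S2 y ?z) = (inverse (Q y ?z') - inverse (Q y ?z)) * (v \<bullet> ?M y)"
        by (simp add: S2_def w_def gp_def inner_diff_right algebra_simps)
      also have "inverse (Q y ?z') - inverse (Q y ?z) = - (t * (v \<bullet> ?M y)) / (Q y ?z' * Q y ?z)"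
        using pos unfolding Q' by (simp add: field_simps)
      finally have eq: "v \<bullet> (S2 y ?z' - S2 y ?z) = - t * ((v \<bullet> ?M y)\<^sup>2 / (Q y ?z' * Q y ?z))"
        by (simp add: power2_eq_square)
      have "Q y ?z' * Q y ?z \<le> (1 + Bl * K1 y)\<^sup>2"
        unfolding power2_eq_square using pos z z' Bl K1(2)[of y]
        by (intro mult_mono le) (auto simp: gp_def w_def)
      then have "(v \<bullet> ?M y)\<^sup>2 / (1 + Bl * K1 y)\<^sup>2 \<le> (v \<bullet> ?M y)\<^sup>2 / (Q y ?z' * Q y ?z)"
        using pos by (intro frac_le mult_pos_pos) auto
      then have "t * ((v \<bullet> ?M y)\<^sup>2 / (1 + Bl * K1 y)\<^sup>2) \<le> t * ((v \<bullet> ?M y)\<^sup>2 / (Q y ?z' * Q y ?z))"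
        using t by (intro mult_left_mono) auto
      then show ?thesis unfolding eq k_def using y by (simp only: indicator_simps mult_1 mult_minus_left neg_le_iff_le)
    qed
    have int: "integrable F (\<lambda>y. v \<bullet> S2 y ?z')" "integrable F (\<lambda>y. v \<bullet> S2 y ?z)"
      using ES2_eq(2)[OF z] ES2_eq(2)[OF z'] by simp_all
    have "v \<bullet> fst (snd (ES ?z')) - v \<bullet> fst (snd (ES ?z)) = (\<integral>y. v \<bullet> S2 y ?z' - v \<bullet> S2 y ?z \<partial>F)"
      using int ES2_eq[OF z] ES2_eq[OF z'] by simp
    also have "\<dots> \<le> (\<integral>y. - t * k y \<partial>F)"
    proof (rule integral_mono_AE)
      show "AE y in F. v \<bullet> S2 y ?z' - v \<bullet> S2 y ?z \<le> - t * k y"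
        using \<Omega>(2) by eventually_elim (use pt in \<open>simp add: inner_diff_right\<close>)
    qed (use int intk in auto)
    finally show ?thesis using ES2_gp[OF z] by simp
  qed
  let ?t = "\<lambda>n. inverse (real (Suc n))"
  have lim: "(\<lambda>n. v \<bullet> fst (snd (real (Suc n) *\<^sub>R (EG (gp x + w /\<^sub>R real (Suc n)) - EG (gp x))))) \<longlonglongrightarrow> v \<bullet> fst (snd (E' w))"
    by (intro tendsto_inner tendsto_const tendsto_fst tendsto_snd derivative_limit_seq[OF E'])
  have "(\<lambda>n. gp x + ?t n *\<^sub>R w) \<longlonglongrightarrow> gp x + 0 *\<^sub>R w" by (intro tendsto_intros LIMSEQ_inverse_real_of_nat)
  then have "\<forall>\<^sub>F n in sequentially. gp x + ?t n *\<^sub>R w \<in> ball \<alpha>0 r"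
    using z by (intro topological_tendstoD[OF _ open_ball]) auto
  then have "\<forall>\<^sub>F n in sequentially. v \<bullet> fst (snd (real (Suc n) *\<^sub>R (EG (gp x + w /\<^sub>R real (Suc n)) - EG (gp x)))) \<le> - (\<integral>y. k y \<partial>F)"
  proof eventually_elim
    case (elim n)
    have "v \<bullet> fst (snd (EG (gp x + w /\<^sub>R real (Suc n)) - EG (gp x))) \<le> - ?t n * (\<integral>y. k y \<partial>F)"
      using step[OF elim] EG_snd[OF elim] EG_snd[OF z] ES2_gp[OF z] by simp
    then have "real (Suc n) * (v \<bullet> fst (snd (EG (gp x + w /\<^sub>R real (Suc n)) - EG (gp x)))) \<le> real (Suc n) * (- ?t n * (\<integral>y. k y \<partial>F))"
      by (rule mult_left_mono) simp
    also have "\<dots> = - (\<integral>y. k y \<partial>F)" by (simp add: field_simps)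
    finally show ?case by simp
  qed
  from tendsto_upperbound[OF lim this] have "(\<integral>y. k y \<partial>F) \<le> 0" using zero by (simp add: w_def)
  moreover have "0 \<le> (\<integral>y. k y \<partial>F)" by (intro integral_nonneg_AE) (simp add: k_def)
  ultimately have "(\<integral>y. k y \<partial>F) = 0" by simp
  moreover have "AE y in F. 0 \<le> k y" by (simp add: k_def)
  ultimately have "AE y in F. k y = 0"
    using integral_nonneg_eq_0_iff_AE[OF intk] by blast
  then have orth: "AE y in F. v \<bullet> ?M y = 0"
    using \<Omega>(2)
  proof eventually_elim
    case (elim y)
    have "0 < 1 + Bl * K1 y" using Bl K1(2)[of y] by (simp add: add_pos_nonneg)
    then show ?case using elim by (simp add: k_def)
  qed
  let ?l = "lam (fst x) (snd x)"
  let ?N = "\<lambda>y. m y (mu (fst x) (snd x)) (snd x)"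
  have x\<Theta>: "fst x \<in> \<Theta>" using ball_proj(6)[OF z] by (simp add: gp_def)
  have ml: "el_multiplier F ?N ?l" using lam[OF x\<Theta>] by simp
  have "el_multiplier F ?N (?l + v)"
    unfolding el_multiplier_def zero_mean_def
  proof (intro conjI)
    have eq: "AE y in F. ?N y /\<^sub>R (1 + ?l \<bullet> ?N y) = ?N y /\<^sub>R (1 + (?l + v) \<bullet> ?N y)"
      using orth by eventually_elim (simp add: Mf_def inner_add_left)
    show "AE y in F. 0 < 1 + (?l + v) \<bullet> ?N y"
      using orth conjunct1[OF ml[unfolded el_multiplier_def]]
      by eventually_elim (simp add: Mf_def inner_add_left)
    have i: "integrable F (\<lambda>y. ?N y /\<^sub>R (1 + ?l \<bullet> ?N y))" "(\<integral>y. ?N y /\<^sub>R (1 + ?l \<bullet> ?N y) \<partial>F) = 0"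
      using ml by (auto simp: el_multiplier_def zero_mean_def)
    have meas: "(\<lambda>y. ?N y /\<^sub>R (1 + ?l \<bullet> ?N y)) \<in> borel_measurable F"
      "(\<lambda>y. ?N y /\<^sub>R (1 + (?l + v) \<bullet> ?N y)) \<in> borel_measurable F" by measurable
    show "integrable F (\<lambda>y. ?N y /\<^sub>R (1 + (?l + v) \<bullet> ?N y))"
      by (rule integrable_cong_AE_imp[OF i(1) meas(2)]) (use eq in eventually_elim, simp)
    show "(\<integral>y. ?N y /\<^sub>R (1 + (?l + v) \<bullet> ?N y) \<partial>F) = 0"
      using integral_cong_AE[OF meas eq] i(2) by simp
  qed
  then have "?l + v = ?l" using lam[OF x\<Theta>] by blast
  then show "v = 0" by simp
qed

text \<open>The multiplier equation is solved by the implicit function lemma, with the injective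
  block above; since its only zero is the multiplier, the solution is \<open>lam\<close>.\<close>

lemma lam_der:
  assumes z: "gp x \<in> ball \<alpha>0 r"
  obtains L' where "((\<lambda>x. lam (fst x) (snd x)) has_derivative L') (at x)"
proof -
  obtain E' where E': "(EG has_derivative E') (at (gp x))" using EG_differentiable[OF z] .
  \<comment> \<open>Reorders the coordinates: the multiplier is the unknown, the pair of \<theta>
    and P the parameter.\<close>
  define \<iota> where "\<iota> p = (fst (snd p), fst p, snd (snd p))" for p :: "'q \<times> 'p \<times> 'r"
  have \<iota>: "bounded_linear \<iota>" unfolding \<iota>_def by (intro bounded_linear_intros)
  let ?l = "lam (fst x) (snd x)"
  have \<iota>x: "\<iota> (?l, x) = gp x" by (simp add: \<iota>_def gp_def)
  obtain X X' where X: "(X has_derivative X') (at x)" "X x = ?l"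
    "\<forall>\<^sub>F x' in nhds x. (X x', x') \<in> \<iota> -` ball \<alpha>0 r \<and> fst (snd (EG (\<iota> (X x', x')))) = 0"
  proof (rule implicit_function_at[of "\<lambda>p. fst (snd (EG (\<iota> p)))" "\<lambda>p. fst (snd (E' (\<iota> p)))" ?l x "\<iota> -` ball \<alpha>0 r"])
    show "((\<lambda>p. fst (snd (EG (\<iota> p)))) has_derivative (\<lambda>p. fst (snd (E' (\<iota> p))))) (at (?l, x))"
      by (intro has_derivative_fst has_derivative_snd has_derivative_compose[OF bounded_linear_imp_has_derivative[OF \<iota>]])
         (simp add: \<iota>x E')
    show "fst (snd (EG (\<iota> (?l, x)))) = 0" using ES2_gp[OF z] EG_snd[OF z] by (simp add: \<iota>x)
    show "v = 0" if "fst (snd (E' (\<iota> (v, 0)))) = 0" for v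
      by (rule multiplier_block_injective[OF z E']) (use that in \<open>simp add: \<iota>_def\<close>)
    show "open (\<iota> -` ball \<alpha>0 r)"
      by (intro open_vimage open_ball linear_continuous_on \<iota>)
    show "(?l, x) \<in> \<iota> -` ball \<alpha>0 r" using z by (simp only: vimage_eq \<iota>x)
    show "continuous_on (\<iota> -` ball \<alpha>0 r) (\<lambda>p. fst (snd (EG (\<iota> p))))"
      by (intro continuous_on_fst continuous_on_snd continuous_on_compose2[OF EG_continuous linear_continuous_on[OF \<iota>]]) auto
  qed
  have "\<forall>\<^sub>F x' in nhds x. X x' = lam (fst x') (snd x')"
    using X(3)
  proof eventually_elim
    case (elim x')
    then have "\<iota> (X x', x') \<in> ball \<alpha>0 r" by simp
    with multiplier_iff[OF this] EG_snd[OF this] elim show ?case by (simp add: \<iota>_def)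
  qed
  from has_derivative_eventually_cong[OF X(1) this] show ?thesis by (rule that)
qed

lemma gp_der:
  assumes "((\<lambda>x. lam (fst x) (snd x)) has_derivative L') (at x)"
  shows "(gp has_derivative (\<lambda>v. (fst v, L' v, snd v))) (at x)"
  unfolding gp_def[abs_def]
  by (intro has_derivative_Pair assms bounded_linear_imp_has_derivative bounded_linear_fst bounded_linear_snd)

lemma gp_near:
  assumes "gp x \<in> ball \<alpha>0 r"
  shows "\<forall>\<^sub>F x' in nhds x. gp x' \<in> ball \<alpha>0 r"
proof -
  obtain L' where "((\<lambda>x. lam (fst x) (snd x)) has_derivative L') (at x)" using lam_der[OF assms] .
  then have "isCont gp x" using gp_der has_derivative_continuous by blast
  then have "(gp \<longlongrightarrow> gp x) (nhds x)" by (simp add: isCont_def tendsto_at_iff_tendsto_nhds)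
  from topological_tendstoD[OF this open_ball assms] show ?thesis .
qed

lemma near_fst:
  assumes "\<forall>\<^sub>F x' in nhds (\<theta>, P). R x'"
  shows "\<forall>\<^sub>F t in nhds \<theta>. R (t, P)"
proof -
  have "filterlim (\<lambda>t. (t, P)) (nhds (\<theta>, P)) (nhds \<theta>)"
    by (intro tendsto_Pair tendsto_const filterlim_ident)
  from eventually_compose_filterlim[OF assms this] show ?thesis .
qed

section \<open>Gradient of the population criterion\<close>

lemma f_pos: "y \<in> \<Omega> \<Longrightarrow> \<theta> \<in> ball \<theta>0 r \<Longrightarrow> 0 < f \<theta> y"
  using score[of y \<theta>] eventually_nhds_x_imp_x unfolding has_egrad_def elog_finite_iff \<theta>0_def by blast

abbreviation "lf \<theta> y \<equiv> real_of_ereal (elog (f \<theta> y))"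

definition "psr y x = (1 - a) * lf (fst x) y - a * ln (Q y (gp x))"

lemma psi_real:
  assumes "y \<in> \<Omega>" "gp (\<theta>, P) \<in> ball \<alpha>0 r"
  shows "psi a f m mu lam y \<theta> P = ereal (psr y (\<theta>, P))"
proof -
  have "0 < f \<theta> y" using f_pos[OF assms(1)] ball_proj(2)[OF assms(2)] by (simp add: gp_def)
  moreover have "0 < 1 + lam \<theta> P \<bullet> m y (mu \<theta> P) P" "Q y (gp (\<theta>, P)) = 1 + lam \<theta> P \<bullet> m y (mu \<theta> P) P"
    using Q_pos[OF assms] by (simp_all add: Q_def gp_def Mf_def)
  ultimately show ?thesis by (simp add: psi_def psr_def elog_def)
qed

lemma Mf_der_fst:
  assumes "y \<in> \<Omega>" "(\<theta>, P) \<in> ball (\<theta>0, P0) r"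
  shows "((\<lambda>t. Mf y (t, P)) has_derivative (\<lambda>v. blinfun_apply (M' y (\<theta>, P)) (v, 0))) (at \<theta>)"
  by (rule has_derivative_compose[of "\<lambda>t. (t, P)" "\<lambda>v. (v, 0)" \<theta> UNIV "Mf y"])
     (auto intro!: derivative_eq_intros Mf_der assms)

text \<open>The chain rule through \<open>lam\<close> adds a term that is linear in
  \<open>S2\<close>, and the mean of \<open>S2\<close> vanishes on the graph of
  \<open>lam\<close>.\<close>

lemma psr_egrad:
  assumes y: "y \<in> \<Omega>" and z: "gp (\<theta>, P) \<in> ball \<alpha>0 r"
    and L': "((\<lambda>x. lam (fst x) (snd x)) has_derivative L') (at (\<theta>, P))"
  shows "egrad (\<lambda>t. psi a f m mu lam y t P) \<theta>
     = S1 y (gp (\<theta>, P)) - a *\<^sub>R grad\<theta> (S2 y (gp (\<theta>, P))) (Blinfun L')"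
proof (rule egrad_eq)
  have near: "\<forall>\<^sub>F t in nhds \<theta>. psi a f m mu lam y t P = ereal (psr y (t, P))"
    using near_fst[OF gp_near[OF z]] by eventually_elim (rule psi_real[OF y])
  note p = ball_proj[OF z]
  let ?z = "gp (\<theta>, P)"
  have bl: "bounded_linear L'" using L' by (rule has_derivative_bounded_linear)
  have dl: "((\<lambda>t. lam t P) has_derivative (\<lambda>v. L' (v, 0))) (at \<theta>)"
    using has_derivative_compose[OF has_derivative_Pair[OF has_derivative_ident has_derivative_const] L'] by simp
  have dM: "((\<lambda>t. Mf y (t, P)) has_derivative (\<lambda>v. blinfun_apply (M' y (\<theta>, P)) (v, 0))) (at \<theta>)"
    using p(1) by (intro Mf_der_fst y) (simp add: gp_def)
  have "((\<lambda>t. Q y (gp (t, P))) has_derivative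
      (\<lambda>v. lam \<theta> P \<bullet> blinfun_apply (M' y (\<theta>, P)) (v, 0) + L' (v, 0) \<bullet> Mf y (\<theta>, P))) (at \<theta>)"
    unfolding Q_def gp_def by (auto intro!: derivative_eq_intros dl dM)
  then have "((\<lambda>t. psr y (t, P)) has_derivative
      (\<lambda>v. (1 - a) * (v \<bullet> score f y \<theta>) - a * ((lam \<theta> P \<bullet> blinfun_apply (M' y (\<theta>, P)) (v, 0) + L' (v, 0) \<bullet> Mf y (\<theta>, P)) / Q y ?z))) (at \<theta>)"
    unfolding psr_def using p(2) Q_pos[OF y z] score_der[OF y, of \<theta>]
    by (auto intro!: derivative_eq_intros simp: gp_def divide_inverse)
  moreover have "(1 - a) * (v \<bullet> score f y \<theta>) - a * ((lam \<theta> P \<bullet> blinfun_apply (M' y (\<theta>, P)) (v, 0) + L' (v, 0) \<bullet> Mf y (\<theta>, P)) / Q y ?z)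
     = v \<bullet> (S1 y ?z - a *\<^sub>R grad\<theta> (S2 y ?z) (Blinfun L'))" for v
    by (simp add: inner_diff_right S1_def S2_def grad\<theta>_inner bounded_linear_Blinfun_apply[OF bl] gp_def divide_inverse
        inner_commute algebra_simps)
  ultimately have "((\<lambda>t. psr y (t, P)) has_derivative (\<lambda>v. v \<bullet> (S1 y ?z - a *\<^sub>R grad\<theta> (S2 y ?z) (Blinfun L')))) (at \<theta>)"
    by simp
  then have "((\<lambda>t. real_of_ereal (psi a f m mu lam y t P)) has_derivative (\<lambda>v. v \<bullet> (S1 y ?z - a *\<^sub>R grad\<theta> (S2 y ?z) (Blinfun L')))) (at \<theta>)"
    by (rule has_derivative_eventually_cong) (use near in eventually_elim, simp)
  moreover have "\<forall>\<^sub>F t in nhds \<theta>. \<bar>psi a f m mu lam y t P\<bar> \<noteq> \<infinity>"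
    using near by eventually_elim simp
  ultimately show "has_egrad (\<lambda>t. psi a f m mu lam y t P) (S1 y ?z - a *\<^sub>R grad\<theta> (S2 y ?z) (Blinfun L')) \<theta>"
    by (simp add: has_egrad_def gderiv_def)
qed

text \<open>Envelope argument: the dependence through the multiplier drops out in expectation.\<close>

lemma EG_fst:
  assumes z: "gp (\<theta>, P) \<in> ball \<alpha>0 r" and l: "(\<theta>, l, P) \<in> ball \<alpha>0 r"
  shows "fst (EG (\<theta>, l, P)) = fst (ES (gp (\<theta>, P)))"
proof -
  obtain L' where L': "((\<lambda>x. lam (fst x) (snd x)) has_derivative L') (at (\<theta>, P))"
    using lam_der[OF z] .
  let ?z = "gp (\<theta>, P)"
  \<comment> \<open>The correction is linear in the value of the estimating function, so it commutes
    with the integral. The left-hand side does not depend on \<open>l\<close>, which is why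
    \<open>l\<close> is arbitrary in the ball.\<close>
  define T where "T u = fst u - a *\<^sub>R grad\<theta> (fst (snd u)) (Blinfun L')" for u :: "'p \<times> 'q \<times> 'r"
  have T: "bounded_linear T" unfolding T_def
    by (intro bounded_linear_intros bounded_linear_compose[OF grad.bounded_linear_left])
  have "fst (EG (\<theta>, l, P)) = (\<integral>y. fst (Jn (\<theta>, l, P) y) \<partial>F)"
    unfolding expected_est_fun_def by (rule integral_bounded_linear[OF bounded_linear_fst i_int'[OF l], symmetric])
  also have "\<dots> = (\<integral>y. T (G y ?z) \<partial>F)"
  proof (rule integral_cong_AE)
    show "(\<lambda>y. fst (Jn (\<theta>, l, P) y)) \<in> borel_measurable F"
      using integrable_bounded_linear[OF bounded_linear_fst i_int'[OF l]] by (rule borel_measurable_integrable)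
    show "(\<lambda>y. T (G y ?z)) \<in> borel_measurable F"
      using integrable_bounded_linear[OF T G_integrable[OF z]] by (rule borel_measurable_integrable)
    show "AE y in F. fst (Jn (\<theta>, l, P) y) = T (G y ?z)"
      using \<Omega>(2)
    proof eventually_elim
      case (elim y)
      then show ?case using psr_egrad[OF elim z L'] by (simp add: Jn_eq T_def G_eq S_def)
    qed
  qed
  also have "\<dots> = T (ES ?z)" unfolding ES_def by (rule integral_bounded_linear[OF T G_integrable[OF z]])
  also have "\<dots> = fst (ES ?z)" using ES2_gp[OF z] by (simp add: T_def grad.zero_left)
  finally show ?thesis .
qed

lemma lnQ_bound:
  assumes "y \<in> \<Omega>" "z \<in> ball \<alpha>0 r"
  shows "\<bar>ln (Q y z)\<bar> \<le> \<bar>ln L\<bar> + Bl * K1 y"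
proof -
  have "fst (snd z) \<bullet> Mf y (fst z, snd (snd z)) \<le> norm (fst (snd z)) * norm (Mf y (fst z, snd (snd z)))"
    by (rule norm_cauchy_schwarz)
  also have "\<dots> \<le> Bl * K1 y"
    using ball_proj[OF assms(2)] Mf_bound[OF assms(1)] Bl by (intro mult_mono) (auto simp: Bl_def)
  finally have "Q y z - 1 \<le> Bl * K1 y" by (simp add: Q_def)
  moreover have "ln (Q y z) \<le> Q y z - 1" by (rule ln_le_minus_one[OF Q_pos[OF assms]])
  moreover have "ln L \<le> ln (Q y z)" using Q_ge[OF assms] Q_pos[OF assms] L by simp
  moreover have "0 \<le> Bl * K1 y" using Bl K1(2)[of y] by simp
  ultimately show ?thesis by linarith
qed

lemma lnQ_integrable:
  assumes z: "z \<in> ball \<alpha>0 r"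
  shows "integrable F (\<lambda>y. indicat_real \<Omega> y * ln (Q y z))"
proof (rule Bochner_Integration.integrable_bound)
  show "integrable F (\<lambda>y. \<bar>ln L\<bar> + Bl * K1 y)" using K1_powers by simp
  have [measurable]: "(\<lambda>y. Q y z) \<in> borel_measurable F" unfolding Q_def by measurable
  show "(\<lambda>y. indicat_real \<Omega> y * ln (Q y z)) \<in> borel_measurable F" by measurable
  show "AE y in F. norm (indicat_real \<Omega> y * ln (Q y z)) \<le> norm (\<bar>ln L\<bar> + Bl * K1 y)"
    using \<Omega>(2) by eventually_elim (auto intro!: order_trans[OF lnQ_bound[OF _ z] abs_ge_self])
qed

lemma lf_meas: "\<theta> \<in> \<Theta> \<Longrightarrow> lf \<theta> \<in> borel_measurable F"
proof -
  assume "\<theta> \<in> \<Theta>"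
  then have [measurable]: "f \<theta> \<in> borel_measurable F" by (rule f_meas_F)
  show ?thesis unfolding elog_real by measurable
qed

text \<open>Integrability of the log density is not assumed. It follows from the finiteness of the
  criterion near \<open>\<theta>0\<close>, which is part of the criticality of \<open>\<theta>0\<close>.\<close>

lemma lf_integrable_near:
  "\<forall>\<^sub>F \<theta> in nhds \<theta>0. integrable F (\<lambda>y. indicat_real \<Omega> y * ((1 - a) * lf \<theta> y))"
proof -
  have "has_egrad (\<lambda>\<theta>. eexpectation F (\<lambda>y. psi a f m mu lam y \<theta> P0)) 0 \<theta>0"
    using theta[of P0] unfolding sole_critical_maximizer_def \<theta>0_def by blast
  then have fin: "\<forall>\<^sub>F \<theta> in nhds \<theta>0. \<bar>eexpectation F (\<lambda>y. psi a f m mu lam y \<theta> P0)\<bar> \<noteq> \<infinity>"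
    by (simp add: has_egrad_def)
  have "\<forall>\<^sub>F \<theta> in nhds \<theta>0. gp (\<theta>, P0) \<in> ball \<alpha>0 r"
    by (rule near_fst, rule gp_near) (simp add: gp_\<alpha>0 r)
  with fin show ?thesis
  proof eventually_elim
    case (elim \<theta>)
    have \<Theta>: "\<theta> \<in> \<Theta>" using ball_proj(6)[OF elim(2)] by (simp add: gp_def)
    note [measurable] = lf_meas[OF \<Theta>]
    have [measurable]: "(\<lambda>y. Q y (gp (\<theta>, P0))) \<in> borel_measurable F" unfolding Q_def by measurable
    have "integrable F (\<lambda>y. psr y (\<theta>, P0))"
    proof (rule eexpectation_finite_integrable[OF _ _ elim(1)])
      show "AE y in F. psi a f m mu lam y \<theta> P0 = ereal (psr y (\<theta>, P0))"
        using \<Omega>(2) by eventually_elim (rule psi_real[OF _ elim(2)])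
      show "(\<lambda>y. psr y (\<theta>, P0)) \<in> borel_measurable F" unfolding psr_def fst_conv by measurable
    qed
    \<comment> \<open>Adding back the empirical likelihood term, integrable by its logarithmic
      bounds, leaves the log density.\<close>
    then have "integrable F (\<lambda>y. indicat_real \<Omega> y *\<^sub>R psr y (\<theta>, P0) + a * (indicat_real \<Omega> y * ln (Q y (gp (\<theta>, P0)))))"
      by (intro Bochner_Integration.integrable_add integrable_mult_right lnQ_integrable elim(2) integrable_mult_indicator \<Omega>(1))
    moreover have "indicat_real \<Omega> y *\<^sub>R psr y (\<theta>, P0) + a * (indicat_real \<Omega> y * ln (Q y (gp (\<theta>, P0))))
       = indicat_real \<Omega> y * ((1 - a) * lf \<theta> y)" for y
      by (simp add: psr_def algebra_simps)
    ultimately show ?case by simp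
  qed
qed

lemma ln_lipschitz:
  assumes "0 < (L::real)" "L \<le> x" "L \<le> y"
  shows "\<bar>ln x - ln y\<bar> \<le> \<bar>x - y\<bar> / L"
proof -
  have *: "ln x - ln y \<le> \<bar>x - y\<bar> / L" if "L \<le> x" "L \<le> y" for x y
  proof -
    have "ln x - ln y = ln (x / y)" using that assms(1) by (simp add: ln_div)
    also have "\<dots> \<le> x / y - 1" using that assms(1) by (intro ln_le_minus_one) simp
    also have "\<dots> = (x - y) / y" using that assms(1) by (simp add: field_simps)
    also have "\<dots> \<le> \<bar>x - y\<bar> / L" using that assms(1) by (intro frac_le) auto
    finally show ?thesis .
  qed
  from *[OF assms(2,3)] *[OF assms(3,2)] show ?thesis by (simp add: abs_le_iff abs_minus_commute)
qed

text \<open>The criterion is the composition of a function of \<theta> and a free multiplier with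
  the graph of \<open>lam\<close>. Its derivative in the multiplier is -a times the mean of
  \<open>S2\<close>, zero on the graph, so only the partial derivative in \<theta> survives.\<close>

lemma criterion_egrad:
  "\<forall>\<^sub>F x in nhds (\<theta>0, P0). gp x \<in> ball \<alpha>0 r \<and>
     has_egrad (\<lambda>t. eexpectation F (\<lambda>y. psi a f m mu lam y t (snd x))) (fst (ES (gp x))) (fst x)"
proof -
  obtain U where U: "open U" "\<theta>0 \<in> U" "\<And>\<theta>. \<theta> \<in> U \<Longrightarrow> integrable F (\<lambda>y. indicat_real \<Omega> y * ((1 - a) * lf \<theta> y))"
    using lf_integrable_near unfolding eventually_nhds by blast
  have "\<forall>\<^sub>F x in nhds (\<theta>0, P0). gp x \<in> ball \<alpha>0 r"
    by (rule gp_near) (simp add: gp_\<alpha>0 r)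
  \<comment> \<open>The integrability on \<open>U\<close> concerns the log density only and so holds
    for every P.\<close>
  moreover have "\<forall>\<^sub>F x in nhds (\<theta>0, P0). x \<in> U \<times> (UNIV :: 'r set)"
    using U by (intro eventually_nhds_in_open open_Times) auto
  ultimately show ?thesis
  proof eventually_elim
    case (elim x)
    obtain \<theta> P where x: "x = (\<theta>, P)" by (cases x)
    have z: "gp (\<theta>, P) \<in> ball \<alpha>0 r" and \<theta>U: "\<theta> \<in> U" using elim x by auto
    let ?l = "lam \<theta> P"
    let ?z = "gp (\<theta>, P)"
    have zeq: "?z = (\<theta>, ?l, P)" by (simp add: gp_def)
    note p = ball_proj[OF z]
    define \<iota> where "\<iota> u = (fst u, snd u, P)" for u :: "'p \<times> 'q"
    have \<iota>c: "continuous_on UNIV \<iota>" unfolding \<iota>_def by (intro continuous_intros)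
    have "open (\<iota> -` ball \<alpha>0 r \<inter> fst -` U)"
      by (intro open_Int open_vimage open_ball U \<iota>c continuous_intros)
    moreover have "(\<theta>, ?l) \<in> \<iota> -` ball \<alpha>0 r \<inter> fst -` U" using z \<theta>U by (simp add: \<iota>_def zeq)
    ultimately obtain s where s: "s > 0" "ball (\<theta>, ?l) s \<subseteq> \<iota> -` ball \<alpha>0 r \<inter> fst -` U"
      using open_contains_ball by blast
    \<comment> \<open>With the multiplier freed, differentiation under the integral uses bounds that
      do not involve \<open>lam\<close>, which enters afterwards by composition.\<close>
    define \<phi> where "\<phi> y u = indicat_real \<Omega> y * ((1 - a) * lf (fst u) y) - a * (indicat_real \<Omega> y * ln (Q y (\<iota> u)))" for y u
    define \<phi>' where "\<phi>' y u = fst u \<bullet> S1 y ?z - a * (snd u \<bullet> S2 y ?z)" for y and u :: "'p \<times> 'q"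
    have \<phi>int: "integrable F (\<lambda>y. \<phi> y u)" if "u \<in> ball (\<theta>, ?l) s" for u
      unfolding \<phi>_def using that s(2)
      by (intro Bochner_Integration.integrable_diff U(3) integrable_mult_right lnQ_integrable) auto
    have \<phi>der: "(\<phi> y has_derivative \<phi>' y) (at (\<theta>, ?l))" if y: "y \<in> \<Omega>" for y
    proof -
      have d1: "((\<lambda>u. lf (fst u) y) has_derivative (\<lambda>u. fst u \<bullet> score f y \<theta>)) (at (\<theta>, ?l))"
        by (rule has_derivative_compose[of fst fst "(\<theta>, ?l)" UNIV "\<lambda>t. lf t y" "\<lambda>v. v \<bullet> score f y \<theta>"])
           (use score_der[OF y, of \<theta>] p(2) in \<open>auto simp: zeq intro!: bounded_linear_imp_has_derivative bounded_linear_fst\<close>)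
      have "(\<theta>, P) \<in> ball (\<theta>0, P0) r" using p(1) by (simp add: zeq)
      then have d2: "((\<lambda>u. Mf y (fst u, P)) has_derivative (\<lambda>u. blinfun_apply (M' y (\<theta>, P)) (fst u, 0))) (at (\<theta>, ?l))"
        by (intro has_derivative_compose[of fst fst "(\<theta>, ?l)" UNIV "\<lambda>t. Mf y (t, P)" "\<lambda>v. blinfun_apply (M' y (\<theta>, P)) (v, 0)"])
           (auto intro!: bounded_linear_imp_has_derivative bounded_linear_fst Mf_der_fst y)
      have "((\<lambda>u. Q y (\<iota> u)) has_derivative (\<lambda>u. ?l \<bullet> blinfun_apply (M' y (\<theta>, P)) (fst u, 0) + snd u \<bullet> Mf y (\<theta>, P))) (at (\<theta>, ?l))"
        unfolding Q_def \<iota>_def by (auto intro!: derivative_eq_intros d2)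
      then have "((\<lambda>u. (1 - a) * lf (fst u) y - a * ln (Q y (\<iota> u))) has_derivative
         (\<lambda>u. (1 - a) * (fst u \<bullet> score f y \<theta>) - a * ((?l \<bullet> blinfun_apply (M' y (\<theta>, P)) (fst u, 0) + snd u \<bullet> Mf y (\<theta>, P)) / Q y ?z))) (at (\<theta>, ?l))"
        using Q_pos[OF y z] d1 by (auto intro!: derivative_eq_intros simp: \<iota>_def zeq divide_inverse)
      moreover have "(1 - a) * (fst u \<bullet> score f y \<theta>) - a * ((?l \<bullet> blinfun_apply (M' y (\<theta>, P)) (fst u, 0) + snd u \<bullet> Mf y (\<theta>, P)) / Q y ?z) = \<phi>' y u" for u
        by (simp add: \<phi>'_def zeq inner_diff_right S1_def S2_def grad\<theta>_inner divide_inverse algebra_simps)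
      ultimately show ?thesis using y by (simp add: \<phi>_def[abs_def])
    qed
    have \<phi>lip: "norm (\<phi> y u - \<phi> y (\<theta>, ?l)) \<le> (K2 y + (1 + Bl) * K1 y / L) * norm (u - (\<theta>, ?l))"
      if y: "y \<in> \<Omega>" and u: "u \<in> ball (\<theta>, ?l) s" for y u
    proof -
      have b: "\<iota> u \<in> ball \<alpha>0 r" "\<iota> (\<theta>, ?l) \<in> ball \<alpha>0 r" using u s z by (auto simp: \<iota>_def zeq)
      have "\<bar>lf (fst u) y - lf \<theta> y\<bar> \<le> K2 y * norm (fst u - \<theta>)"
        unfolding real_norm_def[symmetric]
      proof (rule differentiable_bound_ball[where c = \<theta>0 and r = r and g' = "\<lambda>t v. v \<bullet> score f y t"])
        show "norm (v \<bullet> score f y t) \<le> K2 y * norm v" if "t \<in> ball \<theta>0 r" for t v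
          using score_bound[OF y, of t] that Cauchy_Schwarz_ineq2[of v "score f y t"]
          by (simp add: \<theta>0_def) (metis mult.commute mult_right_mono norm_ge_zero order_trans)
      qed (use ball_proj(2)[OF b(1)] ball_proj(2)[OF b(2)] K2(2)[of y] score_der[OF y] in \<open>auto simp: \<iota>_def\<close>)
      also have "\<dots> \<le> K2 y * norm (u - (\<theta>, ?l))"
        using norm_fst_le[of "fst u - \<theta>" "snd u - ?l"] K2(2)[of y]
        by (intro mult_left_mono) (auto simp: minus_prod_def)
      finally have 1: "\<bar>lf (fst u) y - lf \<theta> y\<bar> \<le> K2 y * norm (u - (\<theta>, ?l))" .
      have "\<bar>ln (Q y (\<iota> u)) - ln (Q y ?z)\<bar> \<le> \<bar>Q y (\<iota> u) - Q y ?z\<bar> / L"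
        using Q_ge[OF y b(1)] Q_ge[OF y z] L by (intro ln_lipschitz)
      also have "\<dots> \<le> ((1 + Bl) * K1 y * norm (\<iota> u - ?z)) / L"
        using Q_lip[OF y b(1) z] L by (intro divide_right_mono) auto
      also have "norm (\<iota> u - ?z) = norm (u - (\<theta>, ?l))"
        by (simp add: \<iota>_def zeq minus_prod_def norm_Pair)
      finally have 2: "\<bar>ln (Q y (\<iota> u)) - ln (Q y ?z)\<bar> \<le> ((1 + Bl) * K1 y * norm (u - (\<theta>, ?l))) / L" .
      have "norm (\<phi> y u - \<phi> y (\<theta>, ?l)) = \<bar>(1 - a) * (lf (fst u) y - lf \<theta> y) - a * (ln (Q y (\<iota> u)) - ln (Q y ?z))\<bar>"
        using y by (simp add: \<phi>_def \<iota>_def zeq algebra_simps)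
      also have "\<dots> \<le> (1 - a) * \<bar>lf (fst u) y - lf \<theta> y\<bar> + a * \<bar>ln (Q y (\<iota> u)) - ln (Q y ?z)\<bar>"
        using a by (intro order_trans[OF abs_triangle_ineq4]) (simp add: abs_mult)
      also have "\<dots> \<le> 1 * (K2 y * norm (u - (\<theta>, ?l))) + 1 * (((1 + Bl) * K1 y * norm (u - (\<theta>, ?l))) / L)"
        using a by (intro add_mono mult_mono 1 2) auto
      finally show ?thesis by (simp add: algebra_simps)
    qed
    define \<Psi> where "\<Psi> u = (\<integral>y. \<phi> y u \<partial>F)" for u
    have intK: "integrable F (\<lambda>y. K2 y + (1 + Bl) * K1 y / L)"
      using K2_integrable K1_powers by simp
    have "(\<Psi> has_derivative (\<lambda>u. \<integral>y. indicat_real \<Omega> y *\<^sub>R \<phi>' y u \<partial>F)) (at (\<theta>, ?l))"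
      unfolding \<Psi>_def[abs_def] by (rule dominated_has_derivative(1)[OF \<Omega> s(1) \<phi>int \<phi>der intK \<phi>lip])
    moreover have "(\<integral>y. indicat_real \<Omega> y *\<^sub>R \<phi>' y u \<partial>F) = fst u \<bullet> fst (ES ?z)" for u
    proof -
      define T where "T w = fst u \<bullet> fst w - a * (snd u \<bullet> fst (snd w))" for w :: "'p \<times> 'q \<times> 'r"
      have T: "bounded_linear T" unfolding T_def
        by (intro bounded_linear_intros bounded_linear_sub bounded_linear_inner_right_comp bounded_linear_const_mult)
      have "indicat_real \<Omega> y *\<^sub>R \<phi>' y u = T (G y ?z)" for y
        by (simp add: \<phi>'_def T_def G_def S_def algebra_simps)
      then have "(\<integral>y. indicat_real \<Omega> y *\<^sub>R \<phi>' y u \<partial>F) = T (ES ?z)"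
        unfolding ES_def using integral_bounded_linear[OF T G_integrable[OF z]] by simp
      then show ?thesis using ES2_gp[OF z] by (simp add: T_def)
    qed
    ultimately have \<Psi>d: "(\<Psi> has_derivative (\<lambda>u. fst u \<bullet> fst (ES ?z))) (at (\<theta>, ?l))" by simp
    obtain L' where L': "((\<lambda>x. lam (fst x) (snd x)) has_derivative L') (at (\<theta>, P))" using lam_der[OF z] .
    have dl: "((\<lambda>t. lam t P) has_derivative (\<lambda>v. L' (v, 0))) (at \<theta>)"
      using has_derivative_compose[OF has_derivative_Pair[OF has_derivative_ident has_derivative_const] L'] by simp
    have dpair: "((\<lambda>t. (t, lam t P)) has_derivative (\<lambda>v. (v, L' (v, 0)))) (at \<theta>)"
      by (intro has_derivative_Pair has_derivative_ident dl)
    have comp: "((\<lambda>t. \<Psi> (t, lam t P)) has_derivative (\<lambda>v. v \<bullet> fst (ES ?z))) (at \<theta>)"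
      using has_derivative_compose[OF dpair \<Psi>d] by simp
    have "isCont (\<lambda>t. (t, lam t P)) \<theta>" using dpair by (rule has_derivative_continuous)
    then have "((\<lambda>t. (t, lam t P)) \<longlongrightarrow> (\<theta>, ?l)) (nhds \<theta>)"
      unfolding isCont_def by (rule tendsto_at_iff_tendsto_nhds[of "\<lambda>t. (t, lam t P)" \<theta>, THEN iffD1])
    then have "\<forall>\<^sub>F t in nhds \<theta>. (t, lam t P) \<in> ball (\<theta>, ?l) s" using s(1) by (intro topological_tendstoD) auto
    then have near: "\<forall>\<^sub>F t in nhds \<theta>. eexpectation F (\<lambda>y. psi a f m mu lam y t P) = ereal (\<Psi> (t, lam t P))"
    proof eventually_elim
      case (elim t)
      have b: "gp (t, P) \<in> ball \<alpha>0 r" using elim s(2) by (auto simp: \<iota>_def gp_def)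
      show ?case unfolding \<Psi>_def
      proof (rule eexpectation_real[OF _ \<phi>int[OF elim]])
        show "AE y in F. psi a f m mu lam y t P = ereal (\<phi> y (t, lam t P))"
          using \<Omega>(2)
        proof eventually_elim
          case (elim y)
          then show ?case using psi_real[OF elim b] by (simp add: psr_def \<phi>_def \<iota>_def gp_def)
        qed
      qed
    qed
    have "((\<lambda>t. real_of_ereal (eexpectation F (\<lambda>y. psi a f m mu lam y t P))) has_derivative (\<lambda>v. v \<bullet> fst (ES ?z))) (at \<theta>)"
      by (rule has_derivative_eventually_cong[OF comp]) (use near in eventually_elim, simp)
    moreover have "\<forall>\<^sub>F t in nhds \<theta>. \<bar>eexpectation F (\<lambda>y. psi a f m mu lam y t P)\<bar> \<noteq> \<infinity>"
      using near by eventually_elim simp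
    ultimately show ?case using elim(1) by (simp add: x has_egrad_def gderiv_def)
  qed
qed

text \<open>The three components vanish for three reasons: \<theta>0 is critical, \<open>l0\<close>
  solves the multiplier equation, and P0 is the root of the mean of \<open>h\<close>.\<close>

lemma ES_\<alpha>0: "ES \<alpha>0 = 0"
proof -
  have "has_egrad (\<lambda>\<theta>. eexpectation F (\<lambda>y. psi a f m mu lam y \<theta> P0)) 0 \<theta>0"
    using theta[of P0] unfolding sole_critical_maximizer_def \<theta>0_def by blast
  moreover have "has_egrad (\<lambda>\<theta>. eexpectation F (\<lambda>y. psi a f m mu lam y \<theta> P0)) (fst (ES \<alpha>0)) \<theta>0"
    using eventually_nhds_x_imp_x[OF criterion_egrad] by (simp add: gp_\<alpha>0)
  ultimately have "fst (ES \<alpha>0) = 0" by (metis has_egrad_unique)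
  moreover have "fst (snd (ES \<alpha>0)) = 0" using ES2_gp[of "(\<theta>0, P0)"] r by (simp add: gp_\<alpha>0)
  moreover have "snd (snd (ES \<alpha>0)) = 0"
  proof -
    have bl: "bounded_linear (\<lambda>x :: 'p \<times> 'q \<times> 'r. snd (snd x))" by (intro bounded_linear_intros)
    have "snd (snd (EG \<alpha>0)) = (\<integral>y. snd (snd (Jn \<alpha>0 y)) \<partial>F)"
      unfolding expected_est_fun_def by (rule integral_bounded_linear[OF bl i_int'[OF \<alpha>0_in_ball], symmetric])
    then show ?thesis using EG_snd[OF \<alpha>0_in_ball] h_P0 by (simp add: Jn_eq \<alpha>0_def)
  qed
  ultimately show ?thesis by (simp add: prod_eq_iff)
qed

section \<open>Block structure and injectivity of the derivatives at \<alpha>0\<close>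

lemma EG'_ex: obtains E' where "(EG has_derivative E') (at \<alpha>0)" "bij E'"
  using iii unfolding \<alpha>0 by blast

text \<open>The first component of the function in (i) ignores the free multiplier and the third
  depends on P alone; the last two components agree with those of \<open>ES\<close> on a whole
  ball.\<close>

lemma EG_block:
  assumes E': "(EG has_derivative E') (at \<alpha>0)"
  shows "fst (E' (0, v, 0)) = 0" "snd (snd (E' (x, v, 0))) = 0" "snd (E' u) = snd (D u)"
proof -
  interpret E': bounded_linear E' using E' by (rule has_derivative_bounded_linear)
  \<comment> \<open>A function that is constant along a line has directional derivative zero
    there.\<close>
  have const: "T (E' w) = 0"
    if T: "bounded_linear T" and c: "\<And>t. \<alpha>0 + t *\<^sub>R w \<in> ball \<alpha>0 r \<Longrightarrow> T (EG (\<alpha>0 + t *\<^sub>R w)) = T (EG \<alpha>0)"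
    for T :: "'p \<times> 'q \<times> 'r \<Rightarrow> 'z::real_normed_vector" and w
  proof -
    have "((\<lambda>t. \<alpha>0 + t *\<^sub>R w) has_derivative (\<lambda>t. t *\<^sub>R w)) (at (0::real))"
      by (auto intro!: derivative_eq_intros)
    then have "((\<lambda>t. T (EG (\<alpha>0 + t *\<^sub>R w))) has_derivative (\<lambda>t. T (E' (t *\<^sub>R w)))) (at 0)"
      by (intro bounded_linear.has_derivative[OF T] has_derivative_compose[of "\<lambda>t. \<alpha>0 + t *\<^sub>R w" _ _ _ EG E']) (simp_all add: E')
    moreover have "\<forall>\<^sub>F t in nhds (0::real). \<alpha>0 + t *\<^sub>R w \<in> ball \<alpha>0 r"
    proof -
      have "((\<lambda>t. \<alpha>0 + t *\<^sub>R w) \<longlongrightarrow> \<alpha>0 + 0 *\<^sub>R w) (nhds (0::real))" by (intro tendsto_intros filterlim_ident)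
      then show ?thesis using r by (intro topological_tendstoD) auto
    qed
    then have "\<forall>\<^sub>F t in nhds (0::real). T (EG (\<alpha>0 + t *\<^sub>R w)) = T (EG \<alpha>0)"
      by eventually_elim (rule c)
    ultimately have "((\<lambda>t. T (EG \<alpha>0)) has_derivative (\<lambda>t. T (E' (t *\<^sub>R w)))) (at (0::real))"
      by (rule has_derivative_eventually_cong)
    then have "(\<lambda>t. T (E' (t *\<^sub>R w))) = (\<lambda>t::real. 0)" by (rule has_derivative_unique) simp
    from fun_cong[OF this, of 1] show ?thesis by simp
  qed
  have i: "fst (EG z) = (\<integral>y. fst (Jn z y) \<partial>F)" "snd (snd (EG z)) = (\<integral>y. snd (snd (Jn z y)) \<partial>F)" if "z \<in> ball \<alpha>0 r" for z
  proof -
    have bl: "bounded_linear (\<lambda>x :: 'p \<times> 'q \<times> 'r. snd (snd x))" by (intro bounded_linear_intros)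
    show "fst (EG z) = (\<integral>y. fst (Jn z y) \<partial>F)"  "snd (snd (EG z)) = (\<integral>y. snd (snd (Jn z y)) \<partial>F)"
      unfolding expected_est_fun_def
      by (rule integral_bounded_linear[OF bounded_linear_fst i_int'[OF that], symmetric])
         (rule integral_bounded_linear[OF bl i_int'[OF that], symmetric])
  qed
  show "fst (E' (0, v, 0)) = 0"
  proof (rule const[OF bounded_linear_fst])
    fix t assume "\<alpha>0 + t *\<^sub>R (0, v, 0) \<in> ball \<alpha>0 r"
    then show "fst (EG (\<alpha>0 + t *\<^sub>R (0, v, 0))) = fst (EG \<alpha>0)"
      unfolding i(1)[OF \<alpha>0_in_ball] by (subst i(1)) (simp_all add: Jn_eq \<alpha>0_def)
  qed
  have bl: "bounded_linear (\<lambda>x :: 'p \<times> 'q \<times> 'r. snd (snd x))" by (intro bounded_linear_intros)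
  show "snd (snd (E' (x, v, 0))) = 0"
  proof (rule const[OF bl])
    fix t assume "\<alpha>0 + t *\<^sub>R (x, v, 0) \<in> ball \<alpha>0 r"
    then show "snd (snd (EG (\<alpha>0 + t *\<^sub>R (x, v, 0)))) = snd (snd (EG \<alpha>0))"
      unfolding i(2)[OF \<alpha>0_in_ball] by (subst i(2)) (simp_all add: Jn_eq \<alpha>0_def)
  qed
  have "((\<lambda>z. snd (ES z)) has_derivative (\<lambda>u. snd (D u))) (at \<alpha>0)"
    by (intro has_derivative_snd ES_der)
  moreover have "((\<lambda>z. snd (ES z)) has_derivative (\<lambda>u. snd (E' u))) (at \<alpha>0)"
  proof (rule has_derivative_eventually_cong[OF has_derivative_snd[OF E']])
    show "\<forall>\<^sub>F z in nhds \<alpha>0. snd (EG z) = snd (ES z)"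
      using eventually_nhds_in_open[OF open_ball \<alpha>0_in_ball] by eventually_elim (rule EG_snd)
  qed
  ultimately have "(\<lambda>u. snd (D u)) = (\<lambda>u. snd (E' u))" by (rule has_derivative_unique)
  then show "snd (E' u) = snd (D u)" by metis
qed

lemma D_bl: "bounded_linear D" using ES_der by (rule has_derivative_bounded_linear)

lemma D_multiplier_block: "fst (snd (D (0, v, 0))) = 0 \<Longrightarrow> v = 0"
proof -
  assume *: "fst (snd (D (0, v, 0))) = 0"
  obtain E' where E': "(EG has_derivative E') (at \<alpha>0)" using EG'_ex by metis
  have "gp (\<theta>0, P0) \<in> ball \<alpha>0 r" using r by (simp add: gp_\<alpha>0)
  then show "v = 0"
    by (rule multiplier_block_injective[of "(\<theta>0, P0)" E']) (use * EG_block(3)[OF E'] E' in \<open>simp_all add: gp_\<alpha>0\<close>)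
qed

text \<open>Complete \<open>x\<close> by a multiplier direction \<open>v\<close> that cancels the
  second component. The first does not see \<open>v\<close>, the third sees neither, so the
  completed vector is in the kernel and (iii) applies.\<close>

lemma EG'_critical_block:
  assumes E': "(EG has_derivative E') (at \<alpha>0)" "bij E'" and zero: "fst (E' (x, 0, 0)) = 0"
  shows "x = 0"
proof -
  interpret E': bounded_linear E' using E'(1) by (rule has_derivative_bounded_linear)
  define B where "B v = fst (snd (E' (0, v, 0)))" for v
  have B: "bounded_linear B" unfolding B_def
    by (intro bounded_linear_fst_comp bounded_linear_snd_comp E'.bounded_linear bounded_linear_intros bounded_linear_compose[OF E'.bounded_linear])
  have "v = 0" if "B v = 0" for v
    using that D_multiplier_block[of v] EG_block(3)[OF E'(1)] by (simp add: B_def)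
  then obtain B' where B': "\<And>x. B (B' x) = x" using injective_linear_inverse[OF B] by metis
  define v where "v = B' (- fst (snd (E' (x, 0, 0))))"
  have "(x, v, 0 :: 'r) = (x, 0, 0) + (0, v, 0)" by simp
  then have split: "E' (x, v, 0) = E' (x, 0, 0) + E' (0, v, 0)" by (metis E'.add)
  have "fst (snd (E' (0, v, 0))) = - fst (snd (E' (x, 0, 0)))" using B' by (simp add: v_def B_def)
  then have "fst (snd (E' (x, v, 0))) = 0" by (simp only: split snd_add fst_add add.right_inverse)
  moreover have "fst (E' (x, v, 0)) = 0"
    by (simp only: split fst_add zero EG_block(1)[OF E'(1)] add_0)
  ultimately have "E' (x, v, 0) = 0"
    using EG_block(2)[OF E'(1), of x v] by (simp add: prod_eq_iff)
  then have "(x, v, 0) = (0 :: 'p \<times> 'q \<times> 'r)" using E'(2) E'.zero by (metis bij_def injD)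
  then show ?thesis by (simp add: zero_prod_def)
qed

text \<open>The implicit function lemma is applied to the first component of the function in (i).
  Its solution is a critical point of the criterion in the interior, hence equals
  \<open>theta P\<close> by uniqueness.\<close>

lemma theta_derivative:
  obtains T' where "(theta has_derivative T') (at P0)"
    "\<forall>\<^sub>F P in nhds P0. gp (theta P, P) \<in> ball \<alpha>0 r \<and> fst (ES (gp (theta P, P))) = 0"
proof -
  obtain E' where E': "(EG has_derivative E') (at \<alpha>0)" "bij E'" using EG'_ex .
  interpret E': bounded_linear E' using E'(1) by (rule has_derivative_bounded_linear)
  \<comment> \<open>The multiplier can be frozen at \<open>l0\<close>, since the first component
    does not depend on it.\<close>
  define \<iota> where "\<iota> p = (fst p, l0, snd p)" for p :: "'p \<times> 'r"
  have \<iota>d: "(\<iota> has_derivative (\<lambda>p. (fst p, 0, snd p))) (at p)" for p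
    unfolding \<iota>_def by (intro has_derivative_Pair has_derivative_const bounded_linear_imp_has_derivative bounded_linear_fst bounded_linear_snd)
  have \<iota>c: "continuous_on UNIV \<iota>" unfolding \<iota>_def by (intro continuous_intros)
  have \<iota>0: "\<iota> (\<theta>0, P0) = \<alpha>0" by (simp add: \<iota>_def \<alpha>0_def)
  obtain X X' where X: "(X has_derivative X') (at P0)" "X P0 = \<theta>0"
    "\<forall>\<^sub>F P in nhds P0. (X P, P) \<in> \<iota> -` ball \<alpha>0 r \<and> fst (EG (\<iota> (X P, P))) = 0"
  proof (rule implicit_function_at[of "\<lambda>p. fst (EG (\<iota> p))" "\<lambda>p. fst (E' (fst p, 0, snd p))" \<theta>0 P0 "\<iota> -` ball \<alpha>0 r"])
    show "((\<lambda>p. fst (EG (\<iota> p))) has_derivative (\<lambda>p. fst (E' (fst p, 0, snd p)))) (at (\<theta>0, P0))"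
      by (intro has_derivative_fst has_derivative_compose[OF \<iota>d]) (simp add: \<iota>0 E')
    have "fst (EG (\<theta>0, l0, P0)) = fst (ES (gp (\<theta>0, P0)))"
      by (rule EG_fst) (use r in \<open>simp_all add: gp_\<alpha>0 \<alpha>0_def[symmetric]\<close>)
    then show "fst (EG (\<iota> (\<theta>0, P0))) = 0" by (simp add: gp_\<alpha>0 \<iota>_def ES_\<alpha>0)
    show "v = 0" if "fst (E' (fst (v, 0::'r), 0, snd (v, 0::'r))) = 0" for v
      using EG'_critical_block[OF E'] that by simp
    show "open (\<iota> -` ball \<alpha>0 r)" by (intro open_vimage open_ball \<iota>c)
    show "(\<theta>0, P0) \<in> \<iota> -` ball \<alpha>0 r" using r by (simp only: vimage_eq \<iota>0) simp
    show "continuous_on (\<iota> -` ball \<alpha>0 r) (\<lambda>p. fst (EG (\<iota> p)))"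
      by (intro continuous_on_fst continuous_on_compose2[OF EG_continuous continuous_on_subset[OF \<iota>c]]) auto
  qed
  have "isCont X P0" using X(1) by (rule has_derivative_continuous)
  then have "(X \<longlongrightarrow> X P0) (nhds P0)" by (simp add: isCont_def tendsto_at_iff_tendsto_nhds)
  \<comment> \<open>The gradient formula holds near the pair of \<theta>0 and P0; continuity of
    \<open>X\<close> transports it to the points \<open>(X P, P)\<close>.\<close>
  then have "filterlim (\<lambda>P. (X P, P)) (nhds (\<theta>0, P0)) (nhds P0)"
    unfolding X(2) by (intro tendsto_Pair filterlim_ident)
  from eventually_compose_filterlim[OF criterion_egrad this] X(3)
  have ev: "\<forall>\<^sub>F P in nhds P0. X P = theta P \<and> gp (X P, P) \<in> ball \<alpha>0 r \<and> fst (ES (gp (X P, P))) = 0"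
  proof eventually_elim
    case (elim P)
    have z: "gp (X P, P) \<in> ball \<alpha>0 r" using elim by simp
    have l: "(X P, l0, P) \<in> ball \<alpha>0 r" using elim by (simp add: \<iota>_def)
    have 0: "fst (ES (gp (X P, P))) = 0" using EG_fst[OF z l] elim by (simp add: \<iota>_def)
    moreover have "X P \<in> interior \<Theta>" using ball_proj(5)[OF l] by simp
    ultimately have "X P = theta P"
      using theta[of P] elim unfolding sole_critical_maximizer_def by auto
    with 0 z show ?case by simp
  qed
  show ?thesis
  proof (rule that)
    show "(theta has_derivative X') (at P0)"
      by (rule has_derivative_eventually_cong[OF X(1)]) (use ev in eventually_elim, simp)
    show "\<forall>\<^sub>F P in nhds P0. gp (theta P, P) \<in> ball \<alpha>0 r \<and> fst (ES (gp (theta P, P))) = 0"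
      using ev by eventually_elim auto
  qed
qed

lemma lam_der0: obtains L' where "((\<lambda>x. lam (fst x) (snd x)) has_derivative L') (at (\<theta>0, P0))"
  by (rule lam_der[of "(\<theta>0, P0)"]) (simp_all add: gp_\<alpha>0 r)

text \<open>Obtained by differentiating the two population equations along the curve of their
  solutions; \<open>N'\<close> is the derivative of P \<mapsto> \<open>lam (theta P) P\<close>. This
  direction is what relates the two estimators.\<close>

lemma D_theta:
  obtains T' N' where "(theta has_derivative T') (at P0)" "bounded_linear N'"
    "\<And>v. fst (D (T' v, N' v, v)) = 0" "\<And>v. fst (snd (D (T' v, N' v, v))) = 0"
proof -
  obtain T' where T': "(theta has_derivative T') (at P0)"
    "\<forall>\<^sub>F P in nhds P0. gp (theta P, P) \<in> ball \<alpha>0 r \<and> fst (ES (gp (theta P, P))) = 0"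
    using theta_derivative .
  obtain L' where L': "((\<lambda>x. lam (fst x) (snd x)) has_derivative L') (at (\<theta>0, P0))" using lam_der0 .
  have th0: "theta P0 = \<theta>0" by (simp add: \<theta>0_def)
  have dp: "((\<lambda>P. (theta P, P)) has_derivative (\<lambda>v. (T' v, v))) (at P0)"
    by (intro has_derivative_Pair T' has_derivative_ident)
  have "((\<lambda>P. gp (theta P, P)) has_derivative (\<lambda>v. (T' v, L' (T' v, v), v))) (at P0)"
    using has_derivative_compose[OF dp, of gp "\<lambda>v. (fst v, L' v, snd v)"] gp_der[OF L'] by (simp add: th0)
  from has_derivative_compose[OF this, of ES D]
  have d: "((\<lambda>P. ES (gp (theta P, P))) has_derivative (\<lambda>v. D (T' v, L' (T' v, v), v))) (at P0)"
    using ES_der by (simp add: th0 gp_\<alpha>0)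
  have bl: "bounded_linear (\<lambda>v. L' (T' v, v))"
    by (rule has_derivative_bounded_linear[OF has_derivative_compose[OF dp, of "\<lambda>x. lam (fst x) (snd x)" L']])
       (simp add: L' th0)
  have "((\<lambda>P. 0) has_derivative (\<lambda>v. fst (D (T' v, L' (T' v, v), v)))) (at P0)"
    by (rule has_derivative_eventually_cong[OF has_derivative_fst[OF d]]) (use T'(2) in eventually_elim, simp)
  then have "(\<lambda>v. fst (D (T' v, L' (T' v, v), v))) = (\<lambda>v. 0)" by (rule has_derivative_unique) simp
  moreover have "((\<lambda>P. 0) has_derivative (\<lambda>v. fst (snd (D (T' v, L' (T' v, v), v))))) (at P0)"
    by (rule has_derivative_eventually_cong[OF has_derivative_fst[OF has_derivative_snd[OF d]]])
       (use T'(2) in eventually_elim, simp add: ES2_gp)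
  then have "(\<lambda>v. fst (snd (D (T' v, L' (T' v, v), v)))) = (\<lambda>v. 0)" by (rule has_derivative_unique) simp
  ultimately show ?thesis using that[OF T'(1) bl] by metis
qed

text \<open>Transfer of (iii). On directions tangent to the graph of \<open>lam\<close> the second
  component of \<open>D\<close> vanishes and the first equals that of \<open>E'\<close> in the
  direction of \<theta> alone.\<close>

lemma D_injective:
  assumes "fst (D (x, v, 0)) = 0" "fst (snd (D (x, v, 0))) = 0"
  shows "x = 0 \<and> v = 0"
proof -
  interpret D: bounded_linear D by (rule D_bl)
  obtain E' where E': "(EG has_derivative E') (at \<alpha>0)" "bij E'" using EG'_ex .
  obtain L' where L': "((\<lambda>x. lam (fst x) (snd x)) has_derivative L') (at (\<theta>0, P0))" using lam_der0 .
  have near: "\<forall>\<^sub>F t in nhds \<theta>0. gp (t, P0) \<in> ball \<alpha>0 r"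
    by (rule near_fst, rule gp_near) (simp add: gp_\<alpha>0 r)
  have near': "\<forall>\<^sub>F t in nhds \<theta>0. (t, l0, P0) \<in> ball \<alpha>0 r"
    using eventually_nhds_in_open[OF open_ball, of \<theta>0 \<theta>0 r] r
    by (auto elim!: eventually_mono simp: \<alpha>0_def dist_Pair_Pair)
  have "((\<lambda>t. (t, P0)) has_derivative (\<lambda>u. (u, 0))) (at \<theta>0)"
    by (intro has_derivative_Pair has_derivative_ident has_derivative_const)
  from has_derivative_compose[OF this, of gp "\<lambda>v. (fst v, L' v, snd v)"]
  have dgp: "((\<lambda>t. gp (t, P0)) has_derivative (\<lambda>u. (u, L' (u, 0), 0))) (at \<theta>0)"
    using gp_der[OF L'] by simp
  then have dES: "((\<lambda>t. ES (gp (t, P0))) has_derivative (\<lambda>u. D (u, L' (u, 0), 0))) (at \<theta>0)"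
    using has_derivative_compose[OF dgp, of ES D] ES_der by (simp add: gp_\<alpha>0)
  have "((\<lambda>t. 0) has_derivative (\<lambda>u. fst (snd (D (u, L' (u, 0), 0))))) (at \<theta>0)"
    by (rule has_derivative_eventually_cong[OF has_derivative_fst[OF has_derivative_snd[OF dES]]])
       (use near in eventually_elim, simp add: ES2_gp)
  then have "(\<lambda>u. fst (snd (D (u, L' (u, 0), 0)))) = (\<lambda>v. 0)" by (rule has_derivative_unique) simp
  then have 2: "fst (snd (D (u, L' (u, 0), 0))) = 0" for u by metis
  have dEG: "((\<lambda>t. EG (t, l0, P0)) has_derivative (\<lambda>u. E' (u, 0, 0))) (at \<theta>0)"
    by (rule has_derivative_compose[of "\<lambda>t. (t, l0, P0)" "\<lambda>u. (u, 0, 0)" \<theta>0 UNIV EG E'])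
       (use E' in \<open>auto intro!: has_derivative_Pair has_derivative_const has_derivative_ident simp: \<alpha>0_def\<close>)
  have "((\<lambda>t. fst (ES (gp (t, P0)))) has_derivative (\<lambda>u. fst (E' (u, 0, 0)))) (at \<theta>0)"
    by (rule has_derivative_eventually_cong[OF has_derivative_fst[OF dEG]])
       (use near near' in eventually_elim, simp add: EG_fst)
  then have "(\<lambda>u. fst (D (u, L' (u, 0), 0))) = (\<lambda>u. fst (E' (u, 0, 0)))"
    by (rule has_derivative_unique[OF has_derivative_fst[OF dES]])
  then have 1: "fst (D (u, L' (u, 0), 0)) = fst (E' (u, 0, 0))" for u by metis
  \<comment> \<open>Subtracting the tangent direction with the same \<theta> part leaves a pure
    multiplier direction, which must vanish.\<close>
  have "(x, v, 0 :: 'r) - (x, L' (x, 0), 0) = (0, v - L' (x, 0), 0)" by simp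
  then have "D (0, v - L' (x, 0), 0) = D (x, v, 0) - D (x, L' (x, 0), 0)" by (metis D.diff)
  then have "fst (snd (D (0, v - L' (x, 0), 0))) = 0" using 2[of x] assms(2) by simp
  then have v: "v = L' (x, 0)" using D_multiplier_block by fastforce
  then have "fst (E' (x, 0, 0)) = 0" using 1[of x] assms(1) by simp
  then have "x = 0" by (rule EG'_critical_block[OF E'])
  moreover have "L' 0 = 0" using has_derivative_bounded_linear[OF L'] by (simp add: linear_simps)
  ultimately show ?thesis using v by (simp add: zero_prod_def)
qed

text \<open>\<open>H\<close> is the mean derivative of \<open>h\<close>. It is surjective because
  \<open>E'\<close> is, and hence injective by dimension; this yields the rate of the plug-in
  estimator.\<close>

lemma D_nuisance_block:
  obtains H where "bounded_linear H" "\<And>u. H u = 0 \<Longrightarrow> u = 0" "\<And>x v u. snd (snd (D (x, v, u))) = H u"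
proof -
  interpret D: bounded_linear D by (rule D_bl)
  obtain E' where E': "(EG has_derivative E') (at \<alpha>0)" "bij E'" using EG'_ex .
  define H where "H u = snd (snd (D (0, 0, u)))" for u
  have H: "bounded_linear H" unfolding H_def
    by (intro bounded_linear_snd_comp bounded_linear_compose[OF D_bl] bounded_linear_intros)
  have eq: "snd (snd (D (x, v, u))) = H u" for x v u
  proof -
    have "(x, v, u) = (x, v, 0) + (0, 0, u)" by simp
    then have "D (x, v, u) = D (x, v, 0) + D (0, 0, u)" by (metis D.add)
    then show ?thesis using EG_block(2)[OF E'(1), of x v] EG_block(3)[OF E'(1)] by (simp add: H_def)
  qed
  have "surj H"
  proof (rule surjI)
    fix w :: 'r
    show "H (snd (snd (inv E' (0, 0, w)))) = w"
    proof -
      have "E' (inv E' (0, 0, w)) = (0, 0, w)" using E'(2) by (simp add: bij_is_surj surj_f_inv_f)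
      then have "snd (snd (D (inv E' (0, 0, w)))) = w" using EG_block(3)[OF E'(1)] by (metis snd_conv)
      then show ?thesis using eq by (metis prod.collapse)
    qed
  qed
  then have "inj H"
    by (intro linear_surjective_imp_injective) (use H in \<open>auto simp: linear_conv_bounded_linear\<close>)
  then have "u = 0" if "H u = 0" for u
    using that H by (metis injD linear_simps(3))
  then show ?thesis using that[OF H] eq by blast
qed

end

section \<open>The sample criterion\<close>

text \<open>The weights are those of Lagrange's method; the multiplier equation makes them feasible,
  and the comparison with a competitor is the inequality of arithmetic and geometric means in
  exponential form.\<close>

lemma emp_lik_eq:
  fixes m :: "'y \<Rightarrow> 's \<Rightarrow> 'r \<Rightarrow> 'q::real_inner"
  assumes n: "n > 0" and pos: "\<And>i. i < n \<Longrightarrow> 0 < 1 + l \<bullet> m (y i) \<mu> P"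
    and zero: "(\<Sum>i<n. inverse (1 + l \<bullet> m (y i) \<mu> P) *\<^sub>R m (y i) \<mu> P) = 0"
  shows "emp_lik m n y \<mu> P = (\<Prod>i<n. 1 / (real n * (1 + l \<bullet> m (y i) \<mu> P)))"
proof -
  define q where "q i = 1 + l \<bullet> m (y i) \<mu> P" for i
  define w where "w i = 1 / (real n * q i)" for i
  define A where "A = {\<Prod>i<n. w i | w :: nat \<Rightarrow> real.
                 (\<Sum>i<n. w i) = 1 \<and> (\<Sum>i<n. w i *\<^sub>R m (y i) \<mu> P) = 0 \<and> (\<forall>i<n. 0 \<le> w i)}"
  have q: "0 < q i" if "i < n" for i using pos[OF that] by (simp add: q_def)
  have "(\<Sum>i<n. inverse (q i)) = (\<Sum>i<n. 1 - l \<bullet> (inverse (q i) *\<^sub>R m (y i) \<mu> P))"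
  proof (rule sum.cong[OF refl])
    fix i assume "i \<in> {..<n}"
    then have "q i \<noteq> 0" using q[of i] by simp
    then have "inverse (q i) = inverse (q i) * (q i - l \<bullet> m (y i) \<mu> P)" by (simp add: q_def)
    also have "\<dots> = 1 - l \<bullet> (inverse (q i) *\<^sub>R m (y i) \<mu> P)"
      using \<open>q i \<noteq> 0\<close> by (simp add: right_diff_distrib)
    finally show "inverse (q i) = 1 - l \<bullet> (inverse (q i) *\<^sub>R m (y i) \<mu> P)" .
  qed
  also have "\<dots> = real n - l \<bullet> (\<Sum>i<n. inverse (q i) *\<^sub>R m (y i) \<mu> P)"
    by (simp add: sum_subtractf inner_sum_right)
  finally have sinv: "(\<Sum>i<n. inverse (q i)) = real n" using zero by (simp add: q_def)
  have w1: "(\<Sum>i<n. w i) = 1"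
  proof -
    have "(\<Sum>i<n. w i) = (\<Sum>i<n. inverse (q i)) / real n"
      unfolding w_def sum_divide_distrib by (simp add: divide_inverse mult.commute)
    then show ?thesis using sinv n by simp
  qed
  have w2: "(\<Sum>i<n. w i *\<^sub>R m (y i) \<mu> P) = 0"
  proof -
    have "(\<Sum>i<n. w i *\<^sub>R m (y i) \<mu> P) = inverse (real n) *\<^sub>R (\<Sum>i<n. inverse (q i) *\<^sub>R m (y i) \<mu> P)"
      by (simp add: w_def scaleR_sum_right divide_inverse)
    then show ?thesis using zero by (simp add: q_def)
  qed
  have w3: "\<forall>i<n. 0 \<le> w i" using q by (auto simp: w_def less_imp_le)
  have mem: "(\<Prod>i<n. w i) \<in> A" unfolding A_def using w1 w2 w3 by blast
  have ub: "x \<le> (\<Prod>i<n. w i)" if "x \<in> A" for x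
  proof -
    obtain v where v: "x = (\<Prod>i<n. v i)" "(\<Sum>i<n. v i) = 1" "(\<Sum>i<n. v i *\<^sub>R m (y i) \<mu> P) = 0" "\<forall>i<n. 0 \<le> v i"
      using \<open>x \<in> A\<close> unfolding A_def by blast
    \<comment> \<open>Each summand is the ratio of the competitor's weight to the Lagrange weight;
      by the constraints these ratios add up to n.\<close>
    have "(\<Sum>i<n. real n * q i * v i) = real n * ((\<Sum>i<n. v i) + l \<bullet> (\<Sum>i<n. v i *\<^sub>R m (y i) \<mu> P))"
      by (simp add: q_def inner_sum_right sum_distrib_left sum.distrib[symmetric] algebra_simps)
    then have s: "(\<Sum>i<n. real n * q i * v i) = real n" using v by simp
    \<comment> \<open>The bound \<open>x \<le> exp (x - 1)\<close> stands in for concavity of the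
      logarithm and also covers weights equal to zero.\<close>
    have "(\<Prod>i<n. real n * q i * v i) \<le> (\<Prod>i<n. exp (real n * q i * v i - 1))"
    proof (rule prod_mono)
      fix i assume "i \<in> {..<n}"
      then show "0 \<le> real n * q i * v i \<and> real n * q i * v i \<le> exp (real n * q i * v i - 1)"
        using v(4) q[of i] exp_ge_add_one_self[of "real n * q i * v i - 1"] by (simp add: less_imp_le)
    qed
    also have "\<dots> = exp (\<Sum>i<n. real n * q i * v i - 1)" by (simp add: exp_sum)
    also have "\<dots> = 1" by (simp add: sum_subtractf s)
    finally have le1: "(\<Prod>i<n. real n * q i * v i) \<le> 1" .
    have wpos: "0 < (\<Prod>i<n. w i)" using q n by (intro prod_pos) (simp add: w_def)
    have "x = (\<Prod>i<n. w i * (real n * q i * v i))"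
      unfolding v(1)
    proof (rule prod.cong[OF refl])
      fix i assume "i \<in> {..<n}"
      then have "q i \<noteq> 0" using q[of i] by simp
      then show "v i = w i * (real n * q i * v i)" using n by (simp add: w_def)
    qed
    also have "\<dots> = (\<Prod>i<n. w i) * (\<Prod>i<n. real n * q i * v i)" by (rule prod.distrib)
    also have "\<dots> \<le> (\<Prod>i<n. w i) * 1" using le1 wpos by (intro mult_left_mono) auto
    finally show ?thesis by simp
  qed
  have "Sup A = (\<Prod>i<n. w i)" by (rule cSup_eq_maximum[OF mem ub])
  then have "emp_lik m n y \<mu> P = (\<Prod>i<n. w i)"
    using mem by (auto simp: emp_lik_def A_def[symmetric])
  then show ?thesis by (simp add: w_def q_def)
qed

context regular_hybrid_model
begin

text \<open>As in the population, the multiplier of the sample is differentiable in \<open>\<theta>\<close>, and its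
  derivative drops out of the gradient.\<close>

lemma sample_critical_point:
  assumes n: "n > 0" and y: "\<And>i. y i \<in> \<Omega>" and z: "(\<theta>, l, P) \<in> ball \<alpha>0 r"
    and S1: "(\<Sum>i<n. S1 (y i) (\<theta>, l, P)) = 0" and S2: "(\<Sum>i<n. S2 (y i) (\<theta>, l, P)) = 0"
    and span: "\<And>v. (\<And>i. i < n \<Longrightarrow> v \<bullet> Mf (y i) (\<theta>, P) = 0) \<Longrightarrow> v = 0"
  shows "has_egrad (\<lambda>t. hybrid_loglik a f m mu n y t P) 0 \<theta>"
proof -
  define \<iota> where "\<iota> p = (snd p, fst p, P)" for p :: "'q \<times> 'p"
  have \<iota>c: "continuous_on UNIV \<iota>" unfolding \<iota>_def by (intro continuous_intros)
  have \<iota>0: "\<iota> (l, \<theta>) = (\<theta>, l, P)" by (simp add: \<iota>_def)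
  define z0 where "z0 = (\<theta>, l, P)"
  have zb: "z0 \<in> ball \<alpha>0 r" using z by (simp add: z0_def)
  note p = ball_proj[OF z]
  define dM where "dM i u = blinfun_apply (M' (y i) (\<theta>, P)) (u, 0)" for i u
  define dQ where "dQ i q = l \<bullet> dM i (snd q) + fst q \<bullet> Mf (y i) (\<theta>, P)" for i and q :: "'q \<times> 'p"
  have Mder: "((\<lambda>t. Mf (y i) (t, P)) has_derivative dM i) (at \<theta>)" for i
    unfolding dM_def[abs_def] using p(1) by (intro Mf_der_fst y) simp
  have Mder': "((\<lambda>q. Mf (y i) (snd q, P)) has_derivative (\<lambda>q. dM i (snd q))) (at (l, \<theta>))" for i
    by (rule has_derivative_compose[of snd snd "(l, \<theta>)" UNIV "\<lambda>t. Mf (y i) (t, P)" "dM i"])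
       (auto intro!: bounded_linear_imp_has_derivative bounded_linear_snd Mder)
  have Qder: "((\<lambda>q. Q (y i) (\<iota> q)) has_derivative dQ i) (at (l, \<theta>))" for i
    unfolding Q_def \<iota>_def dQ_def[abs_def] by (auto intro!: derivative_eq_intros Mder')
  have Qpos: "0 < Q (y i) z0" for i by (rule Q_pos[OF y zb])
  have S2der: "((\<lambda>q. S2 (y i) (\<iota> q)) has_derivative
      (\<lambda>q. inverse (Q (y i) z0) *\<^sub>R dM i (snd q) - ((inverse (Q (y i) z0))\<^sup>2 * dQ i q) *\<^sub>R Mf (y i) (\<theta>, P))) (at (l, \<theta>))" for i
  proof -
    have "((\<lambda>q. inverse (Q (y i) (\<iota> q))) has_derivative (\<lambda>q. - (inverse (Q (y i) z0) * dQ i q * inverse (Q (y i) z0)))) (at (l, \<theta>))"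
      using Deriv.has_derivative_inverse[OF _ Qder[of i]] Qpos[of i] by (simp add: \<iota>0 z0_def)
    from has_derivative_scaleR[OF this Mder'[of i]]
    have "((\<lambda>q. S2 (y i) (\<iota> q)) has_derivative (\<lambda>q. inverse (Q (y i) z0) *\<^sub>R dM i (snd q)
       + (- (inverse (Q (y i) z0) * dQ i q * inverse (Q (y i) z0))) *\<^sub>R Mf (y i) (\<theta>, P))) (at (l, \<theta>))"
      by (simp add: S2_def \<iota>0 z0_def) (simp add: \<iota>_def)
    then show ?thesis by (simp add: power2_eq_square ac_simps)
  qed
  have dM0: "dM i 0 = 0" for i by (simp add: dM_def flip: zero_prod_def)
  obtain X X' where X: "(X has_derivative X') (at \<theta>)" "X \<theta> = l"
    "\<forall>\<^sub>F t in nhds \<theta>. (X t, t) \<in> \<iota> -` ball \<alpha>0 r \<and> (\<Sum>i<n. S2 (y i) (\<iota> (X t, t))) = 0"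
  proof (rule implicit_function_at[of "\<lambda>q. \<Sum>i<n. S2 (y i) (\<iota> q)"
      "\<lambda>q. \<Sum>i<n. inverse (Q (y i) z0) *\<^sub>R dM i (snd q) - ((inverse (Q (y i) z0))\<^sup>2 * dQ i q) *\<^sub>R Mf (y i) (\<theta>, P)"
      l \<theta> "\<iota> -` ball \<alpha>0 r"])
    show "((\<lambda>q. \<Sum>i<n. S2 (y i) (\<iota> q)) has_derivative
      (\<lambda>q. \<Sum>i<n. inverse (Q (y i) z0) *\<^sub>R dM i (snd q) - ((inverse (Q (y i) z0))\<^sup>2 * dQ i q) *\<^sub>R Mf (y i) (\<theta>, P))) (at (l, \<theta>))"
      by (intro has_derivative_sum S2der)
    show "(\<Sum>i<n. S2 (y i) (\<iota> (l, \<theta>))) = 0" by (simp add: \<iota>0 S2)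
    show "open (\<iota> -` ball \<alpha>0 r)" by (intro open_vimage open_ball \<iota>c)
    show "(l, \<theta>) \<in> \<iota> -` ball \<alpha>0 r" using z by (simp only: vimage_eq \<iota>0)
    have "continuous_on (ball \<alpha>0 r) (S2 (y i))" for i
      using S2_diff[OF y] by (meson continuous_at_imp_continuous_on differentiable_imp_continuous_within)
    then show "continuous_on (\<iota> -` ball \<alpha>0 r) (\<lambda>q. \<Sum>i<n. S2 (y i) (\<iota> q))"
      by (intro continuous_on_sum continuous_on_compose2[OF _ continuous_on_subset[OF \<iota>c]]) auto
    fix v
    assume *: "(\<Sum>i<n. inverse (Q (y i) z0) *\<^sub>R dM i (snd (v, 0::'p)) - ((inverse (Q (y i) z0))\<^sup>2 * dQ i (v, 0)) *\<^sub>R Mf (y i) (\<theta>, P)) = 0"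
    \<comment> \<open>The multiplier block is minus a Gram matrix; a kernel vector is therefore
      orthogonal to every \<open>Mf (y i)\<close>, which \<open>span\<close> excludes.\<close>
    have "(\<Sum>i<n. (inverse (Q (y i) z0) * (v \<bullet> Mf (y i) (\<theta>, P)))\<^sup>2)
       = - (v \<bullet> (\<Sum>i<n. inverse (Q (y i) z0) *\<^sub>R dM i (snd (v, 0::'p)) - ((inverse (Q (y i) z0))\<^sup>2 * dQ i (v, 0)) *\<^sub>R Mf (y i) (\<theta>, P)))"
      by (simp add: dM0 dQ_def inner_sum_right sum_negf[symmetric] power2_eq_square ac_simps)
    then have "(\<Sum>i<n. (inverse (Q (y i) z0) * (v \<bullet> Mf (y i) (\<theta>, P)))\<^sup>2) = 0" unfolding * by simp
    then have "\<forall>i\<in>{..<n}. (inverse (Q (y i) z0) * (v \<bullet> Mf (y i) (\<theta>, P)))\<^sup>2 = 0"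
      by (subst (asm) sum_nonneg_eq_0_iff) auto
    then have "v \<bullet> Mf (y i) (\<theta>, P) = 0" if "i < n" for i
      using bspec[OF \<open>\<forall>i\<in>{..<n}. _ i = 0\<close>, of i] that Qpos[of i] by simp
    then show "v = 0" by (rule span)
  qed
  \<comment> \<open>Near \<theta> the multiplier \<open>X t\<close> solves the sample equation, so
    the empirical likelihood has its closed form.\<close>
  define k where "k t = (1 - a) * (\<Sum>i<n. lf t (y i)) - a * (\<Sum>i<n. ln (real n) + ln (Q (y i) (\<iota> (X t, t))))" for t
  have near: "\<forall>\<^sub>F t in nhds \<theta>. hybrid_loglik a f m mu n y t P = ereal (k t)"
    using X(3)
  proof eventually_elim
    case (elim t)
    have b: "(t, X t, P) \<in> ball \<alpha>0 r" using elim by (simp add: \<iota>_def)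
    have Q: "Q (y i) (t, X t, P) = 1 + X t \<bullet> m (y i) (mu t P) P" for i by (simp add: Q_def Mf_def)
    have Qp: "0 < Q (y i) (t, X t, P)" for i by (rule Q_pos[OF y b])
    have Qn: "Q (y i) (t, X t, P) \<noteq> 0" for i using Qp[of i] by simp
    have "emp_lik m n y (mu t P) P = (\<Prod>i<n. 1 / (real n * Q (y i) (t, X t, P)))"
      unfolding Q
    proof (rule emp_lik_eq[OF n])
      show "0 < 1 + X t \<bullet> m (y i) (mu t P) P" for i using Qp[of i] Q by simp
      show "(\<Sum>i<n. inverse (1 + X t \<bullet> m (y i) (mu t P) P) *\<^sub>R m (y i) (mu t P) P) = 0"
        using elim by (simp add: S2_def \<iota>_def Q Mf_def)
    qed
    moreover have "0 < (\<Prod>i<n. 1 / (real n * Q (y i) (t, X t, P)))" using n Qp by (intro prod_pos) simp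
    moreover have "ln (\<Prod>i<n. 1 / (real n * Q (y i) (t, X t, P))) = - (\<Sum>i<n. ln (real n) + ln (Q (y i) (t, X t, P)))"
    proof -
      have "ln (\<Prod>i<n. 1 / (real n * Q (y i) (t, X t, P))) = (\<Sum>i<n. ln (1 / (real n * Q (y i) (t, X t, P))))"
        by (rule ln_prod) (use n Qp Qn in auto)
      also have "\<dots> = (\<Sum>i<n. - (ln (real n) + ln (Q (y i) (t, X t, P))))"
        by (rule sum.cong[OF refl]) (use n Qp in \<open>simp add: ln_div ln_mult Qn\<close>)
      finally show ?thesis by (simp only: sum_negf)
    qed
    ultimately have e1: "elog (emp_lik m n y (mu t P) P) = ereal (- (\<Sum>i<n. ln (real n) + ln (Q (y i) (t, X t, P))))"
      by (simp add: elog_def)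
    have "elog (f t (y i)) = ereal (lf t (y i))" for i
      using f_pos[OF y, of t i] ball_proj(2)[OF b] by (simp add: elog_def)
    then have "(\<Sum>i<n. elog (f t (y i))) = (\<Sum>i<n. ereal (lf t (y i)))" by (intro sum.cong refl)
    then have e2: "(\<Sum>i<n. elog (f t (y i))) = ereal (\<Sum>i<n. lf t (y i))" unfolding sum_ereal .
    show ?case unfolding hybrid_loglik_def e1 e2 by (simp add: k_def \<iota>_def)
  qed
  have "((\<lambda>t. (X t, t)) has_derivative (\<lambda>u. (X' u, u))) (at \<theta>)"
    by (intro has_derivative_Pair X(1) has_derivative_ident)
  from has_derivative_compose[OF this, of "\<lambda>q. Q (y _) (\<iota> q)" "dQ _"]
  have Qder': "((\<lambda>t. Q (y i) (\<iota> (X t, t))) has_derivative (\<lambda>u. dQ i (X' u, u))) (at \<theta>)" for i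
    using Qder[of i] by (simp add: X(2))
  have "((\<lambda>t. ln (Q (y i) (\<iota> (X t, t)))) has_derivative (\<lambda>u. dQ i (X' u, u) / Q (y i) z0)) (at \<theta>)" for i
    using has_derivative_ln[OF _ Qder'[of i]] Qpos[of i] by (simp add: X(2) \<iota>0 z0_def divide_inverse mult.commute)
  then have lnder: "((\<lambda>t. ln (real n) + ln (Q (y i) (\<iota> (X t, t)))) has_derivative (\<lambda>u. dQ i (X' u, u) / Q (y i) z0)) (at \<theta>)" for i
    using has_derivative_add[OF has_derivative_const] by fastforce
  have "(k has_derivative (\<lambda>u. (1 - a) * (\<Sum>i<n. u \<bullet> score f (y i) \<theta>) - a * (\<Sum>i<n. dQ i (X' u, u) / Q (y i) z0))) (at \<theta>)"
    unfolding k_def[abs_def]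
    by (intro has_derivative_diff has_derivative_mult_right has_derivative_sum lnder score_der y) (use p(2) in simp)
  moreover have "(1 - a) * (\<Sum>i<n. u \<bullet> score f (y i) \<theta>) - a * (\<Sum>i<n. dQ i (X' u, u) / Q (y i) z0) = 0" for u
  proof -
    \<comment> \<open>The gradient splits into the sum of \<open>S1\<close> and a term in which
      \<open>X'\<close> is paired with the sum of \<open>S2\<close>; both sums are zero.\<close>
    have "(1 - a) * (\<Sum>i<n. u \<bullet> score f (y i) \<theta>) - a * (\<Sum>i<n. dQ i (X' u, u) / Q (y i) z0)
       = (\<Sum>i<n. u \<bullet> S1 (y i) z0 - a * (X' u \<bullet> S2 (y i) z0))"
      unfolding sum_distrib_left sum_subtractf[symmetric]
      by (rule sum.cong[OF refl])
         (simp add: S1_def S2_def z0_def dQ_def dM_def inner_diff_right grad\<theta>_inner divide_inverse algebra_simps)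
    also have "\<dots> = u \<bullet> (\<Sum>i<n. S1 (y i) z0) - a * (X' u \<bullet> (\<Sum>i<n. S2 (y i) z0))"
      by (simp add: sum_subtractf inner_sum_right sum_distrib_left)
    finally show ?thesis using S1 S2 by (simp add: z0_def)
  qed
  ultimately have "(k has_derivative (\<lambda>u. 0)) (at \<theta>)" by simp
  then have "((\<lambda>t. real_of_ereal (hybrid_loglik a f m mu n y t P)) has_derivative (\<lambda>u. 0)) (at \<theta>)"
    by (rule has_derivative_eventually_cong) (use near in eventually_elim, simp)
  moreover have "\<forall>\<^sub>F t in nhds \<theta>. \<bar>hybrid_loglik a f m mu n y t P\<bar> \<noteq> \<infinity>"
    using near by eventually_elim simp
  ultimately show ?thesis by (simp add: has_egrad_def gderiv_def)
qed

section \<open>Zeros of the sample mean of the estimating function\<close>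

definition Gn :: "nat \<Rightarrow> (nat \<Rightarrow> 'y) \<Rightarrow> 'p \<times> 'q \<times> 'r \<Rightarrow> 'p \<times> 'q \<times> 'r" where
  "Gn n y z = (\<Sum>i<n. G (y i) z) /\<^sub>R n"

text \<open>If all \<open>v \<bullet> M\<^sub>i\<close> vanish, then the second component is constant along the direction
  \<open>v\<close> of the multiplier, which contradicts the linearization.\<close>

lemma sample_span:
  assumes c: "c > 0" "\<And>v. c * norm v \<le> norm (fst (snd (D (0, v, 0))))" and \<epsilon>: "0 < \<epsilon>" "4 * \<epsilon> < c"
    and \<delta>: "0 < \<delta>" "\<delta> < r" and y: "\<And>i. y i \<in> \<Omega>"
    and lin: "\<And>z. z \<in> cball \<alpha>0 \<delta> \<Longrightarrow> norm (Gn n y z - Gn n y \<alpha>0 - D (z - \<alpha>0)) \<le> \<epsilon> * norm (z - \<alpha>0)"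
    and z: "z \<in> cball \<alpha>0 (\<delta> / 2)"
    and orth: "\<And>i. i < n \<Longrightarrow> v \<bullet> Mf (y i) (fst z, snd (snd z)) = 0"
  shows "v = 0"
proof (rule ccontr)
  assume v: "v \<noteq> 0"
  interpret D: bounded_linear D by (rule D_bl)
  \<comment> \<open>Scaled to length \<delta>/2, so that \<open>z + w\<close> still lies in the
    \<delta>-ball.\<close>
  define w where "w = (0::'p, (\<delta> / (2 * norm v)) *\<^sub>R v, 0::'r)"
  have nw: "norm w = \<delta> / 2" using v \<delta> by (simp add: w_def norm_Pair)
  have zn: "norm (z - \<alpha>0) \<le> \<delta> / 2" using z by (simp add: dist_norm norm_minus_commute)
  have z'n: "norm (z + w - \<alpha>0) \<le> \<delta>" using norm_triangle_ineq[of "z - \<alpha>0" w] zn nw by (simp add: algebra_simps)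
  have "Q (y i) (z + w) = Q (y i) z" if "i < n" for i
    using orth[OF that] by (simp add: Q_def w_def inner_add_left)
  then have "S2 (y i) (z + w) = S2 (y i) z" if "i < n" for i
    using that by (simp add: S2_def) (simp add: w_def)
  then have eq: "fst (snd (Gn n y (z + w))) = fst (snd (Gn n y z))"
    by (simp add: Gn_def G_eq[OF y] S_def fst_sum snd_sum)
  let ?R = "\<lambda>z. Gn n y z - Gn n y \<alpha>0 - D (z - \<alpha>0)"
  have "D (z + w - \<alpha>0) - D (z - \<alpha>0) = D w"
    unfolding D.diff[symmetric] by simp
  then have "fst (snd (D w)) = fst (snd (?R z)) - fst (snd (?R (z + w)))"
    using eq by (simp flip: \<open>D (z + w - \<alpha>0) - D (z - \<alpha>0) = D w\<close>)
  then have "norm (fst (snd (D w))) \<le> norm (fst (snd (?R z))) + norm (fst (snd (?R (z + w))))"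
    by (simp only: norm_triangle_ineq4)
  also have "\<dots> \<le> norm (?R z) + norm (?R (z + w))"
    using proj_norm_le(3)[of "?R z" 0] proj_norm_le(3)[of "?R (z + w)" 0] by simp
  also have "\<dots> \<le> \<epsilon> * norm (z - \<alpha>0) + \<epsilon> * norm (z + w - \<alpha>0)"
    using zn z'n \<delta> by (intro add_mono lin) (auto simp: dist_norm norm_minus_commute)
  also have "\<dots> \<le> \<epsilon> * (\<delta> / 2) + \<epsilon> * \<delta>" using zn z'n \<epsilon> by (intro add_mono mult_left_mono) auto
  \<comment> \<open>The two remainders add up to at most (3/2) \<epsilon> \<delta>, and 4 \<epsilon>
    < c.\<close>
  also have "\<dots> < c * (\<delta> / 2)" using \<epsilon> \<delta> by (simp add: algebra_simps)
  also have "c * (\<delta> / 2) \<le> norm (fst (snd (D w)))"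
    using c(2)[of "(\<delta> / (2 * norm v)) *\<^sub>R v"] v \<delta> by (simp add: w_def)
  finally show False by simp
qed

definition pr :: "'p \<times> 'q \<times> 'r \<Rightarrow> 'p \<times> 'q" where "pr u = (fst u, fst (snd u))"
text \<open>The block of \<open>D\<close> for the first two equations and the first two unknowns,
  with P held fixed.\<close>

definition A :: "'p \<times> 'q \<Rightarrow> 'p \<times> 'q" where "A x = pr (D (fst x, snd x, 0))"

lemma pr_bl: "bounded_linear pr" unfolding pr_def by (intro bounded_linear_intros)

lemma norm_pr_le: "norm (pr u) \<le> norm u"
proof -
  obtain x v p where "u = (x, v, p)" by (metis prod.exhaust)
  then show ?thesis by (auto simp: pr_def norm_Pair intro!: real_sqrt_le_mono)
qed

lemma A_bl: "bounded_linear A" unfolding A_def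
  by (intro bounded_linear_compose[OF pr_bl] bounded_linear_compose[OF D_bl] bounded_linear_intros)

lemma A_inverse:
  obtains A' BA where "bounded_linear A'" "\<And>x. A' (A x) = x" "\<And>x. A (A' x) = x" "BA > 0" "\<And>x. norm (A' x) \<le> BA * norm x"
proof -
  have "v = 0" if "A v = 0" for v
    using that D_injective[of "fst v" "snd v"] by (simp add: A_def pr_def zero_prod_def prod_eq_iff)
  from injective_linear_inverse[OF A_bl this] show ?thesis using that by metis
qed

text \<open>\<open>B\<close> and \<open>\<epsilon>0\<close> are chosen before the sample size, the
  data and P, so the lemma can be used on events of high probability. The slack \<open>e\<close>
  keeps the radius positive even if \<open>Gn n y \<alpha>0\<close> is zero and P = P0.\<close>

lemma sample_roots:
  obtains B \<epsilon>0 where "B > 0" "\<epsilon>0 > 0"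
    "\<And>\<epsilon> \<delta> n y P e. 0 < \<epsilon> \<Longrightarrow> \<epsilon> \<le> \<epsilon>0 \<Longrightarrow> 0 < \<delta> \<Longrightarrow> \<delta> < r \<Longrightarrow> 0 < n \<Longrightarrow> (\<And>i. y i \<in> \<Omega>) \<Longrightarrow>
       (\<And>z. z \<in> cball \<alpha>0 \<delta> \<Longrightarrow> norm (Gn n y z - Gn n y \<alpha>0 - D (z - \<alpha>0)) \<le> \<epsilon> * norm (z - \<alpha>0)) \<Longrightarrow>
       0 < e \<Longrightarrow> B * (norm (Gn n y \<alpha>0) + norm (P - P0) + e) \<le> \<delta> \<Longrightarrow>
       \<exists>\<theta> l. norm ((\<theta>, l, P) - \<alpha>0) \<le> B * (norm (Gn n y \<alpha>0) + norm (P - P0) + e) \<and>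
         fst (Gn n y (\<theta>, l, P)) = 0 \<and> fst (snd (Gn n y (\<theta>, l, P))) = 0 \<and>
         \<theta> \<in> interior \<Theta> \<and> has_egrad (\<lambda>t. hybrid_loglik a f m mu n y t P) 0 \<theta>"
proof -
  interpret D: bounded_linear D by (rule D_bl)
  interpret pr: bounded_linear pr by (rule pr_bl)
  obtain A' BA where A': "bounded_linear A'" "\<And>x. A' (A x) = x" "\<And>x. A (A' x) = x" "BA > 0" "\<And>x. norm (A' x) \<le> BA * norm x"
    using A_inverse by metis
  define N where "N v = fst (snd (D (0, v, 0)))" for v
  have N: "bounded_linear N" unfolding N_def
    by (intro bounded_linear_fst_comp bounded_linear_snd_comp bounded_linear_compose[OF D_bl] bounded_linear_intros)
  obtain N' BN where N': "\<And>x. N' (N x) = x" "BN > 0" "\<And>x. norm (N' x) \<le> BN * norm x"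
    using injective_linear_inverse[OF N] D_multiplier_block unfolding N_def by metis
  have c: "1 / BN * norm v \<le> norm (fst (snd (D (0, v, 0))))" for v
    using N'(1)[of v] N'(3)[of "N v"] N'(2) by (simp add: N_def field_simps)
  obtain BD where BD: "BD > 0" "\<And>x. norm (D x) \<le> norm x * BD" using D.pos_bounded by blast
  \<comment> \<open>In turn: the displacement of P enters the remainder with factor at most 1, the
    slope condition of \<open>brouwer_root\<close>, and the condition of \<open>sample_span\<close>
    with c = 1/BN.\<close>
  define \<epsilon>0 where "\<epsilon>0 = min 1 (min (1 / (2 * BA)) (1 / (8 * BN)))"
  have \<epsilon>0: "\<epsilon>0 > 0" using A'(4) N'(2) by (simp add: \<epsilon>0_def)
  \<comment> \<open>The outer factor 2 places the zero in the ball of radius \<delta>/2, as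
    \<open>sample_span\<close> requires.\<close>
  define B where "B = 2 * (2 * BA * (BD + 1) + 2 * BA + 1)"
  have B: "B > 0" unfolding B_def using A'(4) BD(1) by (simp add: add_pos_nonneg)
  show ?thesis
  proof (rule that[OF B \<epsilon>0])
    fix \<epsilon> \<delta> e :: real and n y P
    assume \<epsilon>: "0 < \<epsilon>" "\<epsilon> \<le> \<epsilon>0" and \<delta>: "0 < \<delta>" "\<delta> < r" and n: "0 < n" and y: "\<And>i. y i \<in> \<Omega>"
      and lin: "\<And>z. z \<in> cball \<alpha>0 \<delta> \<Longrightarrow> norm (Gn n y z - Gn n y \<alpha>0 - D (z - \<alpha>0)) \<le> \<epsilon> * norm (z - \<alpha>0)"
      and e: "0 < e" and small: "B * (norm (Gn n y \<alpha>0) + norm (P - P0) + e) \<le> \<delta>"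
    let ?g = "norm (Gn n y \<alpha>0)" and ?p = "norm (P - P0)"
    have \<epsilon>s: "\<epsilon> \<le> 1" "\<epsilon> \<le> 1 / (2 * BA)" "\<epsilon> \<le> 1 / (8 * BN)" using \<epsilon> by (auto simp: \<epsilon>0_def)
    \<comment> \<open>Bounds the part that does not depend on \<open>x\<close>: the noise at
      \<alpha>0, the displacement of P through \<open>D\<close> and through the remainder (hence BD
      + 1), and the slack.\<close>
    define \<eta> where "\<eta> = ?g + (BD + 1) * ?p + e"
    have \<eta>: "\<eta> > 0" unfolding \<eta>_def using e BD(1) by (intro add_nonneg_pos) auto
    have \<eta>le: "2 * BA * \<eta> + ?p \<le> B / 2 * (?g + ?p + e)"
    proof -
      have "0 \<le> BA * BD * ?g + BA * BD * e + ?g + e + BA * ?p"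
        using A'(4) BD(1) e by (intro add_nonneg_nonneg mult_nonneg_nonneg) auto
      moreover have "0 \<le> 2 * BA * ?g + 2 * BA * e" using A'(4) e by simp
      ultimately show ?thesis unfolding \<eta>_def B_def using A'(4) BD(1) e
        by (simp add: algebra_simps)
    qed
    have half: "2 * BA * \<eta> + ?p \<le> \<delta> / 2" using \<eta>le small by simp
    define x0 where "x0 = (\<theta>0, l0)"
    \<comment> \<open>Room left in the ball of radius \<delta>/2 once P has been moved.\<close>
    define \<rho> where "\<rho> = \<delta> / 2 - ?p"
    define Z where "Z x = (fst x, snd x, P)" for x :: "'p \<times> 'q"
    have Zn: "norm (Z x - \<alpha>0) \<le> norm (x - x0) + ?p" for x
    proof -
      have "Z x - \<alpha>0 = (fst (x - x0), snd (x - x0), 0) + (0, 0, P - P0)"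
        by (simp add: Z_def \<alpha>0_def x0_def)
      then have "norm (Z x - \<alpha>0) \<le> norm (fst (x - x0), snd (x - x0), 0::'r) + norm (0::'p, 0::'q, P - P0)"
        by (metis norm_triangle_ineq)
      also have "norm (fst (x - x0), snd (x - x0), 0::'r) = norm (x - x0)"
        by (simp add: norm_Pair norm_prod_def)
      finally show ?thesis by (simp add: norm_Pair)
    qed
    have Zb: "Z x \<in> cball \<alpha>0 (\<delta> / 2)" if "x \<in> cball x0 \<rho>" for x
      using Zn[of x] that by (simp add: dist_norm norm_minus_commute \<rho>_def)
    have "\<exists>x\<in>cball x0 (2 * BA * \<eta>). pr (Gn n y (Z x)) = 0"
    proof (rule brouwer_root[OF A_bl A'(1-5) \<eta>])
      show "2 * BA * \<eta> \<le> \<rho>" using half by (simp add: \<rho>_def)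
      have c1: "continuous_on (ball \<alpha>0 r) (Gn n y)"
        unfolding Gn_def[abs_def] G_eq[OF y] by (intro continuous_intros S_cont y)
      have c2: "Z ` cball x0 \<rho> \<subseteq> ball \<alpha>0 r" using Zb \<delta> by fastforce
      have c3: "continuous_on (cball x0 \<rho>) Z" unfolding Z_def by (intro continuous_intros)
      show "continuous_on (cball x0 \<rho>) (\<lambda>x. pr (Gn n y (Z x)))"
        by (rule pr.continuous_on[OF continuous_on_compose2[OF c1 c3 c2]])
      fix x assume x: "x \<in> cball x0 \<rho>"
      have split: "D (Z x - \<alpha>0) = D (fst (x - x0), snd (x - x0), 0) + D (0, 0, P - P0)"
        unfolding D.add[symmetric] by (simp add: Z_def \<alpha>0_def x0_def)
      define R where "R = Gn n y (Z x) - Gn n y \<alpha>0 - D (Z x - \<alpha>0)"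
      define d where "d = D (0, 0, P - P0)"
      have "pr (Gn n y (Z x)) - A (x - x0) = pr (R + Gn n y \<alpha>0 + d)"
        unfolding A_def R_def d_def split pr.add pr.diff by simp
      then have "norm (pr (Gn n y (Z x)) - A (x - x0)) \<le> norm (R + Gn n y \<alpha>0 + d)"
        by (simp only: norm_pr_le)
      also have "\<dots> \<le> norm R + ?g + norm d"
        using norm_triangle_ineq[of "R + Gn n y \<alpha>0" d] norm_triangle_ineq[of R "Gn n y \<alpha>0"] by linarith
      also have "\<dots> \<le> \<epsilon> * norm (Z x - \<alpha>0) + ?g + BD * ?p"
      proof (intro add_mono order_refl)
        show "norm R \<le> \<epsilon> * norm (Z x - \<alpha>0)" unfolding R_def using Zb[OF x] \<delta> by (intro lin) simp
        show "norm d \<le> BD * ?p" unfolding d_def using BD(2)[of "(0, 0, P - P0)"] by (simp add: norm_Pair mult.commute)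
      qed
      also have "\<dots> \<le> \<epsilon> * (norm (x - x0) + ?p) + ?g + BD * ?p"
        using Zn[of x] \<epsilon> by simp
      also have "\<dots> = \<epsilon> * norm (x - x0) + \<epsilon> * ?p + ?g + BD * ?p" by (simp add: algebra_simps)
      also have "\<dots> \<le> 1 / (2 * BA) * norm (x - x0) + 1 * ?p + ?g + BD * ?p"
        using \<epsilon>s by (intro add_mono mult_right_mono order_refl) auto
      also have "\<dots> \<le> norm (x - x0) / (2 * BA) + \<eta>" using e by (simp add: \<eta>_def algebra_simps)
      finally show "norm (pr (Gn n y (Z x)) - A (x - x0)) \<le> norm (x - x0) / (2 * BA) + \<eta>" .
    qed
    then obtain x where x: "x \<in> cball x0 (2 * BA * \<eta>)" "pr (Gn n y (Z x)) = 0" by blast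
    have x\<rho>: "x \<in> cball x0 \<rho>" using x(1) half by (simp add: \<rho>_def)
    have zb2: "Z x \<in> cball \<alpha>0 (\<delta> / 2)" by (rule Zb[OF x\<rho>])
    then have zb: "Z x \<in> ball \<alpha>0 r" using \<delta> by simp
    obtain \<theta> l where xl: "x = (\<theta>, l)" by (cases x)
    then have zx: "Z x = (\<theta>, l, P)" by (simp add: Z_def)
    have g: "fst (Gn n y (\<theta>, l, P)) = 0" "fst (snd (Gn n y (\<theta>, l, P))) = 0"
      using x(2) by (simp_all add: zx pr_def zero_prod_def)
    have s1: "(\<Sum>i<n. S1 (y i) (\<theta>, l, P)) = 0" "(\<Sum>i<n. S2 (y i) (\<theta>, l, P)) = 0"
      using g n by (simp_all add: Gn_def G_eq[OF y] S_def fst_sum snd_sum)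
    have "norm (Z x - \<alpha>0) \<le> 2 * BA * \<eta> + ?p"
      using Zn[of x] x(1) by (simp add: dist_norm norm_minus_commute)
    also have "\<dots> \<le> B / 2 * (?g + ?p + e)" by (rule \<eta>le)
    also have "\<dots> \<le> B * (?g + ?p + e)" using B e by (intro mult_right_mono) auto
    finally have nz: "norm ((\<theta>, l, P) - \<alpha>0) \<le> B * (?g + ?p + e)" by (simp add: zx)
    have "has_egrad (\<lambda>t. hybrid_loglik a f m mu n y t P) 0 \<theta>"
    proof (rule sample_critical_point[OF n y _ s1])
      show "(\<theta>, l, P) \<in> ball \<alpha>0 r" using zb zx by simp
      fix v assume "\<And>i. i < n \<Longrightarrow> v \<bullet> Mf (y i) (\<theta>, P) = 0"
      then show "v = 0"
        by (intro sample_span[OF _ c \<epsilon>(1) _ \<delta> y lin zb2, of v]) (use N'(2) \<epsilon>s(3) \<epsilon>(1) in \<open>auto simp: zx field_simps\<close>)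
    qed
    moreover have "\<theta> \<in> interior \<Theta>" using ball_proj(5)[OF zb] by (simp add: zx)
    ultimately show "\<exists>\<theta> l. norm ((\<theta>, l, P) - \<alpha>0) \<le> B * (?g + ?p + e) \<and>
         fst (Gn n y (\<theta>, l, P)) = 0 \<and> fst (snd (Gn n y (\<theta>, l, P))) = 0 \<and>
         \<theta> \<in> interior \<Theta> \<and> has_egrad (\<lambda>t. hybrid_loglik a f m mu n y t P) 0 \<theta>"
      using nz g by blast
  qed
qed

section \<open>Deterministic expansion of the two zeros\<close>

definition hbar :: "nat \<Rightarrow> (nat \<Rightarrow> 'y) \<Rightarrow> 'r \<Rightarrow> 'r" where
  "hbar n y P = (\<Sum>i<n. h (y i) P) /\<^sub>R n"

definition linearized :: "real \<Rightarrow> real \<Rightarrow> nat \<Rightarrow> (nat \<Rightarrow> 'y) \<Rightarrow> bool" where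
  "linearized \<epsilon> \<delta> n y \<longleftrightarrow> (\<forall>i. y i \<in> \<Omega>) \<and>
     (\<forall>z \<in> cball \<alpha>0 \<delta>. norm (Gn n y z - Gn n y \<alpha>0 - D (z - \<alpha>0)) \<le> \<epsilon> * norm (z - \<alpha>0))"

definition critical :: "nat \<Rightarrow> (nat \<Rightarrow> 'y) \<Rightarrow> 'r \<Rightarrow> 'p \<Rightarrow> bool" where
  "critical n y P \<theta> \<longleftrightarrow> \<theta> \<in> interior \<Theta> \<and> has_egrad (\<lambda>t. hybrid_loglik a f m mu n y t P) 0 \<theta>"

text \<open>The third equation bounds the displacement of P by \<open>Gn n y \<alpha>0\<close> and
  \<open>hbar n y P\<close>. The difference of the two zeros, minus the kernel direction of
  \<open>D_theta\<close>, is mapped by \<open>A\<close> to a difference of remainders.\<close>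

lemma sample_expansion:
  obtains C \<epsilon>1 T' where "C > 0" "\<epsilon>1 > 0" "(theta has_derivative T') (at P0)"
    "\<And>\<epsilon> \<delta> n y P e. 0 < \<epsilon> \<Longrightarrow> \<epsilon> \<le> \<epsilon>1 \<Longrightarrow> 0 < \<delta> \<Longrightarrow> \<delta> < r \<Longrightarrow> 0 < n \<Longrightarrow> linearized \<epsilon> \<delta> n y \<Longrightarrow>
       0 < e \<Longrightarrow> norm (P - P0) \<le> \<delta> \<Longrightarrow> C * (norm (Gn n y \<alpha>0) + norm (hbar n y P) + e) \<le> \<delta> \<Longrightarrow>
       \<exists>\<theta> \<theta>'. critical n y P \<theta> \<and> critical n y P0 \<theta>' \<and>
         norm (\<theta> - \<theta>0) \<le> C * (norm (Gn n y \<alpha>0) + norm (hbar n y P) + e) \<and>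
         norm (\<theta> - \<theta>' - T' (P - P0)) \<le> C * \<epsilon> * (norm (Gn n y \<alpha>0) + norm (hbar n y P) + e)"
proof -
  interpret D: bounded_linear D by (rule D_bl)
  interpret pr: bounded_linear pr by (rule pr_bl)
  obtain B \<epsilon>0 where B: "B > 0" "\<epsilon>0 > 0"
    and roots: "\<And>\<epsilon> \<delta> n y P e. 0 < \<epsilon> \<Longrightarrow> \<epsilon> \<le> \<epsilon>0 \<Longrightarrow> 0 < \<delta> \<Longrightarrow> \<delta> < r \<Longrightarrow> 0 < n \<Longrightarrow> (\<And>i. y i \<in> \<Omega>) \<Longrightarrow>
       (\<And>z. z \<in> cball \<alpha>0 \<delta> \<Longrightarrow> norm (Gn n y z - Gn n y \<alpha>0 - D (z - \<alpha>0)) \<le> \<epsilon> * norm (z - \<alpha>0)) \<Longrightarrow>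
       0 < e \<Longrightarrow> B * (norm (Gn n y \<alpha>0) + norm (P - P0) + e) \<le> \<delta> \<Longrightarrow>
       \<exists>\<theta> l. norm ((\<theta>, l, P) - \<alpha>0) \<le> B * (norm (Gn n y \<alpha>0) + norm (P - P0) + e) \<and>
         fst (Gn n y (\<theta>, l, P)) = 0 \<and> fst (snd (Gn n y (\<theta>, l, P))) = 0 \<and>
         \<theta> \<in> interior \<Theta> \<and> has_egrad (\<lambda>t. hybrid_loglik a f m mu n y t P) 0 \<theta>"
    using sample_roots by metis
  obtain T' N' where T': "(theta has_derivative T') (at P0)" "bounded_linear N'"
    "\<And>v. fst (D (T' v, N' v, v)) = 0" "\<And>v. fst (snd (D (T' v, N' v, v))) = 0"
    using D_theta by metis
  obtain H where H: "bounded_linear H" "\<And>u. H u = 0 \<Longrightarrow> u = 0" "\<And>x v u. snd (snd (D (x, v, u))) = H u"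
    using D_nuisance_block by metis
  obtain H' BH where H': "\<And>x. H' (H x) = x" "BH > 0" "\<And>x. norm (H' x) \<le> BH * norm x"
    using injective_linear_inverse[OF H(1,2)] by metis
  obtain A' BA where A': "\<And>x. A' (A x) = x" "BA > 0" "\<And>x. norm (A' x) \<le> BA * norm x"
    using A_inverse by metis
  \<comment> \<open>The bound 1/(2 BH) lets the remainder, \<epsilon> times the displacement of P,
    be absorbed on the left-hand side.\<close>
  define \<epsilon>1 where "\<epsilon>1 = min \<epsilon>0 (1 / (2 * BH))"
  have \<epsilon>1: "\<epsilon>1 > 0" using B H' by (simp add: \<epsilon>1_def)
  define C1 where "C1 = B * (1 + 2 * BH)"
  have C1: "C1 > 0" unfolding C1_def using B(1) H'(2) by (intro mult_pos_pos) auto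
  \<comment> \<open>\<open>C1\<close> serves the distance of the zeros from \<alpha>0;
    \<open>2 * BA * C1\<close> serves the error of the expansion, from two remainders and the
    inverse of \<open>A\<close>.\<close>
  define C where "C = C1 + 2 * BA * C1"
  have C: "C > 0" "C1 \<le> C" "2 * BA * C1 \<le> C" using C1 A'(2) by (simp_all add: C_def add_pos_pos)
  have BC1: "B \<le> C1" unfolding C1_def using B(1) H'(2) by simp
  show ?thesis
  proof (rule that[OF C(1) \<epsilon>1 T'(1)])
    fix \<epsilon> \<delta> e :: real and n y P
    let ?g = "norm (Gn n y \<alpha>0)" and ?\<Delta> = "P - P0"
    define \<tau> where "\<tau> = ?g + norm (hbar n y P) + e"
    assume \<epsilon>: "0 < \<epsilon>" "\<epsilon> \<le> \<epsilon>1" and \<delta>: "0 < \<delta>" "\<delta> < r" and n: "0 < n" and lin: "linearized \<epsilon> \<delta> n y"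
      and e: "0 < e" and P: "norm ?\<Delta> \<le> \<delta>" and "C * (?g + norm (hbar n y P) + e) \<le> \<delta>"
    then have small: "C * \<tau> \<le> \<delta>" by (simp add: \<tau>_def)
    have y: "y i \<in> \<Omega>" for i using lin by (simp add: linearized_def)
    define R where "R z = Gn n y z - Gn n y \<alpha>0 - D (z - \<alpha>0)" for z
    have R: "norm (R z) \<le> \<epsilon> * norm (z - \<alpha>0)" if "norm (z - \<alpha>0) \<le> \<delta>" for z
      using lin that by (simp add: linearized_def R_def dist_norm norm_minus_commute)
    have \<tau>: "0 < \<tau>" using e by (simp add: \<tau>_def add_nonneg_pos)
    have G3: "snd (snd (Gn n y z)) = hbar n y (snd (snd z))" for z
      by (simp add: Gn_def G_eq[OF y] S_def hbar_def snd_sum)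
    have Pbound: "norm ?\<Delta> \<le> 2 * BH * \<tau>"
    proof -
      \<comment> \<open>Only P is moved, so the third component reads
        \<open>hbar n y P - hbar n y P0 = H (P - P0)\<close> up to the remainder.\<close>
      let ?z = "(\<theta>0, l0, P)"
      have zd: "?z - \<alpha>0 = (0, 0, ?\<Delta>)" by (simp add: \<alpha>0_def)
      then have nz: "norm (?z - \<alpha>0) = norm ?\<Delta>" by (simp add: norm_Pair)
      have "snd (snd (R ?z)) = hbar n y P - snd (snd (Gn n y \<alpha>0)) - H ?\<Delta>"
        unfolding R_def zd by (simp add: G3 H(3))
      then have "H ?\<Delta> = hbar n y P - snd (snd (Gn n y \<alpha>0)) - snd (snd (R ?z))" by simp
      then have "norm (H ?\<Delta>) \<le> norm (hbar n y P) + norm (snd (snd (Gn n y \<alpha>0))) + norm (snd (snd (R ?z)))"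
        using norm_triangle_ineq4[of "hbar n y P - snd (snd (Gn n y \<alpha>0))" "snd (snd (R ?z))"]
          norm_triangle_ineq4[of "hbar n y P" "snd (snd (Gn n y \<alpha>0))"] by simp
      also have "\<dots> \<le> norm (hbar n y P) + ?g + norm (R ?z)"
        using proj_norm_le(4)[of "Gn n y \<alpha>0" 0] proj_norm_le(4)[of "R ?z" 0] by simp
      also have "\<dots> \<le> \<tau> + \<epsilon> * norm ?\<Delta>" using R[of ?z] P e unfolding nz by (simp add: \<tau>_def)
      finally have "norm (H ?\<Delta>) \<le> \<tau> + \<epsilon> * norm ?\<Delta>" .
      then have "BH * norm (H ?\<Delta>) \<le> BH * (\<tau> + \<epsilon> * norm ?\<Delta>)" using H'(2) by (intro mult_left_mono) auto
      moreover have "norm ?\<Delta> \<le> BH * norm (H ?\<Delta>)" using H'(3)[of "H ?\<Delta>"] by (simp only: H'(1))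
      moreover have "(BH * \<epsilon>) * norm ?\<Delta> \<le> 1 / 2 * norm ?\<Delta>"
      proof (rule mult_right_mono)
        have "BH * \<epsilon> \<le> BH * (1 / (2 * BH))" using \<epsilon>(2) H'(2) by (intro mult_left_mono) (auto simp: \<epsilon>1_def)
        then show "BH * \<epsilon> \<le> 1 / 2" using H'(2) by simp
      qed simp
      ultimately show ?thesis by (simp add: algebra_simps)
    qed
    have b1: "B * (?g + norm ?\<Delta> + e) \<le> C1 * \<tau>"
    proof -
      have "?g + e \<le> \<tau>" by (simp add: \<tau>_def)
      then have "?g + norm ?\<Delta> + e \<le> \<tau> + 2 * BH * \<tau>" using Pbound by linarith
      then have "B * (?g + norm ?\<Delta> + e) \<le> B * (\<tau> + 2 * BH * \<tau>)" using B(1) by (intro mult_left_mono) auto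
      then show ?thesis by (simp add: C1_def algebra_simps)
    qed
    have b2: "B * (?g + norm (P0 - P0) + e) \<le> C1 * \<tau>"
    proof -
      have "B * (?g + norm (P0 - P0) + e) \<le> C1 * (?g + norm (P0 - P0) + e)"
        using BC1 e by (intro mult_right_mono) auto
      also have "\<dots> \<le> C1 * \<tau>" using C1 by (simp add: \<tau>_def)
      finally show ?thesis .
    qed
    have c1: "C1 * \<tau> \<le> C * \<tau>" using C(2) \<tau> by simp
    then have c1\<delta>: "C1 * \<tau> \<le> \<delta>" using small by linarith
    have \<epsilon>0: "\<epsilon> \<le> \<epsilon>0" using \<epsilon>(2) by (simp add: \<epsilon>1_def)
    have lin': "norm (Gn n y z - Gn n y \<alpha>0 - D (z - \<alpha>0)) \<le> \<epsilon> * norm (z - \<alpha>0)" if "z \<in> cball \<alpha>0 \<delta>" for z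
      using lin that by (simp add: linearized_def)
    obtain \<theta> l where t: "norm ((\<theta>, l, P) - \<alpha>0) \<le> C1 * \<tau>" "fst (Gn n y (\<theta>, l, P)) = 0"
      "fst (snd (Gn n y (\<theta>, l, P))) = 0" "critical n y P \<theta>"
      using roots[OF \<epsilon>(1) \<epsilon>0 \<delta> n y lin' e order_trans[OF b1 c1\<delta>]] b1 unfolding critical_def
      by (meson order_trans)
    obtain \<theta>' l' where t': "norm ((\<theta>', l', P0) - \<alpha>0) \<le> C1 * \<tau>" "fst (Gn n y (\<theta>', l', P0)) = 0"
      "fst (snd (Gn n y (\<theta>', l', P0))) = 0" "critical n y P0 \<theta>'"
      using roots[OF \<epsilon>(1) \<epsilon>0 \<delta> n y lin' e order_trans[OF b2 c1\<delta>]] b2 unfolding critical_def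
      by (meson order_trans)
    let ?z = "(\<theta>, l, P)" and ?z' = "(\<theta>', l', P0)"
    have "norm (\<theta> - \<theta>0) \<le> norm (?z - \<alpha>0)" using proj_norm_le(2)[of ?z \<alpha>0] by (simp add: \<alpha>0_def)
    then have cons: "norm (\<theta> - \<theta>0) \<le> C * \<tau>" using t(1) c1 by linarith
    \<comment> \<open>What is left of the difference of the zeros after removing the image of P - P0
      under the derivatives of \<theta> and of the multiplier; its P part is zero, so
      \<open>A\<close> applies.\<close>
    define x where "x = (\<theta> - \<theta>' - T' ?\<Delta>, l - l' - N' ?\<Delta>)"
    have p0: "pr (Gn n y ?z) = 0" "pr (Gn n y ?z') = 0"
      using t t' by (simp_all add: pr_def zero_prod_def)
    have "A x = pr (D (?z - ?z' - (T' ?\<Delta>, N' ?\<Delta>, ?\<Delta>)))" by (simp add: A_def x_def)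
    also have "?z - ?z' = (?z - \<alpha>0) - (?z' - \<alpha>0)" by simp
    also have "pr (D (?z - \<alpha>0 - (?z' - \<alpha>0) - (T' ?\<Delta>, N' ?\<Delta>, ?\<Delta>))) = pr (D (?z - \<alpha>0)) - pr (D (?z' - \<alpha>0))"
    proof -
      have "pr (D (T' ?\<Delta>, N' ?\<Delta>, ?\<Delta>)) = 0" using T'(3,4) by (simp add: pr_def zero_prod_def)
      then show ?thesis by (simp only: D.diff pr.diff diff_zero)
    qed
    also have "\<dots> = pr (R ?z') - pr (R ?z)" using p0 by (simp add: R_def pr.diff)
    finally have "norm (A x) \<le> norm (pr (R ?z')) + norm (pr (R ?z))" by (simp only: norm_triangle_ineq4)
    also have "\<dots> \<le> norm (R ?z') + norm (R ?z)" by (intro add_mono norm_pr_le)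
    also have "\<dots> \<le> \<epsilon> * norm (?z' - \<alpha>0) + \<epsilon> * norm (?z - \<alpha>0)"
      using t(1) t'(1) c1\<delta> by (intro add_mono R) auto
    also have "\<dots> \<le> \<epsilon> * (C1 * \<tau>) + \<epsilon> * (C1 * \<tau>)"
      using t(1) t'(1) \<epsilon>(1) by (intro add_mono mult_left_mono) auto
    finally have Ax: "norm (A x) \<le> 2 * \<epsilon> * C1 * \<tau>" by (simp add: mult_ac)
    have "norm (fst x) \<le> norm x" using norm_fst_le[of "fst x" "snd x"] by simp
    also have "\<dots> \<le> BA * norm (A x)" using A'(3)[of "A x"] by (simp only: A'(1))
    also have "\<dots> \<le> BA * (2 * \<epsilon> * C1 * \<tau>)" using Ax A'(2) by (intro mult_left_mono) auto
    also have "\<dots> = 2 * BA * C1 * (\<epsilon> * \<tau>)" by simp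
    also have "\<dots> \<le> C * (\<epsilon> * \<tau>)" using C(3) \<epsilon>(1) \<tau> by (intro mult_right_mono) auto
    finally have "norm (\<theta> - \<theta>' - T' ?\<Delta>) \<le> C * \<epsilon> * \<tau>" by (simp add: x_def)
    with cons t(4) t'(4) show "\<exists>\<theta> \<theta>'. critical n y P \<theta> \<and> critical n y P0 \<theta>' \<and>
         norm (\<theta> - \<theta>0) \<le> C * (?g + norm (hbar n y P) + e) \<and>
         norm (\<theta> - \<theta>' - T' (P - P0)) \<le> C * \<epsilon> * (?g + norm (hbar n y P) + e)"
      unfolding \<tau>_def[symmetric] by blast
  qed
qed

section \<open>From the deterministic expansion to convergence in probability\<close>

lemma linearized_with_prob:
  assumes "\<epsilon> > 0"
  obtains \<delta> where "0 < \<delta>" "\<delta> < r" "with_prob_tending_to_one M (\<lambda>n \<omega>. linearized \<epsilon> \<delta> n (\<lambda>i. Y i \<omega>))"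
proof -
  obtain \<delta> where \<delta>: "0 < \<delta>" "\<delta> < r" and lin: "with_prob_tending_to_one M (\<lambda>n \<omega>. \<forall>z \<in> cball \<alpha>0 \<delta>.
       norm ((\<Sum>i<n. G (Y i \<omega>) z - G (Y i \<omega>) \<alpha>0) /\<^sub>R n - D (z - \<alpha>0)) \<le> \<epsilon> * norm (z - \<alpha>0))"
    using G_linearization[OF assms] .
  have "with_prob_tending_to_one M (\<lambda>n \<omega>. \<forall>i. Y i \<omega> \<in> \<Omega>)"
    by (intro with_prob_AE AE_sample \<Omega>)
  from with_prob_conj[OF this lin]
  have "with_prob_tending_to_one M (\<lambda>n \<omega>. linearized \<epsilon> \<delta> n (\<lambda>i. Y i \<omega>))"
    by (rule with_prob_mono[where ?n0.0 = 0]) (simp add: linearized_def Gn_def sum_subtractf scaleR_diff_right)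
  with \<delta> show ?thesis by (rule that)
qed

text \<open>Randomness enters through finitely many events of probability tending to one and through
  the size of the mean of \<open>G\<close> at \<alpha>0, which is tight at rate 1/sqrt n. Everything
  else is \<open>sample_expansion\<close>.\<close>

theorem hybrid_plug_in_expansion:
  assumes Phat: "o_pr M (\<lambda>n. 1 / sqrt (real n))
                 (\<lambda>n \<omega>. (\<Sum>i<n. h (Y i \<omega>) (Phat n \<omega>)) /\<^sub>R real n)"
    and Phat_consistent: "consistent_for M Phat P0"
    and thetahat_Phat: "with_prob_tending_to_one M (\<lambda>n \<omega>.
          sole_critical_maximizer \<Theta>
            (\<lambda>\<theta>. hybrid_loglik a f m mu n (\<lambda>i. Y i \<omega>) \<theta> (Phat n \<omega>)) (thetahat n \<omega> (Phat n \<omega>)))"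
    and thetahat_P0: "with_prob_tending_to_one M (\<lambda>n \<omega>.
          sole_critical_maximizer \<Theta>
            (\<lambda>\<theta>. hybrid_loglik a f m mu n (\<lambda>i. Y i \<omega>) \<theta> P0) (thetahat n \<omega> P0))"
  obtains T' where "(theta has_derivative T') (at P0)"
    "consistent_for M (\<lambda>n \<omega>. thetahat n \<omega> (Phat n \<omega>)) (theta P0)"
    "o_pr M (\<lambda>n. 1 / sqrt (real n)) (\<lambda>n \<omega>. thetahat n \<omega> (Phat n \<omega>) - (thetahat n \<omega> P0 + T' (Phat n \<omega> - P0)))"
proof -
  obtain C \<epsilon>1 T' where C: "C > 0" "\<epsilon>1 > 0" and T': "(theta has_derivative T') (at P0)"
    and expan: "\<And>\<epsilon> \<delta> n y P e. 0 < \<epsilon> \<Longrightarrow> \<epsilon> \<le> \<epsilon>1 \<Longrightarrow> 0 < \<delta> \<Longrightarrow> \<delta> < r \<Longrightarrow> 0 < n \<Longrightarrow> linearized \<epsilon> \<delta> n y \<Longrightarrow>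
       0 < e \<Longrightarrow> norm (P - P0) \<le> \<delta> \<Longrightarrow> C * (norm (Gn n y \<alpha>0) + norm (hbar n y P) + e) \<le> \<delta> \<Longrightarrow>
       \<exists>\<theta> \<theta>'. critical n y P \<theta> \<and> critical n y P0 \<theta>' \<and>
         norm (\<theta> - \<theta>0) \<le> C * (norm (Gn n y \<alpha>0) + norm (hbar n y P) + e) \<and>
         norm (\<theta> - \<theta>' - T' (P - P0)) \<le> C * \<epsilon> * (norm (Gn n y \<alpha>0) + norm (hbar n y P) + e)"
    using sample_expansion by metis
  define g where "g n \<omega> = norm (Gn n (\<lambda>i. Y i \<omega>) \<alpha>0)" for n \<omega>
  \<comment> \<open>The summand 2/sqrt n collects two terms of size 1/sqrt n: the bound on
    \<open>hbar\<close> at the plug-in value, and the slack \<open>e\<close>.\<close>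
  define bnd where "bnd \<epsilon> n \<omega> \<longleftrightarrow> norm (thetahat n \<omega> (Phat n \<omega>) - \<theta>0) \<le> C * (g n \<omega> + 2 / sqrt n) \<and>
      norm (thetahat n \<omega> (Phat n \<omega>) - (thetahat n \<omega> P0 + T' (Phat n \<omega> - P0))) \<le> C * \<epsilon> * (g n \<omega> + 2 / sqrt n)" for \<epsilon> n \<omega>
  have mean: "(\<integral>y. G y \<alpha>0 \<partial>F) = 0" using ES_\<alpha>0 by (simp add: ES_def)
  have gsmall: "with_prob_tending_to_one M (\<lambda>n \<omega>. g n \<omega> < e)" if "e > 0" for e
    using weak_law[OF G_meas[OF \<alpha>0_in_ball] G_square_integrable[OF \<alpha>0_in_ball] that]
    unfolding mean by (simp add: g_def Gn_def)
  obtain V where V: "V \<ge> 0" "\<And>n t. n > 0 \<Longrightarrow> t > 0 \<Longrightarrow>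
     outer_measure_of M {\<omega> \<in> space M. t / sqrt n \<le> g n \<omega>} \<le> ennreal (V / t\<^sup>2)"
    using chebyshev_mean[OF G_meas[OF \<alpha>0_in_ball] G_square_integrable[OF \<alpha>0_in_ball]]
    unfolding mean by (auto simp: g_def Gn_def)
  have small: "\<exists>n0. \<forall>n\<ge>n0. 2 / sqrt (real n) \<le> d" if "d > 0" for d :: real
  proof -
    have "(\<lambda>n. 2 / sqrt (real n)) \<longlonglongrightarrow> 0"
      by (intro tendsto_divide_0[OF tendsto_const] filterlim_at_top_imp_at_infinity
          filterlim_compose[OF sqrt_at_top filterlim_real_sequentially])
    from order_tendstoD(2)[OF this that] show ?thesis
      unfolding eventually_sequentially by (meson less_imp_le)
  qed
  have main: "with_prob_tending_to_one M (bnd \<epsilon>)" if \<epsilon>: "0 < \<epsilon>" "\<epsilon> \<le> \<epsilon>1" for \<epsilon>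
  proof -
    obtain \<delta> where \<delta>: "0 < \<delta>" "\<delta> < r" and lin: "with_prob_tending_to_one M (\<lambda>n \<omega>. linearized \<epsilon> \<delta> n (\<lambda>i. Y i \<omega>))"
      using linearized_with_prob[OF \<epsilon>(1)] .
    have cons: "with_prob_tending_to_one M (\<lambda>n \<omega>. norm ((Phat n \<omega> - P0) /\<^sub>R 1) \<le> \<delta>)"
      using Phat_consistent \<delta>(1) unfolding consistent_for_def o_pr_iff by blast
    have hb: "with_prob_tending_to_one M (\<lambda>n \<omega>. norm (((\<Sum>i<n. h (Y i \<omega>) (Phat n \<omega>)) /\<^sub>R real n) /\<^sub>R (1 / sqrt n)) \<le> 1)"
      using Phat[unfolded o_pr_iff, rule_format, of 1] by simp
    have d: "\<delta> / (2 * C) > 0" using \<delta> C by simp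
    obtain n0 where n0: "\<And>n. n \<ge> n0 \<Longrightarrow> 2 / sqrt (real n) \<le> \<delta> / (2 * C)" using small[OF d] by blast
    note ev = with_prob_conj[OF with_prob_conj[OF lin cons] with_prob_conj[OF with_prob_conj[OF hb gsmall[OF d]]
          with_prob_conj[OF thetahat_Phat thetahat_P0]]]
    show ?thesis
    proof (rule with_prob_mono[OF ev, where ?n0.0 = "max n0 1"])
      fix n \<omega> assume n: "max n0 1 \<le> n"
        and *: "(linearized \<epsilon> \<delta> n (\<lambda>i. Y i \<omega>) \<and> norm ((Phat n \<omega> - P0) /\<^sub>R 1) \<le> \<delta>) \<and>
          (norm (((\<Sum>i<n. h (Y i \<omega>) (Phat n \<omega>)) /\<^sub>R real n) /\<^sub>R (1 / sqrt n)) \<le> 1 \<and> g n \<omega> < \<delta> / (2 * C)) \<and>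
          sole_critical_maximizer \<Theta> (\<lambda>\<theta>. hybrid_loglik a f m mu n (\<lambda>i. Y i \<omega>) \<theta> (Phat n \<omega>)) (thetahat n \<omega> (Phat n \<omega>)) \<and>
          sole_critical_maximizer \<Theta> (\<lambda>\<theta>. hybrid_loglik a f m mu n (\<lambda>i. Y i \<omega>) \<theta> P0) (thetahat n \<omega> P0)"
      let ?y = "\<lambda>i. Y i \<omega>" and ?P = "Phat n \<omega>"
      have n1: "0 < n" and sn: "0 < sqrt (real n)" using n by auto
      have lin: "linearized \<epsilon> \<delta> n ?y" and P: "norm (?P - P0) \<le> \<delta>" and gs: "g n \<omega> < \<delta> / (2 * C)" using * by auto
      have "norm (hbar n ?y ?P /\<^sub>R (1 / sqrt n)) \<le> 1" using * unfolding hbar_def by blast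
      then have "sqrt n * norm (hbar n ?y ?P) \<le> 1" by simp
      then have hb: "norm (hbar n ?y ?P) \<le> 1 / sqrt n" using sn by (simp add: field_simps)
      have crit: "thetahat n \<omega> P' = \<theta>" if "critical n ?y P' \<theta>" "P' = ?P \<or> P' = P0" for P' \<theta>
        using that * unfolding sole_critical_maximizer_def critical_def by metis
      have le: "norm (Gn n ?y \<alpha>0) + norm (hbar n ?y ?P) + 1 / sqrt n \<le> g n \<omega> + 2 / sqrt n"
        using hb by (simp add: g_def)
      have "C * (norm (Gn n ?y \<alpha>0) + norm (hbar n ?y ?P) + 1 / sqrt n) \<le> C * (\<delta> / (2 * C) + \<delta> / (2 * C))"
        using le gs n0[of n] n C(1) by (intro mult_left_mono) auto
      also have "\<dots> = \<delta>" using C(1) by (simp add: field_simps)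
      finally have Cs: "C * (norm (Gn n ?y \<alpha>0) + norm (hbar n ?y ?P) + 1 / sqrt n) \<le> \<delta>" .
      obtain \<theta> \<theta>' where t: "critical n ?y ?P \<theta>" "critical n ?y P0 \<theta>'"
         "norm (\<theta> - \<theta>0) \<le> C * (norm (Gn n ?y \<alpha>0) + norm (hbar n ?y ?P) + 1 / sqrt n)"
         "norm (\<theta> - \<theta>' - T' (?P - P0)) \<le> C * \<epsilon> * (norm (Gn n ?y \<alpha>0) + norm (hbar n ?y ?P) + 1 / sqrt n)"
        using expan[OF \<epsilon> \<delta> n1 lin _ P Cs] sn by auto
      have e: "thetahat n \<omega> ?P = \<theta>" "thetahat n \<omega> P0 = \<theta>'" using crit[OF t(1)] crit[OF t(2)] by simp_all
      have "C * (norm (Gn n ?y \<alpha>0) + norm (hbar n ?y ?P) + 1 / sqrt n) \<le> C * (g n \<omega> + 2 / sqrt n)"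
        using le C(1) by (intro mult_left_mono) auto
      moreover have "C * \<epsilon> * (norm (Gn n ?y \<alpha>0) + norm (hbar n ?y ?P) + 1 / sqrt n) \<le> C * \<epsilon> * (g n \<omega> + 2 / sqrt n)"
        using le C(1) \<epsilon>(1) by (intro mult_left_mono) auto
      ultimately show "bnd \<epsilon> n \<omega>"
        unfolding bnd_def e diff_diff_eq[symmetric] using t(3,4) by linarith
    qed
  qed
  show ?thesis
  proof (rule that[OF T'])
    show "consistent_for M (\<lambda>n \<omega>. thetahat n \<omega> (Phat n \<omega>)) (theta P0)"
      unfolding consistent_for_def o_pr_iff
    proof (intro allI impI)
      fix \<kappa> :: real assume \<kappa>: "\<kappa> > 0"
      then have d: "\<kappa> / (2 * C) > 0" using C by simp
      obtain n0 where n0: "\<And>n. n \<ge> n0 \<Longrightarrow> 2 / sqrt (real n) \<le> \<kappa> / (2 * C)" using small[OF d] by blast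
      show "with_prob_tending_to_one M (\<lambda>n \<omega>. norm ((thetahat n \<omega> (Phat n \<omega>) - theta P0) /\<^sub>R 1) \<le> \<kappa>)"
      proof (rule with_prob_mono[OF with_prob_conj[OF main[OF C(2) order_refl] gsmall[OF d]], where ?n0.0 = n0])
        fix n \<omega> assume n: "n0 \<le> n" and *: "bnd \<epsilon>1 n \<omega> \<and> g n \<omega> < \<kappa> / (2 * C)"
        have "C * (g n \<omega> + 2 / sqrt n) \<le> C * (\<kappa> / (2 * C) + \<kappa> / (2 * C))"
          using * n0[OF n] C(1) by (intro mult_left_mono) auto
        also have "\<dots> = \<kappa>" using C(1) by (simp add: field_simps)
        finally show "norm ((thetahat n \<omega> (Phat n \<omega>) - theta P0) /\<^sub>R 1) \<le> \<kappa>"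
          using * by (simp add: bnd_def \<theta>0_def)
      qed
    qed
    show "o_pr M (\<lambda>n. 1 / sqrt (real n)) (\<lambda>n \<omega>. thetahat n \<omega> (Phat n \<omega>) - (thetahat n \<omega> P0 + T' (Phat n \<omega> - P0)))"
      unfolding o_pr_iff
    proof (intro allI impI)
      fix \<kappa> :: real assume \<kappa>: "\<kappa> > 0"
      let ?\<Delta> = "\<lambda>n \<omega>. thetahat n \<omega> (Phat n \<omega>) - (thetahat n \<omega> P0 + T' (Phat n \<omega> - P0))"
      show "with_prob_tending_to_one M (\<lambda>n \<omega>. norm (?\<Delta> n \<omega> /\<^sub>R (1 / sqrt (real n))) \<le> \<kappa>)"
      proof (rule with_prob_tight)
        fix \<eta> :: real assume \<eta>: "\<eta> > 0"
        \<comment> \<open>By Chebyshev the mean exceeds t/sqrt n with probability at most \<eta>;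
          the summand 1 keeps \<open>t\<close> positive if \<open>V\<close> is zero.\<close>
        define t where "t = sqrt (V / \<eta>) + 1"
        have t: "t > 0" using V(1) \<eta> by (simp add: t_def add_nonneg_pos)
        have "V / \<eta> \<le> t\<^sup>2"
        proof -
          have "V / \<eta> = (sqrt (V / \<eta>))\<^sup>2" using V(1) \<eta> by simp
          also have "\<dots> \<le> t\<^sup>2" using V(1) \<eta> by (intro power_mono) (auto simp: t_def)
          finally show ?thesis .
        qed
        then have Vt: "V / t\<^sup>2 \<le> \<eta>" using t \<eta> by (simp add: field_simps)
        \<comment> \<open>Makes the error at most \<kappa>/sqrt n wherever the mean of
          \<open>G\<close> is below t/sqrt n.\<close>
        define \<epsilon> where "\<epsilon> = min \<epsilon>1 (\<kappa> / (C * (t + 2)))"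
        have \<epsilon>: "0 < \<epsilon>" "\<epsilon> \<le> \<epsilon>1" using C \<kappa> t by (auto simp: \<epsilon>_def)
        have "\<forall>\<^sub>F n in sequentially. outer_measure_of M {\<omega> \<in> space M. bnd \<epsilon> n \<omega> \<and> \<not> norm (?\<Delta> n \<omega> /\<^sub>R (1 / sqrt (real n))) \<le> \<kappa>} \<le> ennreal \<eta>"
          using eventually_gt_at_top[of 0]
        proof eventually_elim
          case (elim n)
          then have sn: "0 < sqrt (real n)" by simp
          have "t / sqrt n \<le> g n \<omega>" if b: "bnd \<epsilon> n \<omega>" and big: "\<not> norm (?\<Delta> n \<omega> /\<^sub>R (1 / sqrt (real n))) \<le> \<kappa>" for \<omega>
          proof (rule ccontr)
            assume "\<not> t / sqrt n \<le> g n \<omega>"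
            then have g: "g n \<omega> + 2 / sqrt n \<le> (t + 2) / sqrt n" by (simp add: add_divide_distrib)
            have "norm (?\<Delta> n \<omega>) \<le> C * \<epsilon> * (g n \<omega> + 2 / sqrt n)" using b by (simp add: bnd_def)
            also have "\<dots> \<le> C * \<epsilon> * ((t + 2) / sqrt n)" using g C(1) \<epsilon>(1) by (intro mult_left_mono) auto
            also have "\<dots> = C * (t + 2) * \<epsilon> / sqrt n" by simp
            also have "\<dots> \<le> C * (t + 2) * (\<kappa> / (C * (t + 2))) / sqrt n"
              using C(1) t by (intro divide_right_mono mult_left_mono) (auto simp: \<epsilon>_def)
            also have "\<dots> = \<kappa> / sqrt n" using C(1) t by simp
            finally have "sqrt n * norm (?\<Delta> n \<omega>) \<le> \<kappa>" using sn by (simp add: field_simps)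
            moreover have "norm (?\<Delta> n \<omega> /\<^sub>R (1 / sqrt (real n))) = sqrt n * norm (?\<Delta> n \<omega>)" by simp
            ultimately show False using big by simp
          qed
          then have "{\<omega> \<in> space M. bnd \<epsilon> n \<omega> \<and> \<not> norm (?\<Delta> n \<omega> /\<^sub>R (1 / sqrt (real n))) \<le> \<kappa>} \<subseteq> {\<omega> \<in> space M. t / sqrt n \<le> g n \<omega>}"
            by blast
          then have "outer_measure_of M {\<omega> \<in> space M. bnd \<epsilon> n \<omega> \<and> \<not> norm (?\<Delta> n \<omega> /\<^sub>R (1 / sqrt (real n))) \<le> \<kappa>}
              \<le> outer_measure_of M {\<omega> \<in> space M. t / sqrt n \<le> g n \<omega>}"
            by (rule outer_measure_of_mono)
          also have "\<dots> \<le> ennreal (V / t\<^sup>2)" using V(2)[OF elim t] .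
          also have "\<dots> \<le> ennreal \<eta>" using Vt by (rule ennreal_leI)
          finally show ?case .
        qed
        with main[OF \<epsilon>] show "\<exists>R. with_prob_tending_to_one M R \<and>
           (\<forall>\<^sub>F n in sequentially. outer_measure_of M {\<omega> \<in> space M. R n \<omega> \<and> \<not> norm (?\<Delta> n \<omega> /\<^sub>R (1 / sqrt (real n))) \<le> \<kappa>} \<le> ennreal \<eta>)"
          by (intro exI[of _ "bnd \<epsilon>"]) simp
      qed
    qed
  qed
qed

end

section \<open>The plug-in expansion\<close>

lemma AE_obtain_set:
  assumes "AE y in F. R y"
  obtains \<Omega> where "\<Omega> \<in> sets F" "AE y in F. y \<in> \<Omega>" "\<And>y. y \<in> \<Omega> \<Longrightarrow> R y"
proof -
  obtain N where N: "N \<in> null_sets F" "{y \<in> space F. \<not> R y} \<subseteq> N"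
    using assms by (auto simp: eventually_ae_filter)
  have "AE y in F. y \<in> space F - N" using AE_not_in[OF N(1)] AE_space by eventually_elim simp
  with N that[of "space F - N"] show ?thesis by (auto simp: null_sets_def)
qed

lemma norm_le_basis_bound:
  fixes g :: "'a::euclidean_space \<Rightarrow> 'b::real_normed_vector" and B :: real
  assumes g: "bounded_linear g" and B: "\<And>b. b \<in> Basis \<Longrightarrow> norm (g b) \<le> B"
  shows "norm (g v) \<le> DIM('a) * B * norm v"
proof -
  interpret g: bounded_linear g by fact
  have "g v = (\<Sum>b\<in>Basis. (v \<bullet> b) *\<^sub>R g b)"
    by (subst euclidean_representation[of v, symmetric]) (simp only: g.sum g.scaleR)
  also have "norm \<dots> \<le> (\<Sum>b\<in>(Basis :: 'a set). norm v * B)"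
    by (rule sum_norm_le) (use B in \<open>auto intro!: mult_mono simp: Basis_le_norm\<close>)
  finally show ?thesis by (simp add: ac_simps)
qed

text \<open>Chain rule for the composed estimating function. Bounds on basis vectors become operator
  norm bounds at the cost of one factor of the dimension for each derivative.\<close>

lemma compose_second_order_bounds:
  fixes \<phi> :: "'w::euclidean_space \<Rightarrow> 'q::euclidean_space" and k :: "'x::euclidean_space \<Rightarrow> 'w"
    and kd :: "'x \<Rightarrow> 'x \<Rightarrow>\<^sub>L 'w" and K K' Ck r :: real
  assumes k: "\<And>x. x \<in> ball c r \<Longrightarrow> (k has_derivative blinfun_apply (kd x)) (at x)"
    and kd: "\<And>x. x \<in> ball c r \<Longrightarrow> kd differentiable (at x)" "\<And>x. x \<in> ball c r \<Longrightarrow> norm (kd x) \<le> Ck"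
      "\<And>x x'. x \<in> ball c r \<Longrightarrow> x' \<in> ball c r \<Longrightarrow> norm (kd x - kd x') \<le> Ck * norm (x - x')"
    and p1: "\<And>x. x \<in> ball c r \<Longrightarrow> partials_bounded \<phi> (k x) K"
    and p2: "\<And>x. x \<in> ball c r \<Longrightarrow> second_partials_bounded \<phi> (k x) K'"
    and nonneg: "0 \<le> Ck" "0 \<le> K" "0 \<le> K'"
  defines "M' \<equiv> \<lambda>x. Blinfun (frechet_derivative \<phi> (at (k x))) o\<^sub>L kd x"
  shows "x \<in> ball c r \<Longrightarrow> ((\<lambda>x. \<phi> (k x)) has_derivative blinfun_apply (M' x)) (at x)"
    and "x \<in> ball c r \<Longrightarrow> norm (M' x) \<le> DIM('w) * K * Ck"
    and "x \<in> ball c r \<Longrightarrow> M' differentiable (at x)"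
    and "x \<in> ball c r \<Longrightarrow> x' \<in> ball c r \<Longrightarrow>
      norm (M' x - M' x') \<le> (DIM('w) * K * Ck + DIM('w) * (DIM('w) * K') * Ck * Ck) * norm (x - x')"
proof -
  \<comment> \<open>\<open>second_partials_bounded\<close> supplies a derivative function that may
    change with the base point. A canonical choice, with which each of them agrees locally, is
    differentiable at all the points \<open>k x\<close>.\<close>
  define \<phi>D where "\<phi>D w = Blinfun (frechet_derivative \<phi> (at w))" for w
  have app: "blinfun_apply (\<phi>D w) = g'" if "(\<phi> has_derivative g') (at w)" for w g'
  proof -
    have "frechet_derivative \<phi> (at w) = g'" using frechet_derivative_at[OF that] by simp
    then show ?thesis using has_derivative_bounded_linear[OF that]
      by (simp add: \<phi>D_def bounded_linear_Blinfun_apply)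
  qed
  have d1: "(\<phi> has_derivative blinfun_apply (\<phi>D (k x))) (at (k x))" "norm (\<phi>D (k x)) \<le> DIM('w) * K"
    if x: "x \<in> ball c r" for x
  proof -
    obtain g' where g': "(\<phi> has_derivative g') (at (k x))" "\<And>b. b \<in> Basis \<Longrightarrow> norm (g' b) \<le> K"
      using p1[OF x] unfolding partials_bounded_def by blast
    then show "(\<phi> has_derivative blinfun_apply (\<phi>D (k x))) (at (k x))" by (simp add: app)
    show "norm (\<phi>D (k x)) \<le> DIM('w) * K"
      unfolding norm_blinfun.rep_eq app[OF g'(1)]
    proof (rule onorm_bound)
      show "norm (g' v) \<le> DIM('w) * K * norm v" for v
        by (rule norm_le_basis_bound[OF has_derivative_bounded_linear[OF g'(1)] g'(2)])
    qed (use nonneg in simp)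
  qed
  have d2: "\<exists>g''. ((\<lambda>x. \<phi>D (k x)) has_derivative (\<lambda>v. g'' (blinfun_apply (kd x) v))) (at x) \<and>
      (\<forall>u. norm (g'' u) \<le> DIM('w) * (DIM('w) * K') * norm u)" if x: "x \<in> ball c r" for x
  proof -
    obtain g' g'' where g: "\<forall>\<^sub>F z in nhds (k x). (\<phi> has_derivative blinfun_apply (g' z)) (at z)"
      "(g' has_derivative g'') (at (k x))" "\<And>b c. b \<in> Basis \<Longrightarrow> c \<in> Basis \<Longrightarrow> norm (blinfun_apply (g'' b) c) \<le> K'"
      using p2[OF x] unfolding second_partials_bounded_def by blast
    have "\<forall>\<^sub>F z in nhds (k x). g' z = \<phi>D z"
      using g(1) by eventually_elim (metis app blinfun_eqI)
    from has_derivative_eventually_cong[OF g(2) this] have "(\<phi>D has_derivative g'') (at (k x))" .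
    from has_derivative_compose[OF k[OF x] this]
    have "((\<lambda>x. \<phi>D (k x)) has_derivative (\<lambda>v. g'' (blinfun_apply (kd x) v))) (at x)" .
    moreover have "norm (g'' u) \<le> DIM('w) * (DIM('w) * K') * norm u" for u
    proof (rule norm_le_basis_bound[OF has_derivative_bounded_linear[OF g(2)]])
      fix b :: 'w assume b: "b \<in> Basis"
      show "norm (g'' b) \<le> DIM('w) * K'"
        unfolding norm_blinfun.rep_eq
      proof (rule onorm_bound)
        show "norm (blinfun_apply (g'' b) v) \<le> DIM('w) * K' * norm v" for v
          by (rule norm_le_basis_bound[OF blinfun.bounded_linear_right g(3)[OF b]])
      qed (use nonneg in simp)
    qed
    ultimately show ?thesis by blast
  qed
  have M': "M' = (\<lambda>x. \<phi>D (k x) o\<^sub>L kd x)" by (simp add: M'_def \<phi>D_def)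
  show "((\<lambda>x. \<phi> (k x)) has_derivative blinfun_apply (M' x)) (at x)" if "x \<in> ball c r"
    using has_derivative_compose[OF k[OF that] d1(1)[OF that]] by (simp add: M' blinfun_compose.rep_eq o_def)
  show "norm (M' x) \<le> DIM('w) * K * Ck" if "x \<in> ball c r"
    unfolding M' using d1(2)[OF that] kd(2)[OF that] nonneg
    by (intro order_trans[OF norm_blinfun_compose] mult_mono) auto
  show "M' differentiable (at x)" if x: "x \<in> ball c r"
  proof -
    obtain g'' where g'': "((\<lambda>x. \<phi>D (k x)) has_derivative (\<lambda>v. g'' (blinfun_apply (kd x) v))) (at x)"
      using d2[OF x] by blast
    obtain k'' where k'': "(kd has_derivative k'') (at x)" using kd(1)[OF x] unfolding differentiable_def by blast
    from bounded_bilinear.FDERIV[OF bounded_bilinear_blinfun_compose g'' k''] show ?thesis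
      unfolding M' differentiable_def by blast
  qed
  show "norm (M' x - M' x') \<le> (DIM('w) * K * Ck + DIM('w) * (DIM('w) * K') * Ck * Ck) * norm (x - x')"
    if x: "x \<in> ball c r" "x' \<in> ball c r"
  proof -
    obtain g'' where g'': "\<And>x. x \<in> ball c r \<Longrightarrow> ((\<lambda>x. \<phi>D (k x)) has_derivative (\<lambda>v. g'' x (blinfun_apply (kd x) v))) (at x)"
      "\<And>x u. x \<in> ball c r \<Longrightarrow> norm (g'' x u) \<le> DIM('w) * (DIM('w) * K') * norm u"
      using d2 by metis
    \<comment> \<open>The mean value inequality is used in the variable of \<open>k\<close>, because
      its ball is convex whereas the image of the ball under \<open>k\<close> need not be.\<close>
    have lip: "norm (\<phi>D (k x) - \<phi>D (k x')) \<le> (DIM('w) * (DIM('w) * K') * Ck) * norm (x - x')"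
    proof (rule differentiable_bound_ball[OF g''(1) _ x])
      fix z v assume z: "z \<in> ball c r"
      have "norm (g'' z (blinfun_apply (kd z) v)) \<le> DIM('w) * (DIM('w) * K') * norm (blinfun_apply (kd z) v)"
        by (rule g''(2)[OF z])
      also have "norm (blinfun_apply (kd z) v) \<le> Ck * norm v"
        by (rule order_trans[OF norm_blinfun mult_right_mono[OF kd(2)[OF z]]]) simp
      finally show "norm (g'' z (blinfun_apply (kd z) v)) \<le> DIM('w) * (DIM('w) * K') * Ck * norm v"
        using nonneg by (simp add: mult_left_mono mult.assoc)
    qed (use nonneg in auto)
    show ?thesis unfolding M'
      by (rule bounded_bilinear.lipschitz_prod[OF bounded_bilinear_blinfun_compose])
         (use d1(2)[OF x(1)] kd(2)[OF x(2)] lip kd(3)[OF x] nonneg norm_blinfun_compose in auto)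
  qed
qed

text \<open>Continuity at the centre suffices: on a smaller ball both derivatives stay within
  distance 1 of their values at \<open>c\<close>, and the bound on the second makes the first
  Lipschitz.\<close>

lemma C2_graph_bounds:
  fixes u :: "'p::euclidean_space \<times> 'r::euclidean_space \<Rightarrow> 's::euclidean_space"
  assumes C2: "C2_on W u" and W: "ball c r0 \<subseteq> W" "0 < r0"
  shows "\<exists>r Ck kd. 0 < r \<and> r \<le> r0 \<and> 1 \<le> Ck \<and>
    (\<forall>x\<in>ball c r. ((\<lambda>x. (u x, snd x)) has_derivative blinfun_apply (kd x)) (at x) \<and>
      kd differentiable (at x) \<and> norm (kd x) \<le> Ck \<and>
      (\<forall>x'\<in>ball c r. norm (kd x - kd x') \<le> Ck * norm (x - x')))"
proof -
  obtain u' :: "'p \<times> 'r \<Rightarrow> ('p \<times> 'r) \<Rightarrow>\<^sub>L 's" and u'' :: "'p \<times> 'r \<Rightarrow> ('p \<times> 'r) \<Rightarrow>\<^sub>L (('p \<times> 'r) \<Rightarrow>\<^sub>L 's)"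
    where u': "\<And>x. x \<in> W \<Longrightarrow> (u has_derivative blinfun_apply (u' x)) (at x)"
      and u'': "\<And>x. x \<in> W \<Longrightarrow> (u' has_derivative blinfun_apply (u'' x)) (at x)" "continuous_on W u''"
    using C2 unfolding C2_on_def C1_on_def by blast
  have c: "c \<in> ball c r0" using W by simp
  then have cW: "c \<in> W" using W by blast
  have "isCont u' c" using u''(1)[OF cW] by (rule has_derivative_continuous)
  moreover have "isCont u'' c"
    using continuous_on_subset[OF u''(2) W(1)] c by (simp add: continuous_on_eq_continuous_at)
  ultimately obtain r1 r2 where r12: "0 < r1" "0 < r2"
    "\<And>x. dist x c < r1 \<Longrightarrow> dist (u' x) (u' c) < 1" "\<And>x. dist x c < r2 \<Longrightarrow> dist (u'' x) (u'' c) < 1"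
    unfolding continuous_at_eps_delta by (metis zero_less_one)
  define r where "r = min r0 (min r1 r2)"
  have r: "0 < r" "r \<le> r0" using r12 W by (auto simp: r_def)
  have bW: "x \<in> W" if "x \<in> ball c r" for x using that W by (auto simp: r_def)
  have b1: "norm (u' x) \<le> norm (u' c) + 1" if "x \<in> ball c r" for x
  proof -
    have "dist x c < r1" using that by (simp add: r_def dist_commute)
    from r12(3)[OF this] norm_triangle_sub[of "u' x" "u' c"] show ?thesis unfolding dist_norm by linarith
  qed
  have b2: "norm (u'' x) \<le> norm (u'' c) + 1" if "x \<in> ball c r" for x
  proof -
    have "dist x c < r2" using that by (simp add: r_def dist_commute)
    from r12(4)[OF this] norm_triangle_sub[of "u'' x" "u'' c"] show ?thesis unfolding dist_norm by linarith
  qed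
  \<comment> \<open>Injections that assemble the derivative of the pair as an operator, so that
    \<open>kd\<close> is an affine function of \<open>u'\<close>.\<close>
  define il :: "'s \<Rightarrow>\<^sub>L ('s \<times> 'r)" where "il = Blinfun (\<lambda>s. (s, 0))"
  define ir :: "('p \<times> 'r) \<Rightarrow>\<^sub>L ('s \<times> 'r)" where "ir = Blinfun (\<lambda>v. (0, snd v))"
  have "bounded_linear (\<lambda>s. (s :: 's, 0 :: 'r))" "bounded_linear (\<lambda>v :: 'p \<times> 'r. (0 :: 's, snd v))"
    by (intro bounded_linear_intros)+
  then have il: "blinfun_apply il s = (s, 0)" and ir: "blinfun_apply ir v = (0, snd v)" for s v
    by (simp_all add: il_def ir_def bounded_linear_Blinfun_apply)
  have nil: "norm il \<le> 1" and nir: "norm ir \<le> 1"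
    by (rule norm_blinfun_bound; simp add: il ir norm_Pair norm_snd_le; metis norm_snd_le prod.collapse)+
  define kd where "kd x = (il o\<^sub>L u' x) + ir" for x
  define Ck where "Ck = (norm (u'' c) + 1) + ((norm (u' c) + 1) + 1)"
  have ulip: "norm (u' x - u' x') \<le> (norm (u'' c) + 1) * norm (x - x')" if x: "x \<in> ball c r" "x' \<in> ball c r" for x x'
  proof (rule differentiable_bound_ball[OF u''(1)[OF bW] _ x])
    show "norm (blinfun_apply (u'' z) v) \<le> (norm (u'' c) + 1) * norm v" if "z \<in> ball c r" for z v
      by (rule order_trans[OF norm_blinfun mult_right_mono[OF b2[OF that]]]) simp
  qed (assumption | intro add_nonneg_nonneg norm_ge_zero zero_le_one)+
  show ?thesis
  proof (rule exI[of _ r], rule exI[of _ Ck], rule exI[of _ kd], intro conjI ballI r)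
    show "1 \<le> Ck" by (simp add: Ck_def)
    fix x assume x: "x \<in> ball c r"
    have "((\<lambda>x. (u x, snd x)) has_derivative (\<lambda>v. (blinfun_apply (u' x) v, snd v))) (at x)"
      by (intro has_derivative_Pair u' bW x bounded_linear_imp_has_derivative bounded_linear_snd)
    moreover have "(\<lambda>v. (blinfun_apply (u' x) v, snd v)) = blinfun_apply (kd x)"
      by (simp add: fun_eq_iff kd_def blinfun.add_left il ir)
    ultimately show "((\<lambda>x. (u x, snd x)) has_derivative blinfun_apply (kd x)) (at x)" by simp
    show "kd differentiable (at x)"
      unfolding kd_def differentiable_def
      by (rule exI, rule has_derivative_add[OF bounded_bilinear.FDERIV[OF bounded_bilinear_blinfun_compose
            has_derivative_const u''(1)[OF bW[OF x]]] has_derivative_const])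
    have "norm (kd x) \<le> norm il * norm (u' x) + norm ir"
      unfolding kd_def by (intro order_trans[OF norm_triangle_ineq] add_mono norm_blinfun_compose order_refl)
    also have "\<dots> \<le> 1 * (norm (u' c) + 1) + 1"
      by (intro add_mono mult_mono nil nir b1 x) auto
    also have "\<dots> \<le> Ck"
      unfolding Ck_def mult_1 by (rule add_increasing[OF add_nonneg_nonneg[OF norm_ge_zero zero_le_one] order_refl])
    finally show "norm (kd x) \<le> Ck" .
    fix x' assume x': "x' \<in> ball c r"
    have "kd x - kd x' = il o\<^sub>L (u' x - u' x')"
      by (simp add: kd_def bounded_bilinear.diff_right[OF bounded_bilinear_blinfun_compose])
    then have "norm (kd x - kd x') \<le> norm il * norm (u' x - u' x')" by (simp only: norm_blinfun_compose)
    also have "\<dots> \<le> 1 * ((norm (u'' c) + 1) * norm (x - x'))"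
      by (intro mult_mono nil ulip x x') auto
    also have "\<dots> \<le> Ck * norm (x - x')" by (simp add: Ck_def mult_right_mono)
    finally show "norm (kd x - kd x') \<le> Ck * norm (x - x')" .
  qed
qed

text \<open>The bounding functions are known to be measurable only through an integrable power; the
  root recovers their absolute value.\<close>

lemma abs_integrable_from_power:
  fixes K :: "'y \<Rightarrow> real"
  assumes "integrable F (\<lambda>y. K y ^ n)" "0 < n" "even n"
  shows "(\<lambda>y. \<bar>K y\<bar>) \<in> borel_measurable F" "integrable F (\<lambda>y. \<bar>K y\<bar> ^ n)"
proof -
  have pw: "\<bar>K y\<bar> ^ n = K y ^ n" for y using assms(3) by (rule power_even_abs)
  show "integrable F (\<lambda>y. \<bar>K y\<bar> ^ n)" unfolding pw by (rule assms(1))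
  have "\<bar>K y\<bar> = root n (K y ^ n)" for y unfolding pw[symmetric] using assms(2) by (simp add: real_root_power_cancel)
  moreover have "(\<lambda>y. root n (K y ^ n)) \<in> borel_measurable F"
    using borel_measurable_integrable[OF assms(1)] by (rule measurable_compose) (intro borel_measurable_continuous_onI continuous_intros)
  ultimately show "(\<lambda>y. \<bar>K y\<bar>) \<in> borel_measurable F" by simp
qed

theorem theorem2:
  fixes M :: "'w measure"
    and Y :: "nat \<Rightarrow> 'w \<Rightarrow> real ^ 'd"
    and F \<nu> :: "(real ^ 'd) measure"
    and a :: real
    and \<Theta> :: "(real ^ 'p) set"
    and f :: "real ^ 'p \<Rightarrow> real ^ 'd \<Rightarrow> real"
    and m :: "real ^ 'd \<Rightarrow> real ^ 's \<Rightarrow> real ^ 'r \<Rightarrow> real ^ 'q"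
    and h :: "real ^ 'd \<Rightarrow> real ^ 'r \<Rightarrow> real ^ 'r"
    and mu :: "real ^ 'p \<Rightarrow> real ^ 'r \<Rightarrow> real ^ 's"
    and lam :: "real ^ 'p \<Rightarrow> real ^ 'r \<Rightarrow> real ^ 'q"
    and theta :: "real ^ 'r \<Rightarrow> real ^ 'p"
    and P0 :: "real ^ 'r"
    and Phat :: "nat \<Rightarrow> 'w \<Rightarrow> real ^ 'r"
    and thetahat :: "nat \<Rightarrow> 'w \<Rightarrow> real ^ 'r \<Rightarrow> real ^ 'p"
    and N :: "((real ^ 'p) \<times> (real ^ 'q) \<times> (real ^ 'r)) set"
  \<comment> \<open>i.i.d. sample\<close>
  assumes M: "prob_space M"
    and indep: "prob_space.indep_vars M (\<lambda>_. borel) Y UNIV"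
    and ident: "\<And>i. distr M borel (Y i) = F"
  \<comment> \<open>densities, with respect to a common reference measure\<close>
    and \<nu>: "sigma_finite_measure \<nu>" "sets \<nu> = sets borel"
    and f: "\<And>\<theta>. \<theta> \<in> \<Theta> \<Longrightarrow> f \<theta> \<in> borel_measurable borel"
           "\<And>\<theta> y. \<theta> \<in> \<Theta> \<Longrightarrow> 0 \<le> f \<theta> y"
           "\<And>\<theta>. \<theta> \<in> \<Theta> \<Longrightarrow> (\<integral>\<^sup>+ y. ennreal (f \<theta> y) \<partial>\<nu>) = 1"
    and m_meas: "\<And>\<mu> P. (\<lambda>y. m y \<mu> P) \<in> borel_measurable borel"
    and h_meas: "\<And>P. (\<lambda>y. h y P) \<in> borel_measurable borel"
    and mu: "\<And>\<theta> P \<mu>. \<theta> \<in> \<Theta> \<Longrightarrow>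
               zero_mean (density \<nu> (\<lambda>y. ennreal (f \<theta> y))) (\<lambda>y. m y \<mu> P) \<longleftrightarrow> \<mu> = mu \<theta> P"
    and lam: "\<And>\<theta> P l. \<theta> \<in> \<Theta> \<Longrightarrow> el_multiplier F (\<lambda>y. m y (mu \<theta> P) P) l \<longleftrightarrow> l = lam \<theta> P"
    and a: "0 \<le> a" "a \<le> 1"
  \<comment> \<open>the plug-in estimator\<close>
    and P0: "\<And>P. zero_mean F (\<lambda>y. h y P) \<longleftrightarrow> P = P0"
    and Phat: "o_pr M (\<lambda>n. 1 / sqrt (real n))
                 (\<lambda>n \<omega>. (\<Sum>i<n. h (Y i \<omega>) (Phat n \<omega>)) /\<^sub>R real n)"
    and Phat_consistent: "consistent_for M Phat P0"
  \<comment> \<open>the maximum hybrid likelihood estimators for plug-in values \<open>Phat\<close> and \<open>P0\<close>\<close>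
    and thetahat_Phat: "with_prob_tending_to_one M (\<lambda>n \<omega>.
          sole_critical_maximizer \<Theta>
            (\<lambda>\<theta>. hybrid_loglik a f m mu n (\<lambda>i. Y i \<omega>) \<theta> (Phat n \<omega>)) (thetahat n \<omega> (Phat n \<omega>)))"
    and thetahat_P0: "with_prob_tending_to_one M (\<lambda>n \<omega>.
          sole_critical_maximizer \<Theta>
            (\<lambda>\<theta>. hybrid_loglik a f m mu n (\<lambda>i. Y i \<omega>) \<theta> P0) (thetahat n \<omega> P0))"
    and theta: "\<And>P. sole_critical_maximizer \<Theta>
          (\<lambda>\<theta>. eexpectation F (\<lambda>y. psi a f m mu lam y \<theta> P)) (theta P)"
  \<comment> \<open>the neighbourhood\<close>
    and N: "open N" "(theta P0, lam (theta P0) P0, P0) \<in> N" "N \<subseteq> \<Theta> \<times> UNIV"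
  \<comment> \<open>(i)\<close>
    and i_mu: "C2_on {(\<theta>, P). \<exists>l. (\<theta>, l, P) \<in> N} (\<lambda>(\<theta>, P). mu \<theta> P)"
    and i_diff: "\<And>\<theta> l P. (\<theta>, l, P) \<in> N \<Longrightarrow>
          AE y in F. \<exists>v. has_egrad (\<lambda>t. psi a f m mu lam y t P) v \<theta>"
    and i_int: "\<And>\<alpha>. \<alpha> \<in> N \<Longrightarrow> integrable F (joint_est_fun a f m mu lam h \<alpha>)"
    and i_C1: "C1_on N (expected_est_fun F a f m mu lam h)"
  \<comment> \<open>(ii)\<close>
    and ii_fourth: "\<exists>K. integrable F (\<lambda>y. K y ^ 4) \<and>
          (AE y in F. \<forall>(\<theta>, l, P) \<in> N.
             norm (m y (mu \<theta> P) P) \<le> K y \<and>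
             partials_bounded (\<lambda>(\<mu>, P). m y \<mu> P) (mu \<theta> P, P) (K y))"
    and ii_second: "\<exists>K. integrable F (\<lambda>y. (K y)\<^sup>2) \<and>
          (AE y in F. \<forall>(\<theta>, l, P) \<in> N.
             second_partials_bounded (\<lambda>(\<mu>, P). m y \<mu> P) (mu \<theta> P, P) (K y) \<and>
             (\<exists>v. has_egrad (\<lambda>t. elog (f t y)) v \<theta>) \<and>
             norm (score f y \<theta>) \<le> K y \<and>
             partials_bounded (score f y) \<theta> (K y))"
  \<comment> \<open>(iii)\<close>
    and iii: "\<exists>G'. (expected_est_fun F a f m mu lam h has_derivative G')
                   (at (theta P0, lam (theta P0) P0, P0)) \<and> bij G'"
  \<comment> \<open>(iv)\<close>
    and iv: "\<exists>L>0. \<forall>(\<theta>, l, P) \<in> N. AE y in F. 1 + l \<bullet> m y (mu \<theta> P) P > L"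
  \<comment> \<open>(v)\<close>
    and v: "\<exists>K. integrable F (\<lambda>y. (K y)\<^sup>2) \<and>
          (AE y in F. \<forall>(\<theta>, l, P) \<in> N.
             norm (h y P) \<le> K y \<and>
             (\<exists>h'. (h y has_derivative h') (at P) \<and> onorm h' \<le> K y))"
  shows "consistent_for M (\<lambda>n \<omega>. thetahat n \<omega> (Phat n \<omega>)) (theta P0) \<and>
         theta differentiable (at P0) \<and>
         o_pr M (\<lambda>n. 1 / sqrt (real n))
           (\<lambda>n \<omega>. thetahat n \<omega> (Phat n \<omega>)
                   - (thetahat n \<omega> P0 + jacobian theta (at P0) *v (Phat n \<omega> - P0)))"
proof -
  interpret iid_sample M Y F
    by (intro iid_sample.intro iid_sample_axioms.intro M indep ident)
  define \<theta>0 where "\<theta>0 = theta P0"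
  define l0 where "l0 = lam \<theta>0 P0"
  define \<alpha>0 where "\<alpha>0 = (\<theta>0, l0, P0)"
  have \<alpha>0: "(theta P0, lam (theta P0) P0, P0) = \<alpha>0" by (simp add: \<alpha>0_def \<theta>0_def l0_def)
  obtain r0 where r0: "0 < r0" "ball \<alpha>0 r0 \<subseteq> N"
    using N(1,2) open_contains_ball unfolding \<alpha>0 by blast
  let ?W = "{(\<theta>, P). \<exists>l. (\<theta>, l, P) \<in> N}"
  \<comment> \<open>Conditions on \<theta> and P alone are read off with the multiplier at
    \<open>l0\<close>.\<close>
  have in_N: "(\<theta>, l0, P) \<in> N" if "(\<theta>, P) \<in> ball (\<theta>0, P0) r0" for \<theta> P
    using that r0(2) by (auto simp: \<alpha>0_def dist_Pair_Pair subset_iff)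
  have "ball (\<theta>0, P0) r0 \<subseteq> ?W" using in_N by (auto intro!: exI[of _ l0])
  then obtain r Ck kd where r: "0 < r" "r \<le> r0" "1 \<le> Ck"
    and kd: "\<And>x. x \<in> ball (\<theta>0, P0) r \<Longrightarrow> ((\<lambda>x. ((\<lambda>(\<theta>, P). mu \<theta> P) x, snd x)) has_derivative blinfun_apply (kd x)) (at x)"
    "\<And>x. x \<in> ball (\<theta>0, P0) r \<Longrightarrow> kd differentiable (at x)" "\<And>x. x \<in> ball (\<theta>0, P0) r \<Longrightarrow> norm (kd x) \<le> Ck"
    "\<And>x x'. x \<in> ball (\<theta>0, P0) r \<Longrightarrow> x' \<in> ball (\<theta>0, P0) r \<Longrightarrow> norm (kd x - kd x') \<le> Ck * norm (x - x')"
    using C2_graph_bounds[OF i_mu _ r0(1)] by blast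
  have ballN: "ball \<alpha>0 r \<subseteq> N" using r0(2) r(2) by (meson order_trans subset_ball)
  have N1: "(fst x, l0, snd x) \<in> N" if "x \<in> ball (\<theta>0, P0) r" for x
    using in_N[of "fst x" "snd x"] that r(2) by (auto simp: subset_iff)
  have N2: "(\<theta>, l0, P0) \<in> N" if "\<theta> \<in> ball \<theta>0 r" for \<theta>
    using N1[of "(\<theta>, P0)"] that by (simp add: dist_Pair_Pair)
  have N3: "(\<theta>0, l0, P) \<in> N" if "P \<in> ball P0 r" for P
    using N1[of "(\<theta>0, P)"] that by (simp add: dist_Pair_Pair)

  obtain Ka where Ka: "integrable F (\<lambda>y. Ka y ^ 4)"
    "AE y in F. \<forall>(\<theta>, l, P) \<in> N. norm (m y (mu \<theta> P) P) \<le> Ka y \<and> partials_bounded (\<lambda>(\<mu>, P). m y \<mu> P) (mu \<theta> P, P) (Ka y)"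
    using ii_fourth by blast
  obtain Kb where Kb: "integrable F (\<lambda>y. (Kb y)\<^sup>2)"
    "AE y in F. \<forall>(\<theta>, l, P) \<in> N. second_partials_bounded (\<lambda>(\<mu>, P). m y \<mu> P) (mu \<theta> P, P) (Kb y) \<and>
             (\<exists>v. has_egrad (\<lambda>t. elog (f t y)) v \<theta>) \<and> norm (score f y \<theta>) \<le> Kb y \<and> partials_bounded (score f y) \<theta> (Kb y)"
    using ii_second by blast
  obtain Kc where Kc: "integrable F (\<lambda>y. (Kc y)\<^sup>2)"
    "AE y in F. \<forall>(\<theta>, l, P) \<in> N. norm (h y P) \<le> Kc y \<and> (\<exists>h'. (h y has_derivative h') (at P) \<and> onorm h' \<le> Kc y)"
    using v by blast
  obtain L where L: "L > 0" "\<And>\<theta> l P. (\<theta>, l, P) \<in> N \<Longrightarrow> AE y in F. 1 + l \<bullet> m y (mu \<theta> P) P > L"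
    using iv by (auto simp: case_prod_unfold Ball_def)
  \<comment> \<open>(iv) excludes a null set for each parameter separately. A countable dense set of
    parameters leaves a single null set, and continuity recovers the others.\<close>
  obtain Q :: "((real ^ 'p) \<times> (real ^ 'q) \<times> (real ^ 'r)) set" where Q: "countable Q" "\<And>X. open X \<Longrightarrow> X \<noteq> {} \<Longrightarrow> \<exists>d\<in>Q. d \<in> X"
    by (metis countable_dense_exists)
  have Qpos: "AE y in F. \<forall>z\<in>Q \<inter> N. 1 + fst (snd z) \<bullet> m y (mu (fst z) (snd (snd z))) (snd (snd z)) > L"
  proof (subst AE_ball_countable)
    show "countable (Q \<inter> N)" using Q(1) by blast
    show "\<forall>z\<in>Q \<inter> N. AE y in F. 1 + fst (snd z) \<bullet> m y (mu (fst z) (snd (snd z))) (snd (snd z)) > L"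
    proof
      fix z assume "z \<in> Q \<inter> N"
      then show "AE y in F. 1 + fst (snd z) \<bullet> m y (mu (fst z) (snd (snd z))) (snd (snd z)) > L"
        using L(2)[of "fst z" "fst (snd z)" "snd (snd z)"] by simp
    qed
  qed
  note ae = AE_conjI[OF AE_conjI[OF Ka(2) Kb(2)] AE_conjI[OF Kc(2) Qpos]]
  obtain \<Omega> where \<Omega>: "\<Omega> \<in> sets F" "AE y in F. y \<in> \<Omega>" and \<Omega>R: "\<And>y. y \<in> \<Omega> \<Longrightarrow>
      ((\<forall>(\<theta>, l, P) \<in> N. norm (m y (mu \<theta> P) P) \<le> Ka y \<and> partials_bounded (\<lambda>(\<mu>, P). m y \<mu> P) (mu \<theta> P, P) (Ka y)) \<and>
       (\<forall>(\<theta>, l, P) \<in> N. second_partials_bounded (\<lambda>(\<mu>, P). m y \<mu> P) (mu \<theta> P, P) (Kb y) \<and>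
             (\<exists>v. has_egrad (\<lambda>t. elog (f t y)) v \<theta>) \<and> norm (score f y \<theta>) \<le> Kb y \<and> partials_bounded (score f y) \<theta> (Kb y))) \<and>
      ((\<forall>(\<theta>, l, P) \<in> N. norm (h y P) \<le> Kc y \<and> (\<exists>h'. (h y has_derivative h') (at P) \<and> onorm h' \<le> Kc y)) \<and>
       (\<forall>z\<in>Q \<inter> N. 1 + fst (snd z) \<bullet> m y (mu (fst z) (snd (snd z))) (snd (snd z)) > L))"
    using AE_obtain_set[OF ae] by blast
  have \<Omega>a: "norm (m y (mu \<theta> P) P) \<le> Ka y \<and> partials_bounded (\<lambda>(\<mu>, P). m y \<mu> P) (mu \<theta> P, P) (Ka y)"
    if "y \<in> \<Omega>" "(\<theta>, l, P) \<in> N" for y \<theta> l P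
    using bspec[OF conjunct1[OF conjunct1[OF \<Omega>R[OF that(1)]]] that(2)] by simp
  have \<Omega>b: "second_partials_bounded (\<lambda>(\<mu>, P). m y \<mu> P) (mu \<theta> P, P) (Kb y) \<and>
      (\<exists>v. has_egrad (\<lambda>t. elog (f t y)) v \<theta>) \<and> norm (score f y \<theta>) \<le> Kb y \<and> partials_bounded (score f y) \<theta> (Kb y)"
    if "y \<in> \<Omega>" "(\<theta>, l, P) \<in> N" for y \<theta> l P
    using bspec[OF conjunct2[OF conjunct1[OF \<Omega>R[OF that(1)]]] that(2)] by simp
  have \<Omega>c: "norm (h y P) \<le> Kc y \<and> (\<exists>h'. (h y has_derivative h') (at P) \<and> onorm h' \<le> Kc y)"
    if "y \<in> \<Omega>" "(\<theta>, l, P) \<in> N" for y \<theta> l P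
    using bspec[OF conjunct1[OF conjunct2[OF \<Omega>R[OF that(1)]]] that(2)] by simp
  have \<Omega>d: "1 + fst (snd z) \<bullet> m y (mu (fst z) (snd (snd z))) (snd (snd z)) > L" if "y \<in> \<Omega>" "z \<in> Q \<inter> N" for y z
    using bspec[OF conjunct2[OF conjunct2[OF \<Omega>R[OF that(1)]]] that(2)] by simp

  define kk where "kk x = (mu (fst x) (snd x), snd x)" for x
  define M' where "M' y x = Blinfun (frechet_derivative (\<lambda>(\<mu>, P). m y \<mu> P) (at (kk x))) o\<^sub>L kd x" for y x
  let ?d = "real DIM((real ^ 's) \<times> (real ^ 'r))"
  have d1: "1 \<le> ?d" using DIM_positive[where 'a = "(real ^ 's) \<times> (real ^ 'r)"] by linarith
  have M': "((\<lambda>(\<theta>, P). m y (mu \<theta> P) P) has_derivative blinfun_apply (M' y x)) (at x)"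
      "norm (M' y x) \<le> ?d * \<bar>Ka y\<bar> * Ck" "M' y differentiable (at x)"
      "x' \<in> ball (\<theta>0, P0) r \<Longrightarrow> norm (M' y x - M' y x') \<le> (?d * \<bar>Ka y\<bar> * Ck + ?d * (?d * \<bar>Kb y\<bar>) * Ck * Ck) * norm (x - x')"
    if y: "y \<in> \<Omega>" and x: "x \<in> ball (\<theta>0, P0) r" for y x x'
  proof -
    have kd1: "(kk has_derivative blinfun_apply (kd x)) (at x)" if "x \<in> ball (\<theta>0, P0) r" for x
      using kd(1)[OF that] by (simp add: kk_def[abs_def] case_prod_unfold)
    have p1: "partials_bounded (\<lambda>(\<mu>, P). m y \<mu> P) (kk x) \<bar>Ka y\<bar>" if "x \<in> ball (\<theta>0, P0) r" for x
      using \<Omega>a[OF y N1[OF that]] unfolding partials_bounded_def kk_def by (meson abs_ge_self order_trans)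
    have p2: "second_partials_bounded (\<lambda>(\<mu>, P). m y \<mu> P) (kk x) \<bar>Kb y\<bar>" if "x \<in> ball (\<theta>0, P0) r" for x
      using \<Omega>b[OF y N1[OF that]] unfolding second_partials_bounded_def kk_def by (meson abs_ge_self order_trans)
    have nn: "0 \<le> Ck" using r(3) by simp
    have Mx: "M' y = (\<lambda>x. Blinfun (frechet_derivative (\<lambda>(\<mu>, P). m y \<mu> P) (at (kk x))) o\<^sub>L kd x)"
      by (simp add: M'_def[abs_def])
    have "((\<lambda>x. (\<lambda>(\<mu>, P). m y \<mu> P) (kk x)) has_derivative blinfun_apply (M' y x)) (at x)"
      unfolding Mx by (rule compose_second_order_bounds(1)[OF kd1 kd(2,3,4) p1 p2 nn abs_ge_zero abs_ge_zero x])
    then show "((\<lambda>(\<theta>, P). m y (mu \<theta> P) P) has_derivative blinfun_apply (M' y x)) (at x)"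
      by (simp add: kk_def case_prod_unfold)
    show "norm (M' y x) \<le> ?d * \<bar>Ka y\<bar> * Ck"
      unfolding Mx by (rule compose_second_order_bounds(2)[OF kd1 kd(2,3,4) p1 p2 nn abs_ge_zero abs_ge_zero x])
    show "M' y differentiable (at x)"
      unfolding Mx by (rule compose_second_order_bounds(3)[OF kd1 kd(2,3,4) p1 p2 nn abs_ge_zero abs_ge_zero x])
    show "norm (M' y x - M' y x') \<le> (?d * \<bar>Ka y\<bar> * Ck + ?d * (?d * \<bar>Kb y\<bar>) * Ck * Ck) * norm (x - x')"
      if x': "x' \<in> ball (\<theta>0, P0) r"
      unfolding Mx by (rule compose_second_order_bounds(4)[OF kd1 kd(2,3,4) p1 p2 nn abs_ge_zero abs_ge_zero x x'])
  qed
  \<comment> \<open>Large enough for every coefficient in the bounds: those in the Lipschitz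
    constant of \<open>M'\<close>, the dimension factor of the score, and 1 for
    \<open>h\<close>.\<close>
  define c where "c = ?d * Ck + ?d * ?d * Ck * Ck + real DIM(real ^ 'p) + 1"
  define K1 where "K1 y = ?d * Ck * \<bar>Ka y\<bar>" for y
  define K2 where "K2 y = c * (\<bar>Ka y\<bar> + \<bar>Kb y\<bar> + \<bar>Kc y\<bar>)" for y
  have nn: "0 \<le> ?d * Ck" "0 \<le> ?d * ?d * Ck * Ck" using r(3) by simp_all
  have c: "0 \<le> c" "?d * Ck \<le> c" "?d * ?d * Ck * Ck \<le> c" "real DIM(real ^ 'p) \<le> c" "1 \<le> c"
    unfolding c_def using nn by linarith+
  have dom: "\<alpha> * \<bar>Ka y\<bar> + \<beta> * \<bar>Kb y\<bar> + \<gamma> * \<bar>Kc y\<bar> \<le> K2 y" if "\<alpha> \<le> c" "\<beta> \<le> c" "\<gamma> \<le> c" for \<alpha> \<beta> \<gamma> y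
    unfolding K2_def distrib_left using that by (intro add_mono mult_right_mono) auto
  have dCk: "1 \<le> ?d * Ck" using mult_mono[OF d1 r(3)] by simp
  have Ka_le: "x \<le> K1 y" if "x \<le> Ka y" for x y
  proof -
    have "x \<le> 1 * \<bar>Ka y\<bar>" using that by simp
    also have "\<dots> \<le> K1 y" unfolding K1_def using dCk by (rule mult_right_mono) simp
    finally show ?thesis .
  qed
  have Kb_le: "x \<le> K2 y" if "x \<le> Kb y" for x y using dom[of 0 1 0 y] c that by simp
  have Kc_le: "x \<le> K2 y" if "x \<le> Kc y" for x y using dom[of 0 0 1 y] c that by simp
  note mK = abs_integrable_from_power[OF Ka(1)] abs_integrable_from_power[OF Kb(1)] abs_integrable_from_power[OF Kc(1)]
  have mKa: "(\<lambda>y. \<bar>Ka y\<bar>) \<in> borel_measurable F" "integrable F (\<lambda>y. \<bar>Ka y\<bar> ^ 4)" using mK(1,2) by simp_all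
  have mKb: "(\<lambda>y. \<bar>Kb y\<bar>) \<in> borel_measurable F" "(\<lambda>y. \<bar>Kc y\<bar>) \<in> borel_measurable F" using mK(3,5) by simp_all
  have Ka2: "integrable F (\<lambda>y. \<bar>Ka y\<bar>\<^sup>2)"
  proof (rule F.square_integrable_imp_integrable)
    show "integrable F (\<lambda>y. (\<bar>Ka y\<bar>\<^sup>2)\<^sup>2)" using mKa(2) by (simp flip: power_mult)
  qed (rule borel_measurable_power[OF mKa(1)])

  have "regular_hybrid_model M Y F a \<Theta> f m h mu lam theta P0 M' \<Omega> K1 K2 r L"
  proof (intro regular_hybrid_model.intro regular_hybrid_model_axioms.intro,
      unfold \<theta>0_def[symmetric], unfold l0_def[symmetric], unfold \<alpha>0_def[symmetric])
    show "iid_sample M Y F" by unfold_locales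
    show "0 \<le> a" "a \<le> 1" "0 < r" "\<Omega> \<in> sets F" "AE y in F. y \<in> \<Omega>" "0 < L" by fact+
    show "f \<theta> \<in> borel_measurable borel" if "\<theta> \<in> \<Theta>" for \<theta> using f(1)[OF that] .
    show "(\<lambda>y. m y \<mu> P) \<in> borel_measurable borel" for \<mu> P by (rule m_meas)
    show "(\<lambda>y. h y P) \<in> borel_measurable borel" for P by (rule h_meas)
    show "el_multiplier F (\<lambda>y. m y (mu \<theta> P) P) l \<longleftrightarrow> l = lam \<theta> P" if "\<theta> \<in> \<Theta>" for \<theta> P l using lam[OF that] .
    show "(\<integral>y. h y P0 \<partial>F) = 0" using P0[of P0] by (simp add: zero_mean_def)
    show "sole_critical_maximizer \<Theta> (\<lambda>\<theta>. eexpectation F (\<lambda>y. psi a f m mu lam y \<theta> P)) (theta P)" for P by (rule theta)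
    show "ball \<alpha>0 r \<subseteq> \<Theta> \<times> UNIV" using ballN N(3) by blast
    show "integrable F (joint_est_fun a f m mu lam h \<alpha>)" if "\<alpha> \<in> ball \<alpha>0 r" for \<alpha> using i_int ballN that by blast
    show "C1_on (ball \<alpha>0 r) (expected_est_fun F a f m mu lam h)"
      using i_C1 ballN unfolding C1_on_def by (meson continuous_on_subset subsetD)
    show "\<exists>G'. (expected_est_fun F a f m mu lam h has_derivative G') (at \<alpha>0) \<and> bij G'"
      using iii unfolding \<alpha>0 .
    show "K1 \<in> borel_measurable F" unfolding K1_def[abs_def] by (intro borel_measurable_times borel_measurable_const mKa)
    show "0 \<le> K1 y" for y unfolding K1_def by (rule mult_nonneg_nonneg[OF nn(1) abs_ge_zero])
    show "integrable F (\<lambda>y. K1 y ^ 4)" unfolding K1_def power_mult_distrib using mKa(2) by (intro integrable_mult_right)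
    show "K2 \<in> borel_measurable F" unfolding K2_def[abs_def]
      by (intro borel_measurable_times borel_measurable_const borel_measurable_add mKa mKb)
    then have K2m: "(\<lambda>y. (K2 y)\<^sup>2) \<in> borel_measurable F" by (rule borel_measurable_power)
    show "0 \<le> K2 y" for y unfolding K2_def using c(1) by simp
    show "integrable F (\<lambda>y. (K2 y)\<^sup>2)"
    proof (rule Bochner_Integration.integrable_bound[OF _ K2m])
      show "integrable F (\<lambda>y. c\<^sup>2 * (3 * (\<bar>Ka y\<bar>\<^sup>2 + \<bar>Kb y\<bar>\<^sup>2 + \<bar>Kc y\<bar>\<^sup>2)))"
        using Ka2 Kb(1) Kc(1) by simp
      have "(K2 y)\<^sup>2 \<le> c\<^sup>2 * (3 * (\<bar>Ka y\<bar>\<^sup>2 + \<bar>Kb y\<bar>\<^sup>2 + \<bar>Kc y\<bar>\<^sup>2))" for y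
        unfolding K2_def power_mult_distrib by (intro mult_left_mono square_sum3_le) simp
      then show "AE y in F. norm ((K2 y)\<^sup>2) \<le> norm (c\<^sup>2 * (3 * (\<bar>Ka y\<bar>\<^sup>2 + \<bar>Kb y\<bar>\<^sup>2 + \<bar>Kc y\<bar>\<^sup>2)))"
        by (intro AE_I2) (simp only: real_norm_def abs_of_nonneg zero_le_power2 order_trans[OF _ abs_ge_self])
    qed
    fix y assume y: "y \<in> \<Omega>"
    {
      fix x assume x: "x \<in> ball (\<theta>0, P0) r"
      show "((\<lambda>(\<theta>, P). m y (mu \<theta> P) P) has_derivative blinfun_apply (M' y x)) (at x)" "M' y differentiable (at x)"
        by (rule M'[OF y x])+
      show "norm (M' y x) \<le> K1 y" using M'(2)[OF y x] by (simp add: K1_def ac_simps)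
      fix x' assume x': "x' \<in> ball (\<theta>0, P0) r"
      have "norm (M' y x - M' y x') \<le> (?d * Ck * \<bar>Ka y\<bar> + ?d * ?d * Ck * Ck * \<bar>Kb y\<bar> + 0 * \<bar>Kc y\<bar>) * norm (x - x')"
        using M'(4)[OF y x x'] by (simp add: ac_simps)
      also have "\<dots> \<le> K2 y * norm (x - x')" by (intro mult_right_mono dom c) auto
      finally show "norm (M' y x - M' y x') \<le> K2 y * norm (x - x')" .
    }
    show "norm (m y (mu \<theta> P) P) \<le> K1 y" if "(\<theta>, P) \<in> ball (\<theta>0, P0) r" for \<theta> P
      using \<Omega>a[OF y N1[OF that]] by (intro Ka_le) simp
    have sd: "score f y differentiable (at \<theta>) \<and> has_egrad (\<lambda>t. elog (f t y)) (score f y \<theta>) \<theta> \<and> norm (score f y \<theta>) \<le> K2 y \<and>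
        (\<exists>s'. (score f y has_derivative s') (at \<theta>) \<and> (\<forall>v. norm (s' v) \<le> K2 y * norm v))" if \<theta>: "\<theta> \<in> ball \<theta>0 r" for \<theta>
    proof -
      note b = \<Omega>b[OF y N2[OF \<theta>]]
      obtain v where v: "has_egrad (\<lambda>t. elog (f t y)) v \<theta>" using b by blast
      then have "score f y \<theta> = v" unfolding score_def by (rule egrad_eq)
      with v have e: "has_egrad (\<lambda>t. elog (f t y)) (score f y \<theta>) \<theta>" by simp
      obtain s' where s': "(score f y has_derivative s') (at \<theta>)" "\<And>b. b \<in> Basis \<Longrightarrow> norm (s' b) \<le> Kb y"
        using b unfolding partials_bounded_def by blast
      have "norm (s' v) \<le> K2 y * norm v" for v
      proof -
        have "norm (s' v) \<le> real DIM(real ^ 'p) * \<bar>Kb y\<bar> * norm v"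
          using s' by (intro norm_le_basis_bound has_derivative_bounded_linear[OF s'(1)]) (auto intro: order_trans[OF _ abs_ge_self])
        also have "\<dots> \<le> K2 y * norm v"
          using dom[of 0 "real DIM(real ^ 'p)" 0 y] c by (intro mult_right_mono) auto
        finally show ?thesis .
      qed
      moreover have "norm (score f y \<theta>) \<le> K2 y" using b by (intro Kb_le) simp
      ultimately show ?thesis using e s'(1) unfolding differentiable_def by blast
    qed
    {
      fix \<theta> assume \<theta>: "\<theta> \<in> ball \<theta>0 r"
      show "has_egrad (\<lambda>t. elog (f t y)) (score f y \<theta>) \<theta>" "norm (score f y \<theta>) \<le> K2 y" "score f y differentiable (at \<theta>)"
        using sd[OF \<theta>] by simp_all
      fix \<theta>' assume \<theta>': "\<theta>' \<in> ball \<theta>0 r"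
      obtain s' where "\<And>t. t \<in> ball \<theta>0 r \<Longrightarrow> (score f y has_derivative s' t) (at t)"
        "\<And>t v. t \<in> ball \<theta>0 r \<Longrightarrow> norm (s' t v) \<le> K2 y * norm v"
        using sd by metis
      then show "norm (score f y \<theta> - score f y \<theta>') \<le> K2 y * norm (\<theta> - \<theta>')"
        using \<theta> \<theta>' \<open>0 \<le> K2 y\<close> by (rule differentiable_bound_ball)
    }
    have hd: "norm (h y P) \<le> K2 y \<and> (\<exists>h'. (h y has_derivative h') (at P) \<and> (\<forall>v. norm (h' v) \<le> K2 y * norm v))"
      if P: "P \<in> ball P0 r" for P
    proof -
      note b = \<Omega>c[OF y N3[OF P]]
      obtain h' where h': "(h y has_derivative h') (at P)" "onorm h' \<le> Kc y" using b by blast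
      have "norm (h' v) \<le> K2 y * norm v" for v
        by (rule order_trans[OF onorm[OF has_derivative_bounded_linear[OF h'(1)]]])
           (intro mult_right_mono Kc_le h' norm_ge_zero)
      moreover have "norm (h y P) \<le> K2 y" using b by (intro Kc_le) simp
      ultimately show ?thesis using h'(1) by blast
    qed
    {
      fix P assume P: "P \<in> ball P0 r"
      show "norm (h y P) \<le> K2 y" "h y differentiable (at P)" using hd[OF P] unfolding differentiable_def by blast+
      fix P' assume P': "P' \<in> ball P0 r"
      obtain h' where "\<And>t. t \<in> ball P0 r \<Longrightarrow> (h y has_derivative h' t) (at t)"
        "\<And>t v. t \<in> ball P0 r \<Longrightarrow> norm (h' t v) \<le> K2 y * norm v"
        using hd by metis
      then show "norm (h y P - h y P') \<le> K2 y * norm (P - P')"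
        using P P' \<open>0 \<le> K2 y\<close> by (rule differentiable_bound_ball)
    }
    fix \<theta> l P assume z: "(\<theta>, l, P) \<in> ball \<alpha>0 r"
    show "L \<le> 1 + l \<bullet> m y (mu \<theta> P) P"
    proof (rule ccontr)
      assume neg: "\<not> L \<le> 1 + l \<bullet> m y (mu \<theta> P) P"
      \<comment> \<open>The points of the ball where the expression is below \<open>L\<close> form
        an open set; were it nonempty, it would meet the dense set, on which the bound is already
        known.\<close>
      let ?q = "\<lambda>z. 1 + fst (snd z) \<bullet> (\<lambda>(\<theta>, P). m y (mu \<theta> P) P) (fst z, snd (snd z))"
      have c1: "continuous_on (ball (\<theta>0, P0) r) (\<lambda>(\<theta>, P). m y (mu \<theta> P) P)"
        by (intro continuous_at_imp_continuous_on ballI) (rule has_derivative_continuous[OF M'(1)[OF y]])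
      have c2: "(fst z, snd (snd z)) \<in> ball (\<theta>0, P0) r" if "z \<in> ball \<alpha>0 r" for z
        using that dist_drop_middle_le[of \<alpha>0 z] by (simp add: \<alpha>0_def)
      have c3: "continuous_on (ball \<alpha>0 r) (\<lambda>z. (fst z, snd (snd z)))" by (intro continuous_intros)
      have "continuous_on (ball \<alpha>0 r) (\<lambda>z. (\<lambda>(\<theta>, P). m y (mu \<theta> P) P) (fst z, snd (snd z)))"
        by (rule continuous_on_compose2[OF c1 c3]) (use c2 in blast)
      then have "continuous_on (ball \<alpha>0 r) ?q" by (intro continuous_intros)
      then have "open (?q -` {..<L} \<inter> ball \<alpha>0 r)" by (subst (asm) continuous_on_open_vimage) auto
      moreover have "(\<theta>, l, P) \<in> ?q -` {..<L} \<inter> ball \<alpha>0 r" using z neg by simp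
      ultimately obtain d where d: "d \<in> Q" "d \<in> ?q -` {..<L} \<inter> ball \<alpha>0 r" using Q(2) by blast
      then have "d \<in> Q \<inter> N" using ballN by blast
      from \<Omega>d[OF y this] d(2) show False by simp
    qed
  qed
  then interpret R: regular_hybrid_model M Y F a \<Theta> f m h mu lam theta P0 M' \<Omega> K1 K2 r L .
  obtain T' where T': "(theta has_derivative T') (at P0)"
    "consistent_for M (\<lambda>n \<omega>. thetahat n \<omega> (Phat n \<omega>)) (theta P0)"
    "o_pr M (\<lambda>n. 1 / sqrt (real n)) (\<lambda>n \<omega>. thetahat n \<omega> (Phat n \<omega>) - (thetahat n \<omega> P0 + T' (Phat n \<omega> - P0)))"
    using R.hybrid_plug_in_expansion[OF Phat Phat_consistent thetahat_Phat thetahat_P0] .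
  then have diff: "theta differentiable (at P0)" unfolding differentiable_def by blast
  then have "(theta has_derivative (\<lambda>v. jacobian theta (at P0) *v v)) (at P0)" by (simp only: jacobian_works)
  from has_derivative_unique[OF this T'(1)] have "T' = (\<lambda>v. jacobian theta (at P0) *v v)" by simp
  with T' diff show ?thesis by simp
qed

end
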